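(* For $i=1,2$ let $(\Omega_i,\Sigma_i,\mu_i)$ be $[0,1]$ or the real line $\mathbb{R}$ with Lebesgue measure, and let $E_i=E_i(\Omega_i)$ be a complex ideal Banach space of measurable functions on $(\Omega_i,\Sigma_i,\mu_i)$ containing the characteristic functions of all measurable sets of finite measure. (a) Suppose that $E_1$ and $E_2$ are both projection provided and free from $L_2$-components. Then for any (surjective linear) isometric isomorphism $Q:E_1\to E_2$ there exist a measurable function $q$ on $\Omega_2$ and an invertible measurable transformation $\varphi:\Omega_2\to\Omega_1$ such that $$(Qf)(t)=q(t)\,f(\varphi(t))\qquad\text{for all } f\in E_1$$ (equality for almost every $t\in\Omega_2$). (b) The same conclusion holds if, instead, $E_1$ and $E_2$ are symmetric spaces and the norm of $E_1$ is not proportional to the norm of $L_2(\Omega_1,\Sigma_1,\mu_1)$: for any (surjective linear) isometric isomorphism $Q:E_1\to E_2$ there exist a measurable function $q$ on $\Omega_2$ and an invertible measurable transformation $\varphi:\Omega_2\to\Omega_1$ such that $(Qf)(t)=q(t)f(\varphi(t))$ for all $f\in E_1$.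
   Context: All spaces are over $\mathbb{C}$. For a measure space $(\Omega,\Sigma,\mu)$, $L^0(\Omega,\Sigma,\mu)$ denotes the space of (classes modulo a.e. equality of) measurable complex-valued functions. Functions, sets and transformations are understood modulo null sets; in particular a measurable transformation $\varphi:\Omega_2\to\Omega_1$ is invertible if it has a measurable inverse up to null sets, and $f\mapsto f\circ\varphi$ is well defined on a.e.-equivalence classes. A Banach space $E\subset L^0(\Omega,\Sigma,\mu)$ is an ideal space if $f\in E$, $g\in L^0$, $|g|\le|f|$ a.e. imply $g\in E$ and $\|g\|\le\|f\|$. An ideal space $E$ is symmetric (rearrangement-invariant) if, in addition, whenever $f\in E$, $g\in L^0$ and $|f|$, $|g|$ are equimeasurable (have the same distribution function), then $g\in E$ and $\|g\|=\|f\|$. Let $\Sigma_0=\{\sigma\in\Sigma:\mu(\sigma)<\infty\}$ and for $\sigma\in\Sigma$ let $\rho_\sigma(x)=\chi_\sigma x$, $x\in E$. The image $\rho_\sigma E$ is called a component of $E$. An ideal space $E$ is projection provided if for each finite collection $\overline{\omega}=\{\omega_i\}_{i=1}^n$ of pairwise disjoint sets $\omega_i\in\Sigma_0$ (not all null) there exists a linear projector $\rho^c_{\overline\omega}$ of norm 1 from $E$ onto the subspace of step functions $E^n(\overline\omega)=\{\sum_{i=1}^n c_i\chi_{\omega_i}: c_i\in\mathbb{C}\}$ that commutes with the projectors $\rho_{\omega_i}$, $i=1,\dots,n$. An ideal space $E$ is free from $L_2$-components if for each component $\rho_\sigma E$ (with $\mu(\sigma)>0$) the norm of $E$ on $\rho_\sigma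 E$ does not coincide with the norm of $L_2(\nu)$ for any positive measure $\nu$ on $\Sigma$ (restricted to $\sigma$). The norm of $E$ is proportional to the norm of $L_2(\mu)$ if there is a constant $k>0$ with $\|f\|_E=k\|f\|_{L_2(\mu)}$ for all $f\in E$. *)

theory Defs
  imports "HOL-Analysis.Analysis"
begin

text \<open>
  An element of \<open>L\<^sup>0(M)\<close> is represented by a measurable function; a space \<open>E\<close> of classes modulo
  almost everywhere equality is represented by the set of all representatives of its members
  (the ideal property makes \<open>E\<close> closed under a.e. equality and \<open>N\<close> constant on classes).
  Equality of classes is always written as an \<open>AE\<close> statement. Values off \<open>space M\<close> and values of
  \<open>N\<close> off \<open>E\<close> are irrelevant.
\<close>

locale ideal_banach_space =
  fixes M :: "'a measure" and E :: "('a \<Rightarrow> complex) set" and N :: "('a \<Rightarrow> complex) \<Rightarrow> real"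
  assumes measurable: "E \<subseteq> borel_measurable M"
    and zero: "(\<lambda>t. 0) \<in> E"
    and add: "f \<in> E \<Longrightarrow> g \<in> E \<Longrightarrow> (\<lambda>t. f t + g t) \<in> E"
    and scale: "f \<in> E \<Longrightarrow> (\<lambda>t. c * f t) \<in> E"
    and norm_nonneg: "f \<in> E \<Longrightarrow> 0 \<le> N f"
    and norm_eq_0: "f \<in> E \<Longrightarrow> N f = 0 \<longleftrightarrow> (AE t in M. f t = 0)"
    and norm_triangle: "f \<in> E \<Longrightarrow> g \<in> E \<Longrightarrow> N (\<lambda>t. f t + g t) \<le> N f + N g"
    and norm_scale: "f \<in> E \<Longrightarrow> N (\<lambda>t. c * f t) = cmod c * N f"
    and complete: "(\<And>n. F n \<in> E) \<Longrightarrow>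
      (\<And>e. e > 0 \<Longrightarrow> \<exists>K::nat. \<forall>m\<ge>K. \<forall>n\<ge>K. N (\<lambda>t. F m t - F n t) < e) \<Longrightarrow>
      \<exists>f\<in>E. (\<lambda>n. N (\<lambda>t. F n t - f t)) \<longlonglongrightarrow> 0"
    and ideal: "f \<in> E \<Longrightarrow> g \<in> borel_measurable M \<Longrightarrow> (AE t in M. cmod (g t) \<le> cmod (f t)) \<Longrightarrow>
      g \<in> E \<and> N g \<le> N f"

definition equimeasurable :: "'a measure \<Rightarrow> ('a \<Rightarrow> real) \<Rightarrow> ('a \<Rightarrow> real) \<Rightarrow> bool" where
  "equimeasurable M f g \<longleftrightarrow>
     (\<forall>s\<ge>0. emeasure M {t \<in> space M. f t > s} = emeasure M {t \<in> space M. g t > s})"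

locale symmetric_space = ideal_banach_space +
  assumes symmetric: "f \<in> E \<Longrightarrow> g \<in> borel_measurable M \<Longrightarrow>
      equimeasurable M (\<lambda>t. cmod (f t)) (\<lambda>t. cmod (g t)) \<Longrightarrow> g \<in> E \<and> N g = N f"

definition contains_finite_indicators :: "'a measure \<Rightarrow> ('a \<Rightarrow> complex) set \<Rightarrow> bool" where
  "contains_finite_indicators M E \<longleftrightarrow> (\<forall>A\<in>sets M. emeasure M A < \<infinity> \<longrightarrow> indicator A \<in> E)"

definition rho :: "'a set \<Rightarrow> ('a \<Rightarrow> complex) \<Rightarrow> 'a \<Rightarrow> complex" where
  "rho \<sigma> f = (\<lambda>t. indicator \<sigma> t * f t)"

definition L2_space :: "'a measure \<Rightarrow> ('a \<Rightarrow> complex) set" where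
  "L2_space M = {f \<in> borel_measurable M. integrable M (\<lambda>t. (cmod (f t))\<^sup>2)}"

definition L2_norm :: "'a measure \<Rightarrow> ('a \<Rightarrow> complex) \<Rightarrow> real" where
  "L2_norm M f = sqrt (\<integral>t. (cmod (f t))\<^sup>2 \<partial>M)"

definition free_from_L2_components ::
  "'a measure \<Rightarrow> ('a \<Rightarrow> complex) set \<Rightarrow> (('a \<Rightarrow> complex) \<Rightarrow> real) \<Rightarrow> bool" where
  "free_from_L2_components M E N \<longleftrightarrow>
     (\<forall>\<sigma>\<in>sets M. emeasure M \<sigma> > 0 \<longrightarrow>
        \<not> (\<exists>\<nu>. sets \<nu> = sets (restrict_space M \<sigma>) \<and>
               (\<forall>f \<in> rho \<sigma> ` E. f \<in> L2_space \<nu> \<and> N f = L2_norm \<nu> f)))"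

definition proportional_to_L2 ::
  "'a measure \<Rightarrow> ('a \<Rightarrow> complex) set \<Rightarrow> (('a \<Rightarrow> complex) \<Rightarrow> real) \<Rightarrow> bool" where
  "proportional_to_L2 M E N \<longleftrightarrow>
     (\<exists>k>0. \<forall>f\<in>E. f \<in> L2_space M \<and> N f = k * L2_norm M f)"

text \<open>Linear maps between spaces of classes, given by their action on representatives.\<close>

definition linear_map ::
  "'a measure \<Rightarrow> ('a \<Rightarrow> complex) set \<Rightarrow> 'b measure \<Rightarrow> ('b \<Rightarrow> complex) set \<Rightarrow>
   (('a \<Rightarrow> complex) \<Rightarrow> ('b \<Rightarrow> complex)) \<Rightarrow> bool" where
  "linear_map M E M' E' T \<longleftrightarrow>
     (\<forall>f\<in>E. T f \<in> E') \<and>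
     (\<forall>f\<in>E. \<forall>g\<in>E. (AE t in M. f t = g t) \<longrightarrow> (AE t in M'. T f t = T g t)) \<and>
     (\<forall>f\<in>E. \<forall>g\<in>E. AE t in M'. T (\<lambda>s. f s + g s) t = T f t + T g t) \<and>
     (\<forall>c. \<forall>f\<in>E. AE t in M'. T (\<lambda>s. c * f s) t = c * T f t)"

definition has_operator_norm ::
  "('a \<Rightarrow> complex) set \<Rightarrow> (('a \<Rightarrow> complex) \<Rightarrow> real) \<Rightarrow> (('b \<Rightarrow> complex) \<Rightarrow> real) \<Rightarrow>
   (('a \<Rightarrow> complex) \<Rightarrow> ('b \<Rightarrow> complex)) \<Rightarrow> real \<Rightarrow> bool" where
  "has_operator_norm E N N' T c \<longleftrightarrow>
     0 \<le> c \<and> (\<forall>f\<in>E. N' (T f) \<le> c * N f) \<and>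
     (\<forall>c'\<ge>0. (\<forall>f\<in>E. N' (T f) \<le> c' * N f) \<longrightarrow> c \<le> c')"

definition projector_onto ::
  "'a measure \<Rightarrow> ('a \<Rightarrow> complex) set \<Rightarrow> ('a \<Rightarrow> complex) set \<Rightarrow>
   (('a \<Rightarrow> complex) \<Rightarrow> ('a \<Rightarrow> complex)) \<Rightarrow> bool" where
  "projector_onto M E S P \<longleftrightarrow>
     linear_map M E M E P \<and>
     (\<forall>f\<in>E. AE t in M. P (P f) t = P f t) \<and>
     (\<forall>f\<in>E. \<exists>s\<in>S. AE t in M. P f t = s t) \<and>
     (\<forall>s\<in>S. \<exists>f\<in>E. AE t in M. P f t = s t)"

definition step_functions :: "nat \<Rightarrow> (nat \<Rightarrow> 'a set) \<Rightarrow> ('a \<Rightarrow> complex) set" where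
  "step_functions n \<omega> = range (\<lambda>c t. \<Sum>i<n. c i * indicator (\<omega> i) t)"

definition projection_provided ::
  "'a measure \<Rightarrow> ('a \<Rightarrow> complex) set \<Rightarrow> (('a \<Rightarrow> complex) \<Rightarrow> real) \<Rightarrow> bool" where
  "projection_provided M E N \<longleftrightarrow>
     (\<forall>n \<omega>. (\<forall>i<n. \<omega> i \<in> sets M \<and> emeasure M (\<omega> i) < \<infinity>) \<and>
            disjoint_family_on \<omega> {..<n} \<and>
            (\<exists>i<n. emeasure M (\<omega> i) > 0) \<longrightarrow>
        (\<exists>P. projector_onto M E (step_functions n \<omega>) P \<and>
             has_operator_norm E N N P 1 \<and>
             (\<forall>i<n. \<forall>f\<in>E. AE t in M. P (rho (\<omega> i) f) t = rho (\<omega> i) (P f) t)))"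

definition isometric_isomorphism ::
  "'a measure \<Rightarrow> ('a \<Rightarrow> complex) set \<Rightarrow> (('a \<Rightarrow> complex) \<Rightarrow> real) \<Rightarrow>
   'b measure \<Rightarrow> ('b \<Rightarrow> complex) set \<Rightarrow> (('b \<Rightarrow> complex) \<Rightarrow> real) \<Rightarrow>
   (('a \<Rightarrow> complex) \<Rightarrow> ('b \<Rightarrow> complex)) \<Rightarrow> bool" where
  "isometric_isomorphism M E N M' E' N' Q \<longleftrightarrow>
     linear_map M E M' E' Q \<and>
     (\<forall>f\<in>E. N' (Q f) = N f) \<and>
     (\<forall>g\<in>E'. \<exists>f\<in>E. AE t in M'. Q f t = g t)"

text \<open>
  Preimages of null sets must be null for \<open>f \<mapsto> f \<circ> \<phi>\<close> to be well defined on classes.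
\<close>

definition nonsingular :: "'b measure \<Rightarrow> 'a measure \<Rightarrow> ('b \<Rightarrow> 'a) \<Rightarrow> bool" where
  "nonsingular M' M \<phi> \<longleftrightarrow>
     \<phi> \<in> measurable M' M \<and> (\<forall>A\<in>null_sets M. \<phi> -` A \<inter> space M' \<in> null_sets M')"

definition invertible_transformation :: "'b measure \<Rightarrow> 'a measure \<Rightarrow> ('b \<Rightarrow> 'a) \<Rightarrow> bool" where
  "invertible_transformation M' M \<phi> \<longleftrightarrow>
     nonsingular M' M \<phi> \<and>
     (\<exists>\<psi>. nonsingular M M' \<psi> \<and>
          (AE t in M'. \<psi> (\<phi> t) = t) \<and> (AE s in M. \<phi> (\<psi> s) = s))"

end

theory Submission
  imports Defs
begin

text \<open>
  For a measurable set \<open>A\<close> the map \<open>R = Q \<rho>\<^sub>A Q\<inverse>\<close> on \<open>E\<^sub>2\<close> is Hermitian: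
  \<open>\<parallel>f + i s R f\<parallel> \<le> (1 + C s\<^sup>2) \<parallel>f\<parallel>\<close> for real \<open>s\<close>, because \<open>\<bar>1 + i s \<chi>\<^sub>A\<bar> \<le> 1 + s\<^sup>2 / 2\<close>.
  If some Hermitian map does not commute with all \<open>\<rho>\<^sub>B\<close>, it couples two disjoint sets; compressing
  it by a norm-one projector onto step functions gives a Hermitian \<open>2 \<times> 2\<close> matrix, whose
  one-parameter group of isometries is a group of rotations. Hence the norm depends on the two
  coefficients \<open>a, b\<close> only through \<open>\<bar>a\<bar>\<^sup>2 + \<theta> \<bar>b\<bar>\<^sup>2\<close>. In case (a) this makes a component of the space an
  \<open>L\<^sub>2\<close>-component; in case (b), where averaging is a norm-one projector and all sets of equal measure
  are alike, it makes the norm proportional to that of \<open>L\<^sub>2\<close>.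
  Otherwise \<open>Q \<rho>\<^sub>A Q\<inverse> = \<rho>\<^bsub>\<Phi> A\<^esub>\<close> for an isomorphism \<open>\<Phi>\<close> of the measure algebras, which is induced by
  a point map \<open>\<phi>\<close> of the real line, and \<open>Q f = q (f \<circ> \<phi>)\<close> with \<open>q = Q w / (w \<circ> \<phi>)\<close> for any \<open>w > 0\<close> in \<open>E\<^sub>1\<close>.
\<close>

section \<open>Ideal function spaces\<close>

text \<open>The obstacle is the absence of order continuity: neither step functions nor bounded
  functions need be dense in \<open>E\<close>, so an identity cannot be checked on them and extended
  by continuity. Locality of a Hermitian map is therefore proved for an arbitrary element by a
  growth argument, and the formula for \<open>Q\<close> by approximating \<open>f / w\<close>
  uniformly by step functions on sets where it is bounded, with all errors measured against
  \<open>w\<close>. Norm convergence of truncations comes from completeness, once their differences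
  have been estimated. The one-parameter group is never formed: powers of \<open>1 + i s T\<close>
  with \<open>s\<close> of order \<open>1 / l\<close> are controlled by
  \<open>(1 + C s^2)^l <= exp (C s^2 l)\<close>. The same bound excludes nilpotent parts. Set maps
  are needed in both directions, \<open>\<Phi>\<close> for \<open>Q\<close> and
  \<open>\<Psi>\<close> for its inverse, so Hermitian maps must be local on both spaces; in case (b)
  the hypothesis on the first space passes to the second by the parallelogram law.\<close>

lemma measurable_rho [measurable]:
  assumes [measurable]: "A \<in> sets M" "f \<in> borel_measurable M"
  shows "rho A f \<in> borel_measurable M"
  unfolding rho_def by measurable

lemma rho_rho: "rho A (rho B f) = rho (A \<inter> B) f"
  by (auto simp: rho_def fun_eq_iff split: split_indicator)

lemma rho_apply: "rho A f t = (if t \<in> A then f t else 0)"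
  by (simp add: rho_def)

lemma cmod_rho_le: "cmod (rho A f t) \<le> cmod (f t)"
  by (simp add: rho_apply)

lemma rho_indicator: "rho A (indicator B) = indicator (A \<inter> B)"
  by (auto simp: rho_def fun_eq_iff split: split_indicator)

text \<open>Everything up to the set maps runs over an abstract sigma-finite measure, with
  atomlessness added for case (b). The real line enters only when set maps are turned into point
  maps.\<close>

locale ideal_function_space = ideal_banach_space M E N + sigma_finite_measure M
  for M :: "'a measure" and E N +
  assumes indicator_in: "A \<in> sets M \<Longrightarrow> emeasure M A < \<infinity> \<Longrightarrow> indicator A \<in> E"
begin

lemma meas [measurable_dest]: "f \<in> E \<Longrightarrow> f \<in> borel_measurable M"
  using measurable by auto

lemma dominated_in: "f \<in> E \<Longrightarrow> g \<in> borel_measurable M \<Longrightarrow> AE t in M. cmod (g t) \<le> cmod (f t) \<Longrightarrow> g \<in> E"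
  and norm_mono: "f \<in> E \<Longrightarrow> g \<in> borel_measurable M \<Longrightarrow> AE t in M. cmod (g t) \<le> cmod (f t) \<Longrightarrow> N g \<le> N f"
  using ideal by blast+

lemma norm_mono_in: "f \<in> E \<Longrightarrow> g \<in> E \<Longrightarrow> AE t in M. cmod (g t) \<le> cmod (f t) \<Longrightarrow> N g \<le> N f"
  using norm_mono meas by blast

lemma norm_cong_cmod: "f \<in> E \<Longrightarrow> g \<in> E \<Longrightarrow> AE t in M. cmod (f t) = cmod (g t) \<Longrightarrow> N f = N g"
  by (intro antisym norm_mono_in) auto

lemma norm_cong: "f \<in> E \<Longrightarrow> g \<in> E \<Longrightarrow> AE t in M. f t = g t \<Longrightarrow> N f = N g"
  by (intro norm_cong_cmod) auto

lemma cong_in: "f \<in> E \<Longrightarrow> g \<in> borel_measurable M \<Longrightarrow> AE t in M. f t = g t \<Longrightarrow> g \<in> E"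
  by (rule dominated_in) auto

lemma rho_in: "A \<in> sets M \<Longrightarrow> f \<in> E \<Longrightarrow> rho A f \<in> E"
  by (rule dominated_in) (auto simp: cmod_rho_le)

lemma norm_rho_le: "A \<in> sets M \<Longrightarrow> f \<in> E \<Longrightarrow> N (rho A f) \<le> N f"
  by (rule norm_mono_in) (auto simp: cmod_rho_le rho_in)

lemma norm_zero: "N (\<lambda>t. 0) = 0"
  using norm_eq_0[OF zero] by simp

lemma minus_in: "f \<in> E \<Longrightarrow> (\<lambda>t. - f t) \<in> E"
  using scale[of f "-1"] by simp

lemma diff_in: "f \<in> E \<Longrightarrow> g \<in> E \<Longrightarrow> (\<lambda>t. f t - g t) \<in> E"
  using add[of f "\<lambda>t. - g t"] minus_in[of g] by simp

lemma norm_minus: "f \<in> E \<Longrightarrow> N (\<lambda>t. - f t) = N f"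
  using norm_scale[of f "-1"] by simp

lemma norm_minus_commute: "f \<in> E \<Longrightarrow> g \<in> E \<Longrightarrow> N (\<lambda>t. f t - g t) = N (\<lambda>t. g t - f t)"
  using norm_minus[of "\<lambda>t. f t - g t"] diff_in by simp

lemma norm_triangle_diff: "f \<in> E \<Longrightarrow> g \<in> E \<Longrightarrow> N (\<lambda>t. f t - g t) \<le> N f + N g"
  using norm_triangle[of f "\<lambda>t. - g t"] minus_in norm_minus by simp

lemma norm_le_add_diff: "f \<in> E \<Longrightarrow> g \<in> E \<Longrightarrow> N f \<le> N g + N (\<lambda>t. f t - g t)"
  using norm_triangle[of g "\<lambda>t. f t - g t"] diff_in by simp

lemma abs_norm_diff_le: "f \<in> E \<Longrightarrow> g \<in> E \<Longrightarrow> \<bar>N f - N g\<bar> \<le> N (\<lambda>t. f t - g t)"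
  using norm_le_add_diff[of f g] norm_le_add_diff[of g f] norm_minus_commute[of f g] by linarith

lemma sum_in: "finite I \<Longrightarrow> (\<And>i. i \<in> I \<Longrightarrow> f i \<in> E) \<Longrightarrow> (\<lambda>t. \<Sum>i\<in>I. f i t) \<in> E"
  by (induction I rule: finite_induct) (auto intro: zero add)

lemma norm_sum_le: "finite I \<Longrightarrow> (\<And>i. i \<in> I \<Longrightarrow> f i \<in> E) \<Longrightarrow> N (\<lambda>t. \<Sum>i\<in>I. f i t) \<le> (\<Sum>i\<in>I. N (f i))"
proof (induction I rule: finite_induct)
  case (insert x I)
  then have "N (\<lambda>t. f x t + (\<Sum>i\<in>I. f i t)) \<le> N (f x) + N (\<lambda>t. \<Sum>i\<in>I. f i t)"
    by (intro norm_triangle sum_in) auto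
  with insert show ?case by fastforce
qed (simp add: norm_zero)

lemma step_in:
  "finite I \<Longrightarrow> (\<And>i. i \<in> I \<Longrightarrow> \<omega> i \<in> sets M \<and> emeasure M (\<omega> i) < \<infinity>) \<Longrightarrow>
    (\<lambda>t. \<Sum>i\<in>I. c i * indicator (\<omega> i) t) \<in> E"
  by (intro sum_in scale indicator_in) auto

lemma bounded_dominated:
  assumes "f \<in> E" "g \<in> borel_measurable M" "0 \<le> c" "AE t in M. cmod (g t) \<le> c * cmod (f t)"
  shows "g \<in> E" "N g \<le> c * N f"
proof -
  have s: "(\<lambda>t. complex_of_real c * f t) \<in> E" using assms scale by simp
  have ae: "AE t in M. cmod (g t) \<le> cmod (complex_of_real c * f t)"
    using assms(3,4) by (simp add: norm_mult)
  show "g \<in> E" using dominated_in[OF s assms(2) ae] .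
  show "N g \<le> c * N f"
    using norm_mono[OF s assms(2) ae] norm_scale[OF assms(1), of "complex_of_real c"] assms(3) by simp
qed

lemma bounded_support:
  assumes "A \<in> sets M" "emeasure M A < \<infinity>" "g \<in> borel_measurable M" "0 \<le> c"
    "\<And>t. t \<in> space M \<Longrightarrow> t \<in> A \<Longrightarrow> cmod (g t) \<le> c" "\<And>t. t \<in> space M \<Longrightarrow> t \<notin> A \<Longrightarrow> g t = 0"
  shows "g \<in> E" "N g \<le> c * N (indicator A)"
proof -
  have "AE t in M. cmod (g t) \<le> c * cmod (indicator A t :: complex)"
    using assms(5,6) by (auto intro!: AE_I2 split: split_indicator)
  then show "g \<in> E" "N g \<le> c * N (indicator A)"
    using bounded_dominated[OF indicator_in] assms by blast+
qed

lemma norm_indicator_pos: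
  assumes "A \<in> sets M" "emeasure M A < \<infinity>" "0 < emeasure M A"
  shows "0 < N (indicator A)"
proof -
  have i: "indicator A \<in> E" using assms indicator_in by simp
  have "\<not> (AE t in M. (indicator A t :: complex) = 0)"
  proof
    assume "AE t in M. (indicator A t :: complex) = 0"
    then have "AE t in M. t \<notin> A" by (auto simp: indicator_eq_0_iff)
    then have "A \<in> null_sets M" using assms(1) by (simp add: AE_iff_null_sets)
    then show False using assms(3) by auto
  qed
  then show ?thesis using norm_eq_0[OF i] norm_nonneg[OF i] by linarith
qed

text \<open>For large \<open>n\<close> the function \<open>g - f\<close>, cut off to
  \<open>A\<close>, is dominated by \<open>F n - f\<close>, whose norm tends to 0. Since the terms
  are eventually constant on \<open>A\<close>, the limit is identified without passing to an a.e.
  convergent subsequence.\<close>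

lemma norm_limit_eq_on:
  assumes F: "\<And>n. F n \<in> E" and f: "f \<in> E" and lim: "(\<lambda>n. N (\<lambda>t. F n t - f t)) \<longlonglongrightarrow> 0"
    and A: "A \<in> sets M" and g: "g \<in> borel_measurable M"
    and ev: "\<forall>\<^sub>F n in sequentially. AE t in M. t \<in> A \<longrightarrow> F n t = g t"
  shows "AE t in M. t \<in> A \<longrightarrow> f t = g t"
proof -
  have [measurable]: "f \<in> borel_measurable M" "A \<in> sets M" "g \<in> borel_measurable M" using meas f A g by auto
  let ?d = "rho A (\<lambda>t. g t - f t)"
  obtain n0 where n0: "AE t in M. t \<in> A \<longrightarrow> F n0 t = g t"
    using ev eventually_sequentially by auto
  have dE: "?d \<in> E"
    by (rule dominated_in[OF diff_in[OF F[of n0] f]]) (use n0 in \<open>auto simp: rho_apply\<close>)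
  have "\<forall>\<^sub>F n in sequentially. N ?d \<le> N (\<lambda>t. F n t - f t)"
    using ev by eventually_elim (rule norm_mono[OF diff_in[OF F f]], auto simp: rho_apply)
  then have "N ?d \<le> 0" using lim tendsto_lowerbound by fastforce
  then have "AE t in M. ?d t = 0" using norm_eq_0[OF dE] norm_nonneg[OF dE] by simp
  then show ?thesis by eventually_elim (auto simp: rho_apply split: if_splits)
qed

text \<open>The norm limit supplied by completeness agrees with \<open>f\<close> on every
  \<open>X k\<close>, hence a.e. The first conclusion constructs elements of \<open>E\<close>; the
  second is the substitute for order continuity, available whenever the truncations are known to be
  Cauchy.\<close>

lemma riesz_fischer:
  assumes f: "f \<in> borel_measurable M" and X: "range X \<subseteq> sets M" "incseq X" "(\<Union>n. X n) = space M"
    and E: "\<And>n. rho (X n) f \<in> E"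
    and cauchy: "\<And>e. e > 0 \<Longrightarrow> \<exists>K::nat. \<forall>m\<ge>K. \<forall>n\<ge>K. N (\<lambda>t. rho (X m) f t - rho (X n) f t) < e"
  shows "f \<in> E" "(\<lambda>n. N (\<lambda>t. rho (X n) f t - f t)) \<longlonglongrightarrow> 0"
proof -
  obtain g where g: "g \<in> E" "(\<lambda>n. N (\<lambda>t. rho (X n) f t - g t)) \<longlonglongrightarrow> 0"
    using complete[OF E cauchy] by blast
  have "AE t in M. t \<in> X k \<longrightarrow> g t = f t" for k
  proof (rule norm_limit_eq_on[OF E g(1) g(2) _ f])
    show "X k \<in> sets M" using X by auto
    have "t \<in> X n" if "k \<le> n" "t \<in> X k" for t n using X(2) that by (auto simp: incseq_def)
    then show "\<forall>\<^sub>F n in sequentially. AE t in M. t \<in> X k \<longrightarrow> rho (X n) f t = f t"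
      by (auto simp: eventually_sequentially rho_apply intro!: exI[of _ k])
  qed
  then have "AE t in M. \<forall>k. t \<in> X k \<longrightarrow> g t = f t" by (subst AE_all_countable) blast
  then have eq: "AE t in M. g t = f t" using AE_space by eventually_elim (use X(3) in blast)
  show fE: "f \<in> E" using cong_in[OF g(1) f eq] .
  have "N (\<lambda>t. rho (X n) f t - f t) = N (\<lambda>t. rho (X n) f t - g t)" for n
    by (rule norm_cong[OF diff_in[OF E fE] diff_in[OF E g(1)]]) (use eq in auto)
  then show "(\<lambda>n. N (\<lambda>t. rho (X n) f t - f t)) \<longlonglongrightarrow> 0" using g(2) by simp
qed

text \<open>A weak unit of \<open>E\<close>: a series of indicators of a partition into sets of
  finite measure, with coefficients so small that it converges in norm. It serves as a test function
  that vanishes nowhere and as a denominator.\<close>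

lemma pos_element: "\<exists>w\<in>E. (\<forall>t\<in>space M. \<exists>r>0. w t = complex_of_real r)"
proof -
  obtain A :: "nat \<Rightarrow> 'a set" where A: "range A \<subseteq> sets M" "(\<Union>i. A i) = space M"
     "\<And>i. emeasure M (A i) \<noteq> \<infinity>" "disjoint_family A"
    using sigma_finite_disjoint by blast
  have Am[measurable]: "A i \<in> sets M" for i using A(1) by auto
  have iE: "indicator (A i) \<in> E" for i using A(3)[of i] Am by (intro indicator_in) (auto simp: less_top)
  \<comment> \<open>The \<open>1 +\<close> keeps the quotient meaningful when \<open>A i\<close> is
    null and its indicator has norm 0.\<close>
  define a where "a i = (1/2)^i / (1 + N (indicator (A i)))" for i
  have apos: "a i > 0" for i using norm_nonneg[OF iE[of i]] by (auto simp: a_def)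
  have aN: "a i * N (indicator (A i)) \<le> (1/2)^i" for i
  proof -
    have "N (indicator (A i)) / (1 + N (indicator (A i))) \<le> 1" using norm_nonneg[OF iE[of i]] by simp
    then have "(1/2)^i * (N (indicator (A i)) / (1 + N (indicator (A i)))) \<le> (1/2)^i"
      by (intro mult_left_le) auto
    then show ?thesis unfolding a_def by simp
  qed
  define w where "w t = complex_of_real (\<Sum>i. a i * indicator (A i) t)" for t
  have w_on: "w t = of_real (a i)" if "t \<in> A i" for t i
  proof -
    have "t \<notin> A j" if "j \<noteq> i" for j using A(4) that \<open>t \<in> A i\<close> by (auto simp: disjoint_family_on_def)
    then have "(\<lambda>j. a j * indicator (A j) t) = (\<lambda>j. if j = i then a i else 0)"
      using that by (auto simp: fun_eq_iff)
    moreover have "(\<Sum>j. if j = i then a i else 0) = a i" 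
      using sums_unique[OF sums_single[of i "\<lambda>_. a i"]] by simp
    ultimately show ?thesis unfolding w_def by presburger
  qed
  define X where "X n = (\<Union>i<n. A i)" for n
  have Xm[measurable]: "X n \<in> sets M" for n unfolding X_def by measurable
  have fin: "emeasure M (A i) < \<infinity>" for i using A(3)[of i] by (simp add: less_top)
  have rX: "rho (X n) w t = (\<Sum>i<n. of_real (a i) * indicator (A i) t)" for n t
  proof (cases "t \<in> X n")
    case True
    then obtain i where i: "i < n" "t \<in> A i" by (auto simp: X_def)
    then have "t \<notin> A j" if "j \<noteq> i" for j using A(4) that by (auto simp: disjoint_family_on_def)
    then have "(\<Sum>j<n. of_real (a j) * indicator (A j) t) = (\<Sum>j<n. if j = i then complex_of_real (a i) else 0)"
      using i by (intro sum.cong) auto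
    then show ?thesis using i True by (simp add: rho_apply w_on)
  next
    case False
    then show ?thesis by (auto simp: rho_apply X_def)
  qed
  have rE: "rho (X n) w \<in> E" for n
  proof -
    have "(\<lambda>t. \<Sum>i<n. of_real (a i) * indicator (A i) t) \<in> E"
      using fin by (intro step_in) auto
    moreover have "rho (X n) w = (\<lambda>t. \<Sum>i<n. of_real (a i) * indicator (A i) t)"
      by (rule ext) (rule rX)
    ultimately show ?thesis by (simp only:)
  qed
  have d1: "N (\<lambda>t. rho (X m) w t - rho (X n) w t) \<le> 2 * (1/2)^n" if "n \<le> m" for m n
  proof -
    have "(\<lambda>t. rho (X m) w t - rho (X n) w t) = (\<lambda>t. \<Sum>i\<in>{n..<m}. of_real (a i) * indicator (A i) t)"
      by (simp only: rX sum_diff_nat_ivl[of 0 n m, OF _ that, simplified atLeast0LessThan, OF le0])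
    then have "N (\<lambda>t. rho (X m) w t - rho (X n) w t) \<le> (\<Sum>i\<in>{n..<m}. N (\<lambda>t. of_real (a i) * indicator (A i) t))"
      using norm_sum_le[of "{n..<m}" "\<lambda>i t. of_real (a i) * indicator (A i) t"] scale iE by simp
    also have "\<dots> = (\<Sum>i\<in>{n..<m}. a i * N (indicator (A i)))"
      using norm_scale[OF iE] apos by (intro sum.cong) (auto simp: less_imp_le)
    also have "\<dots> \<le> (\<Sum>i\<in>{n..<m}. (1/2)^i)" by (intro sum_mono aN)
    also have "\<dots> \<le> 2 * (1/2)^n"
    proof -
      have "(\<Sum>i\<in>{n..<m}. (1/2::real)^i) = 2 * (1/2)^n - 2 * (1/2)^m"
        using that by (induction m rule: dec_induct) auto
      then show ?thesis by simp
    qed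
    finally show ?thesis .
  qed
  have w_m: "w \<in> borel_measurable M" unfolding w_def by measurable
  have "w \<in> E"
  proof (rule riesz_fischer(1)[OF w_m])
    show "range X \<subseteq> sets M" by auto
    show "incseq X" unfolding incseq_def X_def by (intro allI impI UN_mono) auto
    show "(\<Union>n. X n) = space M" using A(2) by (auto simp: X_def)
    show "rho (X n) w \<in> E" for n by (rule rE)
    fix e :: real assume "e > 0"
    obtain K where K: "(1/2::real)^K < e/2" using real_arch_pow_inv[of "e/2" "1/2"] \<open>e > 0\<close> by auto
    have "N (\<lambda>t. rho (X m) w t - rho (X n) w t) < e" if "K \<le> m" "K \<le> n" for m n
    proof -
      have "N (\<lambda>t. rho (X m) w t - rho (X n) w t) \<le> 2 * (1/2)^(min m n)"
        using d1[of n m] d1[of m n] norm_minus_commute[OF rE[of m] rE[of n]] by (cases "n \<le> m") auto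
      also have "\<dots> \<le> 2 * (1/2)^K" using that by (simp add: power_decreasing)
      finally show ?thesis using K by simp
    qed
    then show "\<exists>K. \<forall>m\<ge>K. \<forall>n\<ge>K. N (\<lambda>t. rho (X m) w t - rho (X n) w t) < e" by blast
  qed
  moreover have "\<exists>r>0. w t = complex_of_real r" if "t \<in> space M" for t
  proof -
    have "t \<in> (\<Union>i. A i)" using A(2) that by simp
    then obtain i where "t \<in> A i" by (rule UN_E)
    then show ?thesis using w_on apos by blast
  qed
  ultimately show ?thesis by blast
qed

end

section \<open>Hermitian maps and coupled step functions\<close>

lemma linear_map_in: "linear_map M E M' E' T \<Longrightarrow> f \<in> E \<Longrightarrow> T f \<in> E'"
  and linear_map_cong: "linear_map M E M' E' T \<Longrightarrow> f \<in> E \<Longrightarrow> g \<in> E \<Longrightarrow> AE t in M. f t = g t \<Longrightarrow>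
    AE t in M'. T f t = T g t"
  and linear_map_add: "linear_map M E M' E' T \<Longrightarrow> f \<in> E \<Longrightarrow> g \<in> E \<Longrightarrow>
    AE t in M'. T (\<lambda>s. f s + g s) t = T f t + T g t"
  and linear_map_scale: "linear_map M E M' E' T \<Longrightarrow> f \<in> E \<Longrightarrow> AE t in M'. T (\<lambda>s. c * f s) t = c * T f t"
  unfolding linear_map_def by blast+

text \<open>Powers \<open>(1 + i s K)^l\<close> with \<open>K\<close> nilpotent grow like
  \<open>\<bar>s\<bar> * l\<close>, while the Hermitian inequality allows only
  \<open>(1 + C s^2)^l\<close>. With \<open>s = t / l\<close> and \<open>l >= t^2\<close> the latter
  stays below \<open>exp C\<close>, whereas \<open>\<bar>s\<bar> * l = t\<close> is as large as
  desired.\<close>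

lemma exp_dominates_linear:
  fixes a b C :: real
  assumes "0 \<le> C" "0 \<le> b" and le: "\<And>(s::real) (l::nat). \<bar>s\<bar> * real l * a \<le> (1 + C * s\<^sup>2) ^ l * b"
  shows "a \<le> 0"
proof (rule ccontr)
  assume "\<not> a \<le> 0"
  then have a: "a > 0" by simp
  \<comment> \<open>Chosen so that \<open>t * a\<close> exceeds the bound \<open>exp C * b\<close>
    by 1.\<close>
  define t where "t = (exp C * b + 1) / a"
  have t: "t > 0" using a assms(2) by (auto simp: t_def intro!: divide_pos_pos add_nonneg_pos)
  obtain l :: nat where l: "l \<ge> 1" "t\<^sup>2 \<le> real l"
    by (metis real_arch_simple max.cobounded1 max.coboundedI2 of_nat_le_iff order_trans)
  have "t * a = \<bar>t / l\<bar> * real l * a" using l t by simp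
  also have "\<dots> \<le> (1 + C * (t / l)\<^sup>2) ^ l * b" by (rule le)
  also have "(1 + C * (t / l)\<^sup>2) ^ l \<le> exp (C * (t / l)\<^sup>2) ^ l"
    using assms(1) by (intro power_mono) (auto simp: exp_ge_add_one_self)
  also have "\<dots> = exp (C * (t\<^sup>2 / l))"
    using l by (simp add: exp_of_nat_mult[symmetric] power2_eq_square field_simps)
  also have "\<dots> \<le> exp C"
    using l assms(1) mult_left_le[of "t\<^sup>2 / real l" C] by simp
  finally have "t * a \<le> exp C * b" using assms(2) by (simp add: mult_right_mono)
  then show False using a by (simp add: t_def)
qed

text \<open>The factor \<open>1 + i tan x\<close> is the rotation by \<open>x\<close> stretched by
  \<open>1 / cos x >= 1\<close>, and \<open>mono\<close> discards the stretching. Composing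
  \<open>n\<close> rotations by \<theta> / n costs a factor at most
  \<open>exp (C n tan(\<theta>/n)^2)\<close>, which tends to 1. Thus no rotation increases
  \<open>G\<close>, and applying this to the opposite rotation gives equality.\<close>

lemma rotation_invariant:
  fixes G :: "complex \<Rightarrow> real"
  assumes C: "0 \<le> C" and nn: "\<And>z. 0 \<le> G z"
    and le: "\<And>s z. G ((1 + \<i> * complex_of_real s) * z) \<le> (1 + C * s\<^sup>2) * G z"
    and mono: "\<And>r z. r \<ge> 1 \<Longrightarrow> G z \<le> G (complex_of_real r * z)"
  shows "G z = G (complex_of_real (cmod z))"
proof -
  have small: "G (cis x * z) \<le> (1 + C * (tan x)\<^sup>2) * G z" if "\<bar>x\<bar> < pi / 2" for x z
  proof -
    have c: "cos x > 0" using that by (intro cos_gt_zero_pi) auto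
    have "1 + \<i> * complex_of_real (tan x) = complex_of_real (1 / cos x) * cis x"
      using c by (simp add: complex_eq_iff tan_def)
    moreover have "G (cis x * z) \<le> G (complex_of_real (1 / cos x) * (cis x * z))"
      using c by (intro mono) auto
    ultimately show ?thesis using le[of "tan x" z] by (simp add: mult.assoc)
  qed
  have iter: "G (cis (real n * x) * z) \<le> (1 + C * (tan x)\<^sup>2) ^ n * G z" if x: "\<bar>x\<bar> < pi / 2" for x n z
  proof (induction n)
    case (Suc n)
    have "G (cis (real (Suc n) * x) * z) = G (cis x * (cis (real n * x) * z))"
      by (simp add: cis_mult mult.assoc[symmetric] algebra_simps)
    also have "\<dots> \<le> (1 + C * (tan x)\<^sup>2) * G (cis (real n * x) * z)" by (rule small[OF x])
    also have "\<dots> \<le> (1 + C * (tan x)\<^sup>2) * ((1 + C * (tan x)\<^sup>2) ^ n * G z)"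
      using Suc C by (intro mult_left_mono) auto
    finally show ?case by simp
  qed simp
  have rot: "G (cis \<theta> * z) \<le> G z" for \<theta> z
  proof -
    have lim0: "(\<lambda>n::nat. real n * (tan (\<theta> / real n))\<^sup>2) \<longlonglongrightarrow> 0"
    proof (rule tendsto_sandwich[OF always_eventually])
      show "\<forall>n. 0 \<le> real n * (tan (\<theta> / real n))\<^sup>2" by simp
      have "(\<lambda>n::nat. cos (\<theta> / real n)) \<longlonglongrightarrow> cos 0"
        by (intro tendsto_cos lim_const_over_n)
      then have "\<forall>\<^sub>F n in sequentially. 1 / 2 < cos (\<theta> / real n)" by (rule order_tendstoD) simp
      then show "\<forall>\<^sub>F n in sequentially. real n * (tan (\<theta> / real n))\<^sup>2 \<le> (4 * \<theta>\<^sup>2) / real n"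
        using eventually_gt_at_top[of 0]
      proof eventually_elim
        case (elim n)
        have "\<bar>tan (\<theta> / real n)\<bar> \<le> \<bar>\<theta> / real n\<bar> / (1 / 2)"
          unfolding tan_def abs_divide[of "sin _"] using elim abs_sin_x_le_abs_x[of "\<theta> / real n"]
          by (intro frac_le) auto
        then have "(tan (\<theta> / real n))\<^sup>2 \<le> (2 * (\<theta> / real n))\<^sup>2"
          by (intro abs_le_square_iff[THEN iffD1]) (simp add: abs_mult mult.commute)
        then have "real n * (tan (\<theta> / real n))\<^sup>2 \<le> real n * (2 * (\<theta> / real n))\<^sup>2"
          by (intro mult_left_mono) auto
        also have "\<dots> = (4 * \<theta>\<^sup>2) / real n" using elim by (simp add: power2_eq_square)
        finally show ?case .
      qed
    qed (auto intro: lim_const_over_n)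
    have "(\<lambda>n::nat. exp (C * (real n * (tan (\<theta> / real n))\<^sup>2)) * G z) \<longlonglongrightarrow> exp (C * 0) * G z"
      by (intro tendsto_intros lim0)
    moreover have "\<forall>\<^sub>F n in sequentially. G (cis \<theta> * z) \<le> exp (C * (real n * (tan (\<theta> / real n))\<^sup>2)) * G z"
    proof -
      have "(\<lambda>n::nat. \<bar>\<theta> / real n\<bar>) \<longlonglongrightarrow> 0"
        by (intro tendsto_rabs_zero lim_const_over_n)
      then have "\<forall>\<^sub>F n in sequentially. \<bar>\<theta> / real n\<bar> < pi / 2" by (rule order_tendstoD) simp
      then show ?thesis using eventually_gt_at_top[of 0]
      proof eventually_elim
        case (elim n)
        have "G (cis \<theta> * z) \<le> (1 + C * (tan (\<theta> / real n))\<^sup>2) ^ n * G z"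
          using iter[OF elim(1), of n z] elim(2) by simp
        also have "\<dots> \<le> exp (C * (tan (\<theta> / real n))\<^sup>2) ^ n * G z"
          using C nn by (intro mult_right_mono power_mono) (auto simp: exp_ge_add_one_self)
        also have "\<dots> = exp (C * (real n * (tan (\<theta> / real n))\<^sup>2)) * G z"
          by (simp add: exp_of_nat_mult[symmetric] algebra_simps)
        finally show ?case .
      qed
    qed
    ultimately have "G (cis \<theta> * z) \<le> exp (C * 0) * G z"
      using tendsto_lowerbound trivial_limit_sequentially by blast
    then show ?thesis by simp
  qed
  have z: "z = cis (Arg z) * complex_of_real (cmod z)" using rcis_cmod_Arg[of z] by (simp add: rcis_def mult.commute)
  have "G z \<le> G (complex_of_real (cmod z))" using rot[of "Arg z" "complex_of_real (cmod z)"] z by simp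
  moreover have "cis (- Arg z) * z = complex_of_real (cmod z)"
    by (subst z) (simp add: mult.assoc[symmetric] cis_mult)
  then have "G (complex_of_real (cmod z)) \<le> G z" using rot[of "- Arg z" z] by simp
  ultimately show ?thesis by simp
qed

section \<open>Hermitian maps, norm-one averaging and the coupling of two coordinates\<close>

context ideal_function_space
begin

text \<open>A quantitative form of Vidav's condition, that the norm of \<open>1 + i s T\<close> is 1
  up to second order in real \<open>s\<close>. The explicit constant \<open>C\<close> makes it
  possible to bound powers of \<open>1 + i s T\<close> without defining an exponential.\<close>

definition hermitian where
  "hermitian T C \<longleftrightarrow> linear_map M E M E T \<and> 0 \<le> C \<and>
     (\<forall>s::real. \<forall>f\<in>E. N (\<lambda>t. f t + \<i> * complex_of_real s * T f t) \<le> (1 + C * s\<^sup>2) * N f)"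

definition finite_family where
  "finite_family n \<omega> \<longleftrightarrow> (\<forall>i<n. \<omega> i \<in> sets M \<and> emeasure M (\<omega> i) < \<infinity>) \<and> disjoint_family_on \<omega> {..<n::nat}"

text \<open>The \<open>\<phi> i\<close> are the coefficient functionals of a norm-one projector onto
  step functions that commutes with the cut-offs to the \<open>\<omega> i\<close>. Working with
  scalars makes linearity an exact equality. On a null \<open>\<omega> i\<close> the other
  conditions force \<open>\<phi> i = 0\<close>, so the normalisation is demanded only for positive
  measure.\<close>

definition averaging where
  "averaging n \<omega> \<phi> \<longleftrightarrow>
     (\<forall>i<n::nat. \<forall>f\<in>E. \<forall>g\<in>E. (AE t in M. f t = g t) \<longrightarrow> \<phi> i f = \<phi> i g) \<and>
     (\<forall>i<n. \<forall>f\<in>E. \<forall>g\<in>E. \<phi> i (\<lambda>t. f t + g t) = \<phi> i f + \<phi> i g) \<and>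
     (\<forall>i<n. \<forall>c. \<forall>f\<in>E. \<phi> i (\<lambda>t. c * f t) = c * \<phi> i f) \<and>
     (\<forall>i<n. \<forall>f\<in>E. \<phi> i (rho (\<omega> i) f) = \<phi> i f) \<and>
     (\<forall>i<n. emeasure M (\<omega> i) > 0 \<longrightarrow> \<phi> i (indicator (\<omega> i)) = 1) \<and>
     (\<forall>f\<in>E. N (\<lambda>t. \<Sum>i<n. \<phi> i f * indicator (\<omega> i) t) \<le> N f)"

definition has_averaging where
  "has_averaging \<longleftrightarrow> (\<forall>n \<omega>. finite_family n \<omega> \<longrightarrow> (\<exists>\<phi>. averaging n \<omega> \<phi>))"

text \<open>Supports are not enlarged. For linear maps this amounts to commuting with every
  \<open>rho A\<close>.\<close>

definition local_map where
  "local_map T \<longleftrightarrow> (\<forall>A\<in>sets M. \<forall>f\<in>E. AE t in M. t \<notin> A \<longrightarrow> T (rho A f) t = 0)"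

lemma step_at:
  assumes "finite_family n \<omega>" "m < n" "t \<in> \<omega> m"
  shows "(\<Sum>i<n. c i * indicator (\<omega> i) t) = (c m :: complex)"
proof -
  have "t \<notin> \<omega> i" if "i < n" "i \<noteq> m" for i
    using assms that by (auto simp: finite_family_def disjoint_family_on_def)
  then have "(\<Sum>i<n. c i * indicator (\<omega> i) t) = (\<Sum>i<n. if i = m then c m else 0)"
    using assms(3) by (intro sum.cong) auto
  then show ?thesis using assms(2) by simp
qed

lemma step_off: "(\<And>m. m < n \<Longrightarrow> t \<notin> \<omega> m) \<Longrightarrow> (\<Sum>i<n. c i * indicator (\<omega> i) t) = (0::complex)"
  by (intro sum.neutral) auto

lemma family_step_in: "finite_family n \<omega> \<Longrightarrow> (\<lambda>t. \<Sum>i<n. c i * indicator (\<omega> i) t) \<in> E"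
  by (rule step_in) (auto simp: finite_family_def)

lemma rho_step:
  assumes "finite_family n \<omega>" "m < n"
  shows "rho (\<omega> m) (\<lambda>t. \<Sum>i<n. c i * indicator (\<omega> i) t) = (\<lambda>t. c m * indicator (\<omega> m) t)"
  using step_at[OF assms] by (auto simp: rho_apply fun_eq_iff)

lemma step_mono:
  assumes "finite_family n \<omega>" "\<And>m. m < n \<Longrightarrow> cmod (c m) \<le> cmod (d m)"
  shows "N (\<lambda>t. \<Sum>i<n. c i * indicator (\<omega> i) t) \<le> N (\<lambda>t. \<Sum>i<n. d i * indicator (\<omega> i) t)"
proof (rule norm_mono_in[OF family_step_in[OF assms(1)] family_step_in[OF assms(1)]], rule AE_I2)
  fix t assume "t \<in> space M"
  show "cmod (\<Sum>i<n. c i * indicator (\<omega> i) t) \<le> cmod (\<Sum>i<n. d i * indicator (\<omega> i) t)"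
  proof (cases "\<exists>m<n. t \<in> \<omega> m")
    case True
    then obtain m where "m < n" "t \<in> \<omega> m" by blast
    then show ?thesis using step_at[OF assms(1)] assms(2) by simp
  next
    case False
    then show ?thesis using step_off[of n t \<omega>] by simp
  qed
qed

lemma step_cong_cmod:
  assumes "finite_family n \<omega>" "\<And>m. m < n \<Longrightarrow> cmod (c m) = cmod (d m)"
  shows "N (\<lambda>t. \<Sum>i<n. c i * indicator (\<omega> i) t) = N (\<lambda>t. \<Sum>i<n. d i * indicator (\<omega> i) t)"
  using assms by (intro antisym step_mono) auto

lemma step_component_le:
  assumes "finite_family n \<omega>" "m < n"
  shows "cmod (c m) * N (indicator (\<omega> m)) \<le> N (\<lambda>t. \<Sum>i<n. c i * indicator (\<omega> i) t)"
proof -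
  have w: "\<omega> m \<in> sets M" "emeasure M (\<omega> m) < \<infinity>" using assms by (auto simp: finite_family_def)
  have "cmod (c m) * N (indicator (\<omega> m)) = N (rho (\<omega> m) (\<lambda>t. \<Sum>i<n. c i * indicator (\<omega> i) t))"
    unfolding rho_step[OF assms] using norm_scale[OF indicator_in[OF w]] by simp
  also have "\<dots> \<le> N (\<lambda>t. \<Sum>i<n. c i * indicator (\<omega> i) t)"
    by (rule norm_rho_le[OF w(1) family_step_in[OF assms(1)]])
  finally show ?thesis .
qed

text \<open>
  The off-diagonal part of \<open>T\<close> with respect to \<open>A, B\<close> is the average of \<open>a b D\<^bsub>ab\<^esub> T D\<^bsub>ab\<^esub>\<close> over the signs
  \<open>a, b\<close>, where the isometry \<open>D\<^bsub>ab\<^esub>\<close> multiplies by \<open>a\<close> on \<open>A\<close> and by \<open>b\<close> on \<open>B\<close>.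
\<close>

lemma hermitian_off_diagonal:
  assumes T: "hermitian T C" and A: "A \<in> sets M" "B \<in> sets M" "A \<inter> B = {}" and x: "x \<in> E"
  shows "N (\<lambda>t. x t + \<i> * complex_of_real s * (rho B (T (rho A x)) t + rho A (T (rho B x)) t)) \<le> (1 + C * s\<^sup>2) * N x"
proof -
  have lin: "linear_map M E M E T" and
    le: "\<And>s f. f \<in> E \<Longrightarrow> N (\<lambda>t. f t + \<i> * complex_of_real s * T f t) \<le> (1 + C * s\<^sup>2) * N f"
    using T by (auto simp: hermitian_def)
  have [measurable]: "A \<in> sets M" "B \<in> sets M" "x \<in> borel_measurable M" using A x meas by auto
  define D where "D a b f t = (if t \<in> A then a * f t else if t \<in> B then b * f t else f t)"
    for a b :: complex and f :: "'a \<Rightarrow> complex" and t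
  define S where "S = {-1, 1::complex}"
  have cmodD: "cmod (D a b f t) = cmod (f t)" if "a \<in> S" "b \<in> S" for a b f t
    using that by (auto simp: D_def S_def norm_mult)
  have Dm: "D a b f \<in> borel_measurable M" if "f \<in> E" for a b f
  proof -
    have [measurable]: "f \<in> borel_measurable M" using that meas by auto
    show ?thesis unfolding D_def by measurable
  qed
  have DE: "D a b f \<in> E" and DN: "N (D a b f) = N f" if "a \<in> S" "b \<in> S" "f \<in> E" for a b f
  proof -
    show *: "D a b f \<in> E" by (rule dominated_in[OF that(3) Dm[OF that(3)]]) (simp add: cmodD that)
    show "N (D a b f) = N f" by (rule norm_cong_cmod[OF * that(3)]) (simp add: cmodD that)
  qed
  define R where "R = space M - (A \<union> B)"
  have Rm[measurable]: "R \<in> sets M" unfolding R_def by auto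
  have xin: "rho A x \<in> E" "rho B x \<in> E" "rho R x \<in> E" using rho_in A x Rm by auto
  have TD: "AE t in M. T (D a b x) t = a * T (rho A x) t + b * T (rho B x) t + T (rho R x) t"
    if "a \<in> S" "b \<in> S" for a b
  proof -
    let ?g = "\<lambda>t. (a * rho A x t + b * rho B x t) + rho R x t"
    have g: "(\<lambda>t. a * rho A x t + b * rho B x t) \<in> E" "?g \<in> E"
      using add[OF add[OF scale[OF xin(1)] scale[OF xin(2)]] xin(3)] add[OF scale[OF xin(1)] scale[OF xin(2)]] by auto
    have "AE t in M. T (D a b x) t = T ?g t"
      using A(3) by (intro linear_map_cong[OF lin DE[OF that x] g(2)] AE_I2) (auto simp: D_def rho_apply R_def)
    moreover note linear_map_add[OF lin g(1) xin(3)]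
      linear_map_add[OF lin scale[OF xin(1), of a] scale[OF xin(2), of b]]
      linear_map_scale[OF lin xin(1), of a] linear_map_scale[OF lin xin(2), of b]
    ultimately show ?thesis by eventually_elim simp
  qed
  \<comment> \<open>Since \<open>D a b\<close> is an involution, \<open>z a b\<close> is
    \<open>x + i s a b D T D x\<close>. The sign \<open>a b\<close> is absorbed into the real
    parameter \<open>s\<close>, where it does not affect the bound in \<open>s^2\<close>.\<close>
  define z where "z a b = D a b (\<lambda>t. D a b x t + \<i> * complex_of_real (s * Re (a * b)) * T (D a b x) t)" for a b
  have zE: "z a b \<in> E" and zN: "N (z a b) \<le> (1 + C * s\<^sup>2) * N x" if "a \<in> S" "b \<in> S" for a b
  proof -
    have i: "(\<lambda>t. D a b x t + \<i> * complex_of_real (s * Re (a * b)) * T (D a b x) t) \<in> E"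
      by (intro add scale linear_map_in[OF lin] DE that x)
    show "z a b \<in> E" unfolding z_def by (intro DE that i)
    have "N (z a b) = N (\<lambda>t. D a b x t + \<i> * complex_of_real (s * Re (a * b)) * T (D a b x) t)"
      unfolding z_def by (rule DN[OF that i])
    also have "\<dots> \<le> (1 + C * (s * Re (a * b))\<^sup>2) * N x"
      using le[OF DE[OF that x], of "s * Re (a * b)"] unfolding DN[OF that x] .
    also have "(s * Re (a * b))\<^sup>2 = s\<^sup>2" using that by (auto simp: S_def power2_eq_square)
    finally show "N (z a b) \<le> (1 + C * s\<^sup>2) * N x" .
  qed
  have S1: "1 \<in> S" "-1 \<in> S" by (auto simp: S_def)
  let ?y = "\<lambda>t. x t + \<i> * complex_of_real s * (rho B (T (rho A x)) t + rho A (T (rho B x)) t)"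
  let ?u = "\<lambda>t. (z 1 1 t + z 1 (-1) t) + (z (-1) 1 t + z (-1) (-1) t)"
  have uE: "(\<lambda>t. z 1 1 t + z 1 (-1) t) \<in> E" "(\<lambda>t. z (-1) 1 t + z (-1) (-1) t) \<in> E" "?u \<in> E"
    using zE S1 by (auto intro!: add)
  have yE: "?y \<in> E" using A xin by (intro add scale rho_in linear_map_in[OF lin] x) auto
  \<comment> \<open>In the sum over the four signs the terms of \<open>T (rho R x)\<close> and the
    diagonal terms cancel, and so does everything off \<open>A\<close> and \<open>B\<close> except
    \<open>x\<close>; each off-diagonal term survives four times.\<close>
  have eq: "AE t in M. ?u t = 4 * ?y t"
    using TD[OF S1(1) S1(1)] TD[OF S1(1) S1(2)] TD[OF S1(2) S1(1)] TD[OF S1(2) S1(2)]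
  proof eventually_elim
    case (elim t)
    have "t \<in> A \<Longrightarrow> t \<notin> B" using A(3) by blast
    then show ?case
      by (cases "t \<in> A"; cases "t \<in> B") (simp_all add: z_def D_def[of _ _ _ t] elim rho_apply algebra_simps)
  qed
  have "4 * N ?y = N (\<lambda>t. 4 * ?y t)" using norm_scale[OF yE, of 4] by simp
  also have "\<dots> = N ?u" by (rule norm_cong[OF scale[OF yE] uE(3)]) (use eq in auto)
  also have "\<dots> \<le> (N (z 1 1) + N (z 1 (-1))) + (N (z (-1) 1) + N (z (-1) (-1)))"
    using norm_triangle[OF uE(1,2)] norm_triangle[OF zE zE, OF S1(1) S1(1) S1(1) S1(2)]
      norm_triangle[OF zE zE, OF S1(2) S1(1) S1(2) S1(2)] by linarith
  also have "\<dots> \<le> 4 * ((1 + C * s\<^sup>2) * N x)"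
    using zN[OF S1(1) S1(1)] zN[OF S1(1) S1(2)] zN[OF S1(2) S1(1)] zN[OF S1(2) S1(2)] by linarith
  finally show ?thesis by simp
qed

lemma
  assumes "averaging n \<omega> \<phi>"
  shows averaging_cong: "\<And>m f g. m < n \<Longrightarrow> f \<in> E \<Longrightarrow> g \<in> E \<Longrightarrow> AE t in M. f t = g t \<Longrightarrow> \<phi> m f = \<phi> m g"
    and averaging_add: "\<And>m f g. m < n \<Longrightarrow> f \<in> E \<Longrightarrow> g \<in> E \<Longrightarrow> \<phi> m (\<lambda>t. f t + g t) = \<phi> m f + \<phi> m g"
    and averaging_scale: "\<And>m c f. m < n \<Longrightarrow> f \<in> E \<Longrightarrow> \<phi> m (\<lambda>t. c * f t) = c * \<phi> m f"
    and averaging_rho: "\<And>m f. m < n \<Longrightarrow> f \<in> E \<Longrightarrow> \<phi> m (rho (\<omega> m) f) = \<phi> m f"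
    and averaging_one: "\<And>m. m < n \<Longrightarrow> emeasure M (\<omega> m) > 0 \<Longrightarrow> \<phi> m (indicator (\<omega> m)) = 1"
    and averaging_le: "\<And>f. f \<in> E \<Longrightarrow> N (\<lambda>t. \<Sum>i<n. \<phi> i f * indicator (\<omega> i) t) \<le> N f"
  using assms unfolding averaging_def by blast+

lemma averaging_zero:
  assumes "averaging n \<omega> \<phi>" "i < n"
  shows "\<phi> i (\<lambda>t. 0) = 0"
  using averaging_scale[OF assms zero, of 0] by simp

text \<open>
  The compression of \<open>T\<close> to the coefficients at \<open>i, j\<close> is \<open>K (a, b) = (h b, k a)\<close>. If \<open>h = 0\<close>, then
  \<open>(1 + i s K)\<^sup>l\<close> would grow linearly in \<open>l\<close>; the eigenvalues \<open>\<plusminus>\<kappa>\<close> of \<open>K\<close> are real because \<open>\<bar>1 + i s \<kappa>\<bar> \<le> 1 + C s\<^sup>2\<close>.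
  After a change of phase and scale, \<open>1 + i s K\<close> is multiplication by \<open>1 + i s\<close> on \<open>z = a + i b\<close>.
\<close>

lemma coupling:
  assumes fam: "finite_family n \<omega>" and av: "averaging n \<omega> \<phi>" and T: "hermitian T C"
    and ij: "i < n" "j < n" "i \<noteq> j" and k0: "\<phi> j (T (indicator (\<omega> i))) \<noteq> 0"
  shows "\<exists>\<theta>>0. \<forall>c. N (\<lambda>t. \<Sum>m<n. c m * indicator (\<omega> m) t) =
     N (\<lambda>t. \<Sum>m<n. (c(i := complex_of_real (sqrt ((cmod (c i))\<^sup>2 + \<theta> * (cmod (c j))\<^sup>2)), j := 0)) m * indicator (\<omega> m) t)"
proof -
  have lin: "linear_map M E M E T" and C: "0 \<le> C" using T by (auto simp: hermitian_def)
  have w: "\<And>m. m < n \<Longrightarrow> \<omega> m \<in> sets M" "\<And>m. m < n \<Longrightarrow> emeasure M (\<omega> m) < \<infinity>"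
    using fam by (auto simp: finite_family_def)
  have iE: "\<And>m. m < n \<Longrightarrow> indicator (\<omega> m) \<in> E" using w indicator_in by blast
  note cong = averaging_cong[OF av] and padd = averaging_add[OF av] and pscale = averaging_scale[OF av]
    and prho = averaging_rho[OF av] and pone = averaging_one[OF av] and ple = averaging_le[OF av]
  have p0: "\<And>m. m < n \<Longrightarrow> \<phi> m (\<lambda>t. 0) = 0" using averaging_zero[OF av] .
  have null0: "\<phi> m f = 0" if "m < n" "emeasure M (\<omega> m) = 0" "f \<in> E" for m f
  proof -
    have "\<omega> m \<in> null_sets M" using that w by auto
    then have "AE t in M. rho (\<omega> m) f t = 0" using AE_not_in by (fastforce simp: rho_apply)
    then have "\<phi> m (rho (\<omega> m) f) = \<phi> m (\<lambda>t. 0)"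
      using that w by (intro cong rho_in zero) auto
    then show ?thesis using prho[OF that(1,3)] p0[OF that(1)] by simp
  qed
  have wj: "emeasure M (\<omega> j) > 0"
    using null0[OF ij(2) _ linear_map_in[OF lin iE[OF ij(1)]]] k0 by (metis gr_zeroI)
  have wi: "emeasure M (\<omega> i) > 0"
  proof (rule ccontr)
    assume "\<not> 0 < emeasure M (\<omega> i)"
    then have "\<omega> i \<in> null_sets M" using w ij by auto
    then have "AE t in M. indicator (\<omega> i) t = (0::complex)"
      using AE_not_in[of "\<omega> i" M] by (auto simp: indicator_eq_0_iff)
    then have "AE t in M. T (indicator (\<omega> i)) t = T (\<lambda>t. 0 * indicator (\<omega> i) t) t"
      by (intro linear_map_cong[OF lin] scale iE ij) auto
    then have "AE t in M. T (indicator (\<omega> i)) t = 0"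
      using linear_map_scale[OF lin iE[OF ij(1)], of 0] by auto
    then have "\<phi> j (T (indicator (\<omega> i))) = \<phi> j (\<lambda>t. 0)"
      by (intro cong ij linear_map_in[OF lin] iE zero)
    then show False using k0 p0[OF ij(2)] by simp
  qed
  define k where "k = \<phi> j (T (indicator (\<omega> i)))"
  define h where "h = \<phi> i (T (indicator (\<omega> j)))"
  define F where "F c = N (\<lambda>t. \<Sum>m<n. c m * indicator (\<omega> m) t)" for c
  have Fpos: "F c \<ge> 0" for c unfolding F_def by (intro norm_nonneg family_step_in fam)
  have Fscale: "F (\<lambda>m. a * c m) = cmod a * F c" for a c
    unfolding F_def using norm_scale[OF family_step_in[OF fam], of a c] by (simp only: sum_distrib_left mult.assoc)
  have Fcong: "F c = F d" if "\<And>m. m < n \<Longrightarrow> cmod (c m) = cmod (d m)" for c d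
    unfolding F_def by (rule step_cong_cmod[OF fam that])
  have Fmono: "F c \<le> F d" if "\<And>m. m < n \<Longrightarrow> cmod (c m) \<le> cmod (d m)" for c d
    unfolding F_def by (rule step_mono[OF fam that])
  define K where "K c = (\<lambda>m. 0 :: complex)(i := h * c j, j := k * c i)" for c :: "nat \<Rightarrow> complex"
  \<comment> \<open>The Hermitian inequality survives the compression because replacing a function
    by the step function of its averages does not increase the norm.\<close>
  have FK: "F (\<lambda>m. c m + \<i> * complex_of_real s * K c m) \<le> (1 + C * s\<^sup>2) * F c" for c and s :: real
  proof -
    let ?x = "\<lambda>t. \<Sum>m<n. c m * indicator (\<omega> m) t"
    have x: "?x \<in> E" by (rule family_step_in[OF fam])
    have d: "\<omega> i \<inter> \<omega> j = {}" using fam ij by (auto simp: finite_family_def disjoint_family_on_def)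
    let ?p = "rho (\<omega> j) (T (rho (\<omega> i) ?x))" and ?q = "rho (\<omega> i) (T (rho (\<omega> j) ?x))"
    have pq: "?p \<in> E" "?q \<in> E"
      by (rule rho_in[OF w(1)] linear_map_in[OF lin] x ij)+
    let ?y = "\<lambda>t. ?x t + \<i> * complex_of_real s * (?p t + ?q t)"
    have y: "?y \<in> E" using pq by (intro add scale x)
    have px: "\<phi> m ?x = (if emeasure M (\<omega> m) > 0 then c m else 0)" if "m < n" for m
    proof (cases "emeasure M (\<omega> m) > 0")
      case True
      have "\<phi> m ?x = \<phi> m (\<lambda>t. c m * indicator (\<omega> m) t)"
        using prho[OF that x] rho_step[OF fam that] by simp
      then show ?thesis using pscale[OF that iE[OF that]] pone[OF that True] True by simp
    qed (use null0[OF that _ x] in auto)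
    have pz: "\<phi> m (rho (\<omega> l) f) = 0" if "m < n" "l < n" "m \<noteq> l" "f \<in> E" for m l f
    proof -
      have "\<omega> m \<inter> \<omega> l = {}" using fam that by (auto simp: finite_family_def disjoint_family_on_def)
      then have "rho (\<omega> m) (rho (\<omega> l) f) = (\<lambda>t. 0)" by (simp add: rho_rho) (simp add: rho_def)
      then show ?thesis using prho[OF that(1) rho_in[OF w(1)[OF that(2)] that(4)]] p0 that by simp
    qed
    have T1: "\<phi> m (T (rho (\<omega> l) ?x)) = c l * \<phi> m (T (indicator (\<omega> l)))" if "m < n" "l < n" for m l
    proof -
      have "\<phi> m (T (rho (\<omega> l) ?x)) = \<phi> m (\<lambda>t. c l * T (indicator (\<omega> l)) t)"
        unfolding rho_step[OF fam that(2)] 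
        by (intro cong that linear_map_in[OF lin] scale iE linear_map_scale[OF lin])
      then show ?thesis using pscale[OF that(1) linear_map_in[OF lin iE[OF that(2)]]] by simp
    qed
    have TE: "T (rho (\<omega> l) ?x) \<in> E" if "l < n" for l using that w by (intro linear_map_in[OF lin] rho_in x) auto
    have py: "\<phi> m ?y = \<phi> m ?x + \<i> * complex_of_real s * K c m" if "m < n" for m
    proof -
      have "\<phi> m ?y = \<phi> m ?x + \<i> * complex_of_real s * (\<phi> m ?p + \<phi> m ?q)"
        using padd[OF that x scale[OF add[OF pq]]] pscale[OF that add[OF pq]] padd[OF that pq] by simp
      moreover have "\<phi> m ?p = (if m = j then k * c i else 0)"
        using pz[OF that ij(2) _ TE[OF ij(1)]] prho[OF ij(2) TE[OF ij(1)]] T1[OF ij(2,1)]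
        by (auto simp: k_def)
      moreover have "\<phi> m ?q = (if m = i then h * c j else 0)"
        using pz[OF that ij(1) _ TE[OF ij(2)]] prho[OF ij(1) TE[OF ij(2)]] T1[OF ij(1,2)]
        by (auto simp: h_def)
      ultimately show ?thesis using ij(3) by (auto simp: K_def)
    qed
    have "F (\<lambda>m. c m + \<i> * complex_of_real s * K c m) = F (\<lambda>m. \<phi> m ?y)"
      unfolding F_def
    proof (rule norm_cong[OF family_step_in[OF fam] family_step_in[OF fam]])
      \<comment> \<open>The averages of a step function may differ from its coefficients only on
        null pieces, which the norm does not see.\<close>
      have "AE t in M. \<forall>m\<in>{..<n}. emeasure M (\<omega> m) = 0 \<longrightarrow> t \<notin> \<omega> m"
        using w by (subst AE_finite_all) (auto intro!: AE_not_in)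
      then show "AE t in M. (\<Sum>m<n. (c m + \<i> * complex_of_real s * K c m) * indicator (\<omega> m) t) = (\<Sum>m<n. \<phi> m ?y * indicator (\<omega> m) t)"
      proof eventually_elim
        case (elim t)
        have "(c m + \<i> * complex_of_real s * K c m) * indicator (\<omega> m) t = \<phi> m ?y * indicator (\<omega> m) t" if "m < n" for m
          unfolding py[OF that] px[OF that] using elim that by (auto simp: indicator_def zero_less_iff_neq_zero)
        then show ?case by (intro sum.cong) auto
      qed
    qed
    also have "\<dots> \<le> N ?y" unfolding F_def by (rule ple[OF y])
    also have "\<dots> \<le> (1 + C * s\<^sup>2) * F c"
      unfolding F_def using hermitian_off_diagonal[OF T w(1)[OF ij(1)] w(1)[OF ij(2)] d x] .
    finally show ?thesis .
  qed
  have Ni: "N (indicator (\<omega> i)) > 0" and Nj: "N (indicator (\<omega> j)) > 0"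
    using norm_indicator_pos w ij wi wj by auto
  have Fcomp: "cmod (c m) * N (indicator (\<omega> m)) \<le> F c" if "m < n" for c m
    unfolding F_def by (rule step_component_le[OF fam that])
  have k: "k \<noteq> 0" using k0 by (simp add: k_def)
  have h: "h \<noteq> 0"
  proof
    assume h0: "h = 0"
    \<comment> \<open>This is \<open>(1 + i s K)^l\<close> applied to the \<open>i\<close>-th unit
      vector: for \<open>h = 0\<close> the square of \<open>K\<close> is zero, and the binomial
      expansion stops after the linear term.\<close>
    define b where "b l s = (\<lambda>m. 0 :: complex)(i := 1, j := \<i> * complex_of_real s * of_nat l * k)" for l :: nat and s :: real
    have "F (b l s) \<le> (1 + C * s\<^sup>2) ^ l * F (b 0 0)" for l s
    proof (induction l)
      case (Suc l)
      have "b (Suc l) s = (\<lambda>m. b l s m + \<i> * complex_of_real s * K (b l s) m)"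
        using ij(3) by (auto simp: b_def K_def h0 fun_eq_iff algebra_simps)
      then have "F (b (Suc l) s) \<le> (1 + C * s\<^sup>2) * F (b l s)" using FK by simp
      also have "\<dots> \<le> (1 + C * s\<^sup>2) * ((1 + C * s\<^sup>2) ^ l * F (b 0 0))"
        using Suc C by (intro mult_left_mono) auto
      finally show ?case by simp
    qed (simp add: b_def)
    moreover have "\<bar>s\<bar> * real l * (cmod k * N (indicator (\<omega> j))) \<le> F (b l s)" for l s
      using Fcomp[OF ij(2), of "b l s"] by (simp add: b_def norm_mult mult.assoc)
    ultimately have "cmod k * N (indicator (\<omega> j)) \<le> 0"
      by (intro exp_dominates_linear[OF C Fpos[of "b 0 0"]]) (meson order_trans)
    then show False using k Nj by (simp add: mult_le_0_iff)
  qed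
  define \<kappa> where "\<kappa> = csqrt (h * k)"
  have \<kappa>2: "\<kappa> * \<kappa> = h * k" unfolding \<kappa>_def using power2_csqrt[of "h * k"] by (simp add: power2_eq_square)
  have "\<bar>Im \<kappa>\<bar> \<le> 0"
  proof -
    \<comment> \<open>An eigenvector: \<open>K v = \<kappa> v\<close>, because
      \<open>\<kappa>^2 = h k\<close>. It turns the inequality for \<open>K\<close> into one for the
      scalar \<open>1 + i s \<kappa>\<close>, and letting \<open>s\<close> tend to 0 with either
      sign forces \<open>\<kappa>\<close> to be real.\<close>
    define v where "v = (\<lambda>m. 0 :: complex)(i := h, j := \<kappa>)"
    have "0 < cmod h * N (indicator (\<omega> i))" using h Ni by simp
    then have Fv: "F v > 0" using Fcomp[OF ij(1), of v] ij(3) by (simp add: v_def)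
    have "1 - s * Im \<kappa> \<le> 1 + C * s\<^sup>2" for s
    proof -
      have "(\<lambda>m. v m + \<i> * complex_of_real s * K v m) = (\<lambda>m. (1 + \<i> * complex_of_real s * \<kappa>) * v m)"
        using ij(3) \<kappa>2 by (auto simp: v_def K_def fun_eq_iff algebra_simps)
      then have "cmod (1 + \<i> * complex_of_real s * \<kappa>) * F v \<le> (1 + C * s\<^sup>2) * F v"
        using FK[of v s] Fscale by simp
      then have "cmod (1 + \<i> * complex_of_real s * \<kappa>) \<le> 1 + C * s\<^sup>2" using Fv by simp
      then show ?thesis using complex_Re_le_cmod[of "1 + \<i> * complex_of_real s * \<kappa>"] by simp
    qed
    note le = this
    have "\<bar>Im \<kappa>\<bar> \<le> 0 + e" if "e > 0" for e
    proof -
      define s where "s = e / (C + 1)"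
      have s: "s > 0" "C * s \<le> e" using that C by (auto simp: s_def field_simps)
      have "s * \<bar>Im \<kappa>\<bar> \<le> C * s\<^sup>2"
        using le[of s] le[of "-s"] s by (auto simp: abs_if)
      then have "s * \<bar>Im \<kappa>\<bar> \<le> s * (C * s)" by (simp add: power2_eq_square algebra_simps)
      then have "\<bar>Im \<kappa>\<bar> \<le> C * s" using s by simp
      then show ?thesis using s by simp
    qed
    then show ?thesis by (rule field_le_epsilon)
  qed
  then have Im: "Im \<kappa> = 0" by simp
  define r where "r = \<bar>Re \<kappa>\<bar>"
  have hk: "h * k = complex_of_real (r * r)"
    unfolding \<kappa>2[symmetric] r_def using Im by (simp add: complex_eq_iff)
  have r: "r > 0"
  proof -
    have "r * r \<noteq> 0" using hk h k by (metis mult_eq_0_iff of_real_0)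
    then show ?thesis unfolding r_def by auto
  qed
  \<comment> \<open>The scale \<open>\<beta>\<close> and the phase \<open>u\<close> solve
    \<open>i k = u \<beta> r\<close> and \<open>i h u \<beta> = - r\<close>. In the coordinates
    \<open>c i = Re z\<close>, \<open>c j = u \<beta> Im z\<close> the matrix \<open>i K\<close>
    then acts as multiplication of \<open>z\<close> by \<open>i r\<close>.\<close>
  define \<beta> where "\<beta> = cmod k / r"
  have \<beta>: "\<beta> > 0" using k r by (simp add: \<beta>_def)
  define u where "u = \<i> * k / complex_of_real (cmod k)"
  have u: "cmod u = 1" using k by (simp add: u_def norm_mult norm_divide)
  have hu: "\<i> * h * u * complex_of_real \<beta> = - complex_of_real r"
  proof -
    have "\<i> * h * u * complex_of_real \<beta> = - (h * k) / complex_of_real r"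
      using k by (simp add: u_def \<beta>_def algebra_simps)
    then show ?thesis using r by (simp add: hk)
  qed
  have ku: "\<i> * k = u * complex_of_real \<beta> * complex_of_real r"
    using k r by (simp add: u_def \<beta>_def)
  have key: "F c = F (c(i := complex_of_real (sqrt ((cmod (c i))\<^sup>2 + (1 / \<beta>\<^sup>2) * (cmod (c j))\<^sup>2)), j := 0))" for c
  proof -
    define G where "G z = F (c(i := complex_of_real (Re z), j := u * complex_of_real (\<beta> * Im z)))" for z
    have "G z = G (complex_of_real (cmod z))" for z
    \<comment> \<open>The parameter is rescaled to \<open>s / r\<close> so that the eigenvalue
      \<open>r\<close> becomes 1, which divides the constant by \<open>r^2\<close>.\<close>
    proof (rule rotation_invariant[of "C / r\<^sup>2"])
      show "0 \<le> C / r\<^sup>2" using C by simp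
      show "0 \<le> G z" for z unfolding G_def by (rule Fpos)
      show "G z \<le> G (complex_of_real x * z)" if "x \<ge> 1" for x z
        unfolding G_def using that \<beta> u 
        by (intro Fmono) (auto simp: norm_mult abs_mult intro!: mult_left_mono mult_right_le_one_le mult_le_cancel_right1[THEN iffD2])
      fix s z
      define d where "d = c(i := complex_of_real (Re z), j := u * complex_of_real (\<beta> * Im z))"
      have e1: "\<i> * complex_of_real (s / r) * K d i = - complex_of_real (s * Im z)"
      proof -
        have "\<i> * complex_of_real (s / r) * K d i = (\<i> * h * u * complex_of_real \<beta>) * complex_of_real (s / r) * complex_of_real (Im z)"
          using ij(3) by (simp add: K_def d_def)
        then show ?thesis unfolding hu using r by simp
      qed
      have e2: "\<i> * complex_of_real (s / r) * K d j = u * complex_of_real (\<beta> * (s * Re z))"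
      proof -
        have "\<i> * complex_of_real (s / r) * K d j = (\<i> * k) * complex_of_real (s / r) * complex_of_real (Re z)"
          using ij(3) by (simp add: K_def d_def)
        then show ?thesis unfolding ku using r by simp
      qed
      have e3: "K d m = 0" if "m \<noteq> i" "m \<noteq> j" for m using that by (simp add: K_def)
      have "(\<lambda>m. d m + \<i> * complex_of_real (s / r) * K d m) =
        c(i := complex_of_real (Re ((1 + \<i> * complex_of_real s) * z)), j := u * complex_of_real (\<beta> * Im ((1 + \<i> * complex_of_real s) * z)))"
      proof
        fix m
        consider "m = i" | "m = j" | "m \<noteq> i" "m \<noteq> j" by blast
        then show "d m + \<i> * complex_of_real (s / r) * K d m = (c(i := complex_of_real (Re ((1 + \<i> * complex_of_real s) * z)), j := u * complex_of_real (\<beta> * Im ((1 + \<i> * complex_of_real s) * z)))) m"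
        proof cases
          case 1
          then show ?thesis unfolding 1 e1 using ij(3) by (simp add: d_def)
        next
          case 2
          then show ?thesis unfolding 2 e2 using ij(3) by (simp add: d_def distrib_left)
        next
          case 3
          then show ?thesis using e3 by (simp add: d_def)
        qed
      qed
      then have "G ((1 + \<i> * complex_of_real s) * z) \<le> (1 + C * (s / r)\<^sup>2) * G z"
        using FK[of d "s / r"] unfolding G_def d_def by simp
      then show "G ((1 + \<i> * complex_of_real s) * z) \<le> (1 + C / r\<^sup>2 * s\<^sup>2) * G z"
        by (simp add: power_divide)
    qed
    note rot = this
    \<comment> \<open>\<open>F\<close> depends only on the moduli of the coefficients, so both may
      be brought to the phases that occur in \<open>G\<close>, and the phase of \<open>u\<close>
      costs nothing. The weight is \<theta> = 1 / \<beta>^2.\<close>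
    let ?z = "Complex (cmod (c i)) (cmod (c j) / \<beta>)"
    have "F c = G ?z" unfolding G_def using u \<beta> by (intro Fcong) (auto simp: norm_mult)
    also have "\<dots> = G (complex_of_real (cmod ?z))" by (rule rot)
    also have "cmod ?z = sqrt ((cmod (c i))\<^sup>2 + (1 / \<beta>\<^sup>2) * (cmod (c j))\<^sup>2)"
      by (simp add: cmod_def power_divide)
    finally show ?thesis by (simp add: G_def)
  qed
  show ?thesis using key \<beta> unfolding F_def by (intro exI[of _ "1 / \<beta>\<^sup>2"]) simp
qed

end

section \<open>Local maps and weighted composition\<close>

text \<open>The values lie in a compact disc, which is covered by finitely many
  \<open>e\<close>-balls; each point is assigned to the first ball that contains its value.\<close>

lemma uniform_step_approx:
  fixes f :: "'a \<Rightarrow> complex"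
  assumes [measurable]: "f \<in> borel_measurable M" and K: "\<And>t. t \<in> space M \<Longrightarrow> cmod (f t) \<le> K" and e: "e > 0"
  obtains n :: nat and \<omega> :: "nat \<Rightarrow> 'a set" and b :: "nat \<Rightarrow> complex"
  where "\<And>i. i < n \<Longrightarrow> \<omega> i \<in> sets M" "disjoint_family_on \<omega> {..<n}" "(\<Union>i<n. \<omega> i) = space M"
    "\<And>i t. i < n \<Longrightarrow> t \<in> \<omega> i \<Longrightarrow> cmod (f t - b i) < e"
proof -
  have "\<forall>e>0. \<exists>Z. finite Z \<and> cball (0::complex) K \<subseteq> (\<Union>z\<in>Z. ball z e)"
    using compact_cball[of "0::complex" K] unfolding compact_eq_totally_bounded by (rule conjunct2)
  then have "\<exists>Z. finite Z \<and> cball (0::complex) K \<subseteq> (\<Union>z\<in>Z. ball z e)" using e by simp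
  then obtain Z where Z: "finite Z" "cball (0::complex) K \<subseteq> (\<Union>z\<in>Z. ball z e)" by (elim exE conjE)
  obtain n :: nat and b where b: "Z = b ` {i. i < n}" using Z(1) by (auto simp: finite_conv_nat_seg_image)
  define U where "U i = {t \<in> space M. dist (b i) (f t) < e}" for i
  define \<omega> where "\<omega> i = U i - (\<Union>j<i. U j)" for i
  have Um: "U i \<in> sets M" for i unfolding U_def by measurable
  show ?thesis
  proof (rule that[of n \<omega> b])
    show "\<omega> i \<in> sets M" if "i < n" for i using Um unfolding \<omega>_def by auto
    show "disjoint_family_on \<omega> {..<n}"
      unfolding disjoint_family_on_def \<omega>_def by (metis (no_types, lifting) DiffE Int_emptyI UN_I lessThan_iff linorder_neqE_nat)
    show "cmod (f t - b i) < e" if "i < n" "t \<in> \<omega> i" for i t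
      using that by (auto simp: \<omega>_def U_def dist_norm norm_minus_commute)
    show "(\<Union>i<n. \<omega> i) = space M"
    proof (intro equalityI subsetI)
      fix t assume t: "t \<in> space M"
      then have "f t \<in> (\<Union>z\<in>Z. ball z e)" using Z(2) K[OF t] by (auto simp: subset_iff)
      then have ex: "\<exists>i. i < n \<and> t \<in> U i" using t b by (auto simp: U_def)
      define i where "i = (LEAST i. i < n \<and> t \<in> U i)"
      have i: "i < n" "t \<in> U i" using LeastI_ex[OF ex] by (auto simp: i_def)
      moreover have "t \<notin> U j" if "j < i" for j
        using not_less_Least[of j "\<lambda>i. i < n \<and> t \<in> U i"] that i by (auto simp: i_def)
      ultimately show "t \<in> (\<Union>i<n. \<omega> i)" by (auto simp: \<omega>_def)
    qed (auto simp: \<omega>_def U_def)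
  qed
qed

lemma (in sigma_finite_measure) finite_positive_subset:
  assumes D: "D \<in> sets M" "emeasure M D > 0"
  obtains B where "B \<in> sets M" "B \<subseteq> D" "emeasure M B > 0" "emeasure M B < \<infinity>"
proof -
  obtain A :: "nat \<Rightarrow> 'a set" where A: "range A \<subseteq> sets M" "(\<Union>i. A i) = space M" "\<And>i. emeasure M (A i) \<noteq> \<infinity>"
    using sigma_finite by blast
  have Am: "A i \<in> sets M" for i using A(1) by auto
  have "\<exists>i. emeasure M (D \<inter> A i) > 0"
  proof (rule ccontr)
    assume "\<nexists>i. emeasure M (D \<inter> A i) > 0"
    then have "D \<inter> A i \<in> null_sets M" for i using D Am by (auto intro!: null_setsI)
    then have "(\<Union>i. D \<inter> A i) \<in> null_sets M" by (rule null_sets_UN)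
    moreover have "(\<Union>i. D \<inter> A i) = D" using A(2) sets.sets_into_space[OF D(1)] by blast
    ultimately show False using D by auto
  qed
  then obtain i where i: "emeasure M (D \<inter> A i) > 0" by blast
  have "emeasure M (D \<inter> A i) \<le> emeasure M (A i)" by (intro emeasure_mono Am) auto
  then have "emeasure M (D \<inter> A i) < \<infinity>" using A(3)[of i] by (simp add: less_top order_le_less_trans)
  then show ?thesis using that[of "D \<inter> A i"] i D Am by auto
qed

lemma not_AE_positive:
  assumes "Measurable.pred M P" "\<not> (AE t in M. P t)"
  shows "emeasure M {t \<in> space M. \<not> P t} > 0"
proof (rule ccontr)
  have m: "{t \<in> space M. \<not> P t} \<in> sets M" using assms(1) by measurable
  assume "\<not> ?thesis"
  then have "{t \<in> space M. \<not> P t} \<in> null_sets M" using m by auto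
  then have "AE t in M. P t" by (rule AE_I') auto
  then show False using assms(2) by simp
qed

context ideal_function_space
begin

lemma linear_map_sum:
  assumes lin: "linear_map M E M' E' T" and I: "finite I" "\<And>i. i \<in> I \<Longrightarrow> f i \<in> E"
  shows "AE t in M'. T (\<lambda>s. \<Sum>i\<in>I. c i * f i s) t = (\<Sum>i\<in>I. c i * T (f i) t)"
  using I
proof (induction I rule: finite_induct)
  case empty
  have "AE t in M'. T (\<lambda>s. 0 * 0) t = 0 * T (\<lambda>s. 0) t" by (rule linear_map_scale[OF lin zero])
  then show ?case by simp
next
  case (insert x F)
  have s: "(\<lambda>s. \<Sum>i\<in>F. c i * f i s) \<in> E" using insert by (intro sum_in scale) auto
  have x: "f x \<in> E" using insert by auto
  have "AE t in M'. T (\<lambda>s. \<Sum>i\<in>F. c i * f i s) t = (\<Sum>i\<in>F. c i * T (f i) t)"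
    using insert by blast
  then show ?case
    using linear_map_add[OF lin scale[OF x, of "c x"] s] linear_map_scale[OF lin x, of "c x"]
    by eventually_elim (use insert in simp)
qed

lemma linear_map_diff:
  assumes lin: "linear_map M E M' E' T" and fg: "f \<in> E" "g \<in> E"
  shows "AE t in M'. T (\<lambda>s. f s - g s) t = T f t - T g t"
proof -
  have "AE t in M'. T (\<lambda>s. f s + (-1) * g s) t = T f t + T (\<lambda>s. (-1) * g s) t"
    by (rule linear_map_add[OF lin fg(1) scale[OF fg(2)]])
  moreover have "AE t in M'. T (\<lambda>s. (-1) * g s) t = (-1) * T g t" by (rule linear_map_scale[OF lin fg(2)])
  ultimately show ?thesis by eventually_elim simp
qed

lemma hermitian_bounded:
  assumes T: "hermitian T C" and f: "f \<in> E"
  shows "N (T f) \<le> (2 + C) * N f"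
proof -
  have lin: "linear_map M E M E T" using T by (simp add: hermitian_def)
  have Tf: "T f \<in> E" by (rule linear_map_in[OF lin f])
  have "N (\<lambda>t. f t + \<i> * complex_of_real 1 * T f t) \<le> (1 + C * 1\<^sup>2) * N f"
    using T f unfolding hermitian_def by blast
  then have 1: "N (\<lambda>t. f t + \<i> * T f t) \<le> (1 + C) * N f" by simp
  have "N (T f) = N (\<lambda>t. \<i> * T f t)" using norm_scale[OF Tf, of \<i>] by simp
  also have "\<dots> = N (\<lambda>t. (f t + \<i> * T f t) - f t)" by simp
  also have "\<dots> \<le> N (\<lambda>t. f t + \<i> * T f t) + N f" by (rule norm_triangle_diff[OF add[OF f scale[OF Tf]] f])
  finally show ?thesis using 1 by (simp add: algebra_simps)
qed

text \<open>A uniform error \<open>e\<close> becomes a norm error only against an element of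
  \<open>E\<close>, here the indicator of \<open>A\<close>; for this reason all steps are cut down
  to \<open>A\<close>.\<close>

lemma bounded_step_approx:
  assumes A: "A \<in> sets M" "emeasure M A < \<infinity>" and g: "g \<in> borel_measurable M"
    and gK: "\<And>t. t \<in> space M \<Longrightarrow> cmod (g t) \<le> K" and g0: "\<And>t. t \<in> space M \<Longrightarrow> t \<notin> A \<Longrightarrow> g t = 0" and e: "e > 0"
  obtains n \<omega> b where "finite_family n \<omega>" "\<And>i. i < n \<Longrightarrow> \<omega> i \<subseteq> A"
    "\<And>t. t \<in> space M \<Longrightarrow> cmod (g t - (\<Sum>i<n. b i * indicator (\<omega> i) t)) \<le> e"
    "N (\<lambda>t. g t - (\<Sum>i<n. b i * indicator (\<omega> i) t)) \<le> e * N (indicator A)"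
    "\<And>t. t \<in> space M \<Longrightarrow> t \<in> A \<Longrightarrow> \<exists>i<n. t \<in> \<omega> i"
proof -
  obtain n :: nat and \<omega> b where w: "\<And>i. i < n \<Longrightarrow> \<omega> i \<in> sets M" "disjoint_family_on \<omega> {..<n}" "(\<Union>i<n. \<omega> i) = space M"
    "\<And>i t. i < n \<Longrightarrow> t \<in> \<omega> i \<Longrightarrow> cmod (g t - b i) < e"
    using uniform_step_approx[OF g gK e] by metis
  define v where "v i = \<omega> i \<inter> A" for i
  have vm: "v i \<in> sets M" if "i < n" for i unfolding v_def using A w(1)[OF that] by auto
  have vf: "emeasure M (v i) < \<infinity>" for i
    unfolding v_def by (intro order_le_less_trans[OF emeasure_mono A(2)] A) auto
  have fam: "finite_family n v"
    unfolding finite_family_def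
  proof (intro conjI allI impI vm vf)
    show "disjoint_family_on v {..<n}" using w(2) unfolding disjoint_family_on_def v_def by blast
  qed
  have bnd: "cmod (g t - (\<Sum>i<n. b i * indicator (v i) t)) \<le> e" if "t \<in> space M" "t \<in> A" for t
  proof -
    have "t \<in> (\<Union>i<n. \<omega> i)" using w(3) that by simp
    then obtain m where m: "m < n" "t \<in> \<omega> m" by auto
    then show ?thesis using step_at[OF fam m(1), of t b] w(4)[OF m] that by (simp add: v_def)
  qed
  have off: "g t - (\<Sum>i<n. b i * indicator (v i) t) = 0" if "t \<in> space M" "t \<notin> A" for t
    using g0[OF that] step_off[of n t v b] that by (simp add: v_def)
  have m: "(\<lambda>t. g t - (\<Sum>i<n. b i * indicator (v i) t)) \<in> borel_measurable M"
    using g meas[OF family_step_in[OF fam]] by (intro borel_measurable_diff)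
  show ?thesis
  proof (rule that[OF fam, of b])
    show "v i \<subseteq> A" for i by (auto simp: v_def)
    show "cmod (g t - (\<Sum>i<n. b i * indicator (v i) t)) \<le> e" if "t \<in> space M" for t
      using bnd[OF that] off[OF that] e by (cases "t \<in> A") auto
    show "N (\<lambda>t. g t - (\<Sum>i<n. b i * indicator (v i) t)) \<le> e * N (indicator A)"
      by (rule bounded_support(2)[OF A m _ bnd off]) (use e in auto)
    show "\<exists>i<n. t \<in> v i" if "t \<in> space M" "t \<in> A" for t using w(3) that by (auto simp: v_def)
  qed
qed

lemma zero_ae_if_small:
  assumes f: "f \<in> E" and le: "\<And>e. e > 0 \<Longrightarrow> N f \<le> e * K"
  shows "AE t in M. f t = 0"
proof -
  have "N f \<le> 0"
  proof (rule field_le_epsilon)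
    fix e :: real assume "e > 0"
    then have "N f \<le> (e / (\<bar>K\<bar> + 1)) * K" by (intro le) auto
    also have "\<dots> \<le> e" using \<open>e > 0\<close> by (simp add: field_simps abs_if)
    finally show "N f \<le> 0 + e" by simp
  qed
  then show ?thesis using norm_eq_0[OF f] norm_nonneg[OF f] by simp
qed

text \<open>
  Without coupling, \<open>T\<close> is local on step functions and hence on bounded functions with support of
  finite measure. These need not be dense. For general \<open>f\<close>, a bounded piece \<open>g'\<close> of \<open>T (\<rho>\<^sub>A f)\<close> off \<open>A\<close> makes the
  off-diagonal part of \<open>T\<close> nilpotent on the span of \<open>\<rho>\<^sub>A f\<close> and \<open>g'\<close>, which contradicts boundedness of its powers.
\<close>

lemma local_map_if_no_coupling:
  assumes T: "hermitian T C"
    and no: "\<And>A B c. A \<in> sets M \<Longrightarrow> B \<in> sets M \<Longrightarrow> A \<inter> B = {} \<Longrightarrow> emeasure M A < \<infinity> \<Longrightarrow> emeasure M B > 0 \<Longrightarrow>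
      emeasure M B < \<infinity> \<Longrightarrow> c \<noteq> 0 \<Longrightarrow> \<not> (\<forall>t\<in>B. cmod (T (indicator A) t - c) \<le> cmod c / 2)"
  shows "local_map T"
proof -
  have lin: "linear_map M E M E T" and C: "0 \<le> C" using T by (auto simp: hermitian_def)
  have step1: "AE t in M. t \<notin> A \<longrightarrow> T (indicator A) t = 0" if A: "A \<in> sets M" "emeasure M A < \<infinity>" for A
  proof -
    have [measurable]: "T (indicator A) \<in> borel_measurable M" "A \<in> sets M"
      using meas[OF linear_map_in[OF lin indicator_in[OF A]]] A by auto
    \<comment> \<open>Every nonzero value of \<open>T (indicator A)\<close> is close to one of
      countably many constants. So, unless the function vanishes off \<open>A\<close>, it stays near
      one fixed constant on a set of positive measure, which the hypothesis forbids.\<close>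
    obtain Q :: "complex set" where Q: "countable Q" "\<And>X. open X \<Longrightarrow> X \<noteq> {} \<Longrightarrow> \<exists>d\<in>Q. d \<in> X"
      using countable_dense_exists by blast
    define D where "D q = {t \<in> space M. t \<notin> A \<and> q \<noteq> 0 \<and> cmod (T (indicator A) t - q) \<le> cmod q / 2}" for q
    have Dm: "D q \<in> sets M" for q unfolding D_def by measurable
    have "D q \<in> null_sets M" for q
    proof (rule ccontr)
      assume "D q \<notin> null_sets M"
      then have "emeasure M (D q) > 0" using Dm by (simp add: null_sets_def zero_less_iff_neq_zero)
      then obtain B where B: "B \<in> sets M" "B \<subseteq> D q" "emeasure M B > 0" "emeasure M B < \<infinity>"
        using finite_positive_subset[OF Dm] by blast
      moreover have "q \<noteq> 0" using B by (auto simp: D_def)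
      moreover have "A \<inter> B = {}" using B(2) by (auto simp: D_def)
      ultimately show False using no[OF A(1) B(1) _ A(2) B(3,4)] by (auto simp: D_def)
    qed
    then have "AE t in M. \<forall>q\<in>Q. t \<notin> D q" using Q(1) by (subst AE_ball_countable) (auto intro: AE_not_in)
    then show ?thesis using AE_space
    proof eventually_elim
      case (elim t)
      show ?case
      proof (intro impI, rule ccontr)
        assume t: "t \<notin> A" "T (indicator A) t \<noteq> 0"
        define z where "z = T (indicator A) t"
        have "ball z (cmod z / 3) \<noteq> {}" using t by (simp add: z_def)
        \<comment> \<open>The radius \<open>\<bar>z\<bar> / 3\<close> gives
          \<open>\<bar>q\<bar> > 2 \<bar>z\<bar> / 3\<close>, hence
          \<open>\<bar>z - q\<bar> < \<bar>q\<bar> / 2\<close>.\<close>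
        then obtain q where q: "q \<in> Q" "cmod (z - q) < cmod z / 3"
          using Q(2)[OF open_ball, of z "cmod z / 3"] by (auto simp: dist_norm)
        have "cmod z \<le> cmod (z - q) + cmod q" using norm_triangle_ineq[of "z - q" q] by simp
        then have q2: "cmod (z - q) \<le> cmod q / 2" using q by linarith
        moreover have "q \<noteq> 0" using q t by (auto simp: z_def)
        ultimately have "t \<in> D q" using t elim by (simp add: D_def z_def)
        then show False using elim q by blast
      qed
    qed
  qed
  have step2: "AE t in M. t \<notin> A \<longrightarrow> T g t = 0"
    if A: "A \<in> sets M" "emeasure M A < \<infinity>" and g: "g \<in> borel_measurable M"
     "\<And>t. t \<in> space M \<Longrightarrow> cmod (g t) \<le> K" "\<And>t. t \<in> space M \<Longrightarrow> t \<notin> A \<Longrightarrow> g t = 0" "0 \<le> K" for A g K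
  proof -
    have gE: "g \<in> E" by (rule bounded_support(1)[OF A g(1,4,2,3)])
    have Ac: "space M - A \<in> sets M" using A by auto
    have E1: "rho (space M - A) (T g) \<in> E" by (rule rho_in[OF Ac linear_map_in[OF lin gE]])
    have "AE t in M. rho (space M - A) (T g) t = 0"
    proof (rule zero_ae_if_small[OF E1])
      fix e :: real assume e: "e > 0"
      obtain n \<omega> b where v: "finite_family n \<omega>" "\<And>i. i < n \<Longrightarrow> \<omega> i \<subseteq> A"
        "N (\<lambda>t. g t - (\<Sum>i<n. b i * indicator (\<omega> i) t)) \<le> e * N (indicator A)"
        by (rule bounded_step_approx[OF A g(1,2,3) e]) (assumption | rule that)+
      let ?v = "\<lambda>t. (\<Sum>i<n. b i * indicator (\<omega> i) t)"
      have w: "\<And>i. i < n \<Longrightarrow> \<omega> i \<in> sets M" "\<And>i. i < n \<Longrightarrow> emeasure M (\<omega> i) < \<infinity>" "\<And>i. i < n \<Longrightarrow> indicator (\<omega> i) \<in> E"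
        using v(1) indicator_in by (auto simp: finite_family_def)
      have vE: "?v \<in> E" by (rule family_step_in[OF v(1)])
      have "AE t in M. \<forall>i\<in>{..<n}. t \<notin> \<omega> i \<longrightarrow> T (indicator (\<omega> i)) t = 0"
        using step1 w by (subst AE_finite_all) auto
      moreover have "AE t in M. T ?v t = (\<Sum>i<n. b i * T (indicator (\<omega> i)) t)"
        by (rule linear_map_sum[OF lin]) (use w in auto)
      ultimately have "AE t in M. t \<notin> A \<longrightarrow> T ?v t = 0"
      proof eventually_elim
        case (elim t)
        show ?case
        proof
          assume "t \<notin> A"
          then have "t \<notin> \<omega> i" if "i < n" for i using v(2)[OF that] by blast
          then have "(\<Sum>i<n. b i * T (indicator (\<omega> i)) t) = 0" using elim(1) by (intro sum.neutral) auto
          then show "T ?v t = 0" using elim(2) by simp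
        qed
      qed
      then have "AE t in M. rho (space M - A) (T g) t = rho (space M - A) (T (\<lambda>t. g t - ?v t)) t"
        using linear_map_diff[OF lin gE vE] by eventually_elim (auto simp: rho_apply)
      then have "N (rho (space M - A) (T g)) = N (rho (space M - A) (T (\<lambda>t. g t - ?v t)))"
        by (intro norm_cong rho_in Ac linear_map_in[OF lin] gE diff_in[OF gE vE]) auto
      also have "\<dots> \<le> N (T (\<lambda>t. g t - ?v t))" by (rule norm_rho_le[OF Ac linear_map_in[OF lin diff_in[OF gE vE]]])
      also have "\<dots> \<le> (2 + C) * N (\<lambda>t. g t - ?v t)" by (rule hermitian_bounded[OF T diff_in[OF gE vE]])
      also have "\<dots> \<le> (2 + C) * (e * N (indicator A))" using v(3) C by (intro mult_left_mono) auto
      finally show "N (rho (space M - A) (T g)) \<le> e * ((2 + C) * N (indicator A))" by (simp add: algebra_simps)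
    qed
    then show ?thesis using AE_space by eventually_elim (auto simp: rho_apply)
  qed
  show ?thesis unfolding local_map_def
  proof (intro ballI, rule ccontr)
    fix A f assume A: "A \<in> sets M" and f: "f \<in> E"
    define g where "g = T (rho A f)"
    have fA: "rho A f \<in> E" by (rule rho_in[OF A f])
    have gE: "g \<in> E" unfolding g_def by (rule linear_map_in[OF lin fA])
    have [measurable]: "g \<in> borel_measurable M" "A \<in> sets M" using meas[OF gE] A by auto
    assume "\<not> (AE t in M. t \<notin> A \<longrightarrow> T (rho A f) t = 0)"
    then have no0: "\<not> (AE t in M. t \<notin> A \<longrightarrow> g t = 0)" by (simp add: g_def)
    \<comment> \<open>A bounded part of \<open>g\<close> is needed because the locality in
      \<open>step2\<close> holds only for bounded functions supported on a set of finite
      measure.\<close>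
    have "\<exists>k::nat. \<not> (AE t in M. \<not> (t \<notin> A \<and> g t \<noteq> 0 \<and> cmod (g t) \<le> real k))"
    proof (rule ccontr)
      assume "\<nexists>k::nat. \<not> (AE t in M. \<not> (t \<notin> A \<and> g t \<noteq> 0 \<and> cmod (g t) \<le> real k))"
      then have "AE t in M. \<forall>k::nat. \<not> (t \<notin> A \<and> g t \<noteq> 0 \<and> cmod (g t) \<le> real k)"
        by (subst AE_all_countable) blast
      then have "AE t in M. t \<notin> A \<longrightarrow> g t = 0" by eventually_elim (metis real_arch_simple)
      then show False using no0 by simp
    qed
    then obtain k :: nat where k: "\<not> (AE t in M. \<not> (t \<notin> A \<and> g t \<noteq> 0 \<and> cmod (g t) \<le> real k))" by blast
    define D where "D = {t \<in> space M. t \<notin> A \<and> g t \<noteq> 0 \<and> cmod (g t) \<le> real k}"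
    have Dm: "D \<in> sets M" unfolding D_def by measurable
    have "emeasure M D > 0" using not_AE_positive[OF _ k] unfolding D_def by simp
    then obtain B where B: "B \<in> sets M" "B \<subseteq> D" "emeasure M B > 0" "emeasure M B < \<infinity>"
      using finite_positive_subset[OF Dm] by blast
    have AB: "A \<inter> B = {}" using B(2) by (auto simp: D_def)
    define g' where "g' = rho B g"
    have g'E: "g' \<in> E" unfolding g'_def by (rule rho_in[OF B(1) gE])
    have Tg': "AE t in M. t \<notin> B \<longrightarrow> T g' t = 0"
      by (rule step2[OF B(1,4) meas[OF g'E], of "real k"]) (use B(2) in \<open>auto simp: g'_def rho_apply D_def\<close>)
    \<comment> \<open>The off-diagonal part of \<open>T\<close> for \<open>A, B\<close> sends
      \<open>rho A f\<close> to \<open>g'\<close>, and \<open>g'\<close> to 0, since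
      \<open>T g'\<close> vanishes off \<open>B\<close>. So \<open>x s l\<close> is the
      \<open>l\<close>-th power of \<open>1 + i s\<close> times that part, applied to
      \<open>rho A f\<close>.\<close>
    define x where "x s l = (\<lambda>t. rho A f t + (\<i> * complex_of_real s * of_nat l) * g' t)" for s :: real and l :: nat
    have xE: "x s l \<in> E" for s l unfolding x_def by (intro add fA scale g'E)
    have rhoA: "rho A (x s l) = rho A f" and rhoB: "rho B (x s l) = (\<lambda>t. (\<i> * complex_of_real s * of_nat l) * g' t)" for s l
      using AB by (auto simp: x_def rho_apply g'_def fun_eq_iff)
    have "N (x s l) \<le> (1 + C * s\<^sup>2) ^ l * N (rho A f)" for s l
    proof (induction l)
      case (Suc l)
      let ?y = "\<lambda>t. x s l t + \<i> * complex_of_real s * (rho B (T (rho A (x s l))) t + rho A (T (rho B (x s l))) t)"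
      have yE: "?y \<in> E"
        by (rule add[OF xE scale[OF add]]) (rule rho_in A B linear_map_in[OF lin] xE)+
      have "AE t in M. x s (Suc l) t = ?y t"
        using Tg' linear_map_scale[OF lin g'E, of "\<i> * complex_of_real s * of_nat l"] unfolding rhoA rhoB
      proof eventually_elim
        case (elim t)
        have "rho A (T (\<lambda>t. \<i> * complex_of_real s * of_nat l * g' t)) t = 0"
          using elim AB by (auto simp: rho_apply)
        moreover have "rho B (T (rho A f)) t = g' t" by (simp add: g'_def g_def)
        ultimately show ?case unfolding x_def by (simp add: algebra_simps)
      qed
      then have "N (x s (Suc l)) = N ?y" by (rule norm_cong[OF xE yE])
      also have "\<dots> \<le> (1 + C * s\<^sup>2) * N (x s l)"
        by (rule hermitian_off_diagonal[OF T A B(1) AB xE])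
      also have "\<dots> \<le> (1 + C * s\<^sup>2) * ((1 + C * s\<^sup>2) ^ l * N (rho A f))"
        using Suc C by (intro mult_left_mono) auto
      finally show ?case by simp
    qed (simp add: x_def)
    moreover have "\<bar>s\<bar> * real l * N g' \<le> N (x s l)" for s l
      using norm_rho_le[OF B(1) xE[of s l]] norm_scale[OF g'E] unfolding rhoB by (simp add: norm_mult)
    ultimately have "N g' \<le> 0"
      by (intro exp_dominates_linear[OF C norm_nonneg[OF fA]]) (meson order_trans)
    then have "AE t in M. g' t = 0" using norm_eq_0[OF g'E] norm_nonneg[OF g'E] by simp
    then have "AE t in M. t \<notin> B" by eventually_elim (use B(2) in \<open>auto simp: g'_def rho_apply D_def\<close>)
    then show False using B(1,3) AE_iff_null_sets[OF B(1)] by auto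
  qed
qed

lemma local_map_commutes:
  assumes lin: "linear_map M E M E T" and loc: "local_map T" and A: "A \<in> sets M" and f: "f \<in> E"
  shows "AE t in M. T (rho A f) t = rho A (T f) t"
proof -
  have Ac: "space M - A \<in> sets M" using A by auto
  have in1: "rho A f \<in> E" "rho (space M - A) f \<in> E" using rho_in[OF A f] rho_in[OF Ac f] .
  have "AE t in M. T f t = T (\<lambda>t. rho A f t + rho (space M - A) f t) t"
    by (rule linear_map_cong[OF lin f add[OF in1]]) (auto simp: rho_apply)
  moreover have "AE t in M. t \<notin> A \<longrightarrow> T (rho A f) t = 0" using loc A f by (auto simp: local_map_def)
  moreover have "AE t in M. t \<notin> space M - A \<longrightarrow> T (rho (space M - A) f) t = 0"
    using loc Ac f by (auto simp: local_map_def)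
  ultimately show ?thesis using linear_map_add[OF lin in1] AE_space
    by eventually_elim (auto simp: rho_apply)
qed

end

text \<open>Commutation gives \<open>V (s w) = (s o \<phi>) V w\<close> for step functions
  \<open>s\<close>, and uniform limits extend this to bounded \<open>f / w\<close>. Commutation also
  permits restricting to the sets where \<open>f / w\<close> is bounded, so no density is involved.
  With \<phi> the identity this says that a map commuting with all cut-offs is a
  multiplication.\<close>

lemma weighted_composition:
  assumes M: "ideal_function_space M E N" and M': "ideal_function_space M' E' N'"
    and lin: "linear_map M E M' E' V" and V: "\<And>f. f \<in> E \<Longrightarrow> N' (V f) \<le> K * N f" and K: "0 \<le> K"
    and \<phi>[measurable]: "\<phi> \<in> measurable M' M"
    and comm: "\<And>A f. A \<in> sets M \<Longrightarrow> f \<in> E \<Longrightarrow> AE t in M'. V (rho A f) t = indicator A (\<phi> t) * V f t"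
  shows "\<exists>q\<in>borel_measurable M'. \<forall>f\<in>E. AE t in M'. V f t = q t * f (\<phi> t)"
proof -
  interpret E: ideal_function_space M E N by fact
  interpret E': ideal_function_space M' E' N' by fact
  obtain w where w: "w \<in> E" "\<forall>t\<in>space M. \<exists>r>0. w t = complex_of_real r" using E.pos_element by blast
  have w0: "w t \<noteq> 0" if "t \<in> space M" for t using w(2) that by fastforce
  have VE: "V w \<in> E'" by (rule linear_map_in[OF lin w(1)])
  have [measurable]: "w \<in> borel_measurable M" "V w \<in> borel_measurable M'"
    using E.meas[OF w(1)] E'.meas[OF VE] by auto
  define q where "q t = V w t / w (\<phi> t)" for t
  have qm: "q \<in> borel_measurable M'" unfolding q_def by measurable
  have "AE t in M'. V f t = q t * f (\<phi> t)" if f: "f \<in> E" for f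
  proof -
    have [measurable]: "f \<in> borel_measurable M" using E.meas[OF f] .
    \<comment> \<open>These sets exhaust the space because \<open>w\<close> vanishes nowhere, and on
      each of them \<open>f / w\<close> is within reach of
      \<open>uniform_step_approx\<close>.\<close>
    define X where "X n = {t \<in> space M. cmod (f t / w t) \<le> real n}" for n :: nat
    have Xm[measurable]: "X n \<in> sets M" for n unfolding X_def by measurable
    have "AE t in M'. \<phi> t \<in> X n \<longrightarrow> V f t = q t * f (\<phi> t)" for n
    proof -
      define h where "h = rho (X n) (\<lambda>t. f t / w t)"
      have hm[measurable]: "h \<in> borel_measurable M" unfolding h_def by (intro measurable_rho) measurable
      have hn: "cmod (h t) \<le> real n" for t by (auto simp: h_def rho_apply X_def)
      let ?g = "rho (X n) f"
      have gE: "?g \<in> E" by (rule E.rho_in[OF Xm f])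
      have gh: "?g t = h t * w t" if "t \<in> space M" for t using w0[OF that] by (simp add: h_def rho_apply)
      let ?u = "\<lambda>t. h (\<phi> t) * V w t"
      have um[measurable]: "?u \<in> borel_measurable M'" by measurable
      have uE: "?u \<in> E'"
        by (rule E'.bounded_dominated(1)[OF VE um, of "real n"]) (auto simp: norm_mult intro!: mult_right_mono hn)
      let ?d = "\<lambda>t. V ?g t - ?u t"
      have dE: "?d \<in> E'" by (rule E'.diff_in[OF linear_map_in[OF lin gE] uE])
      have "AE t in M'. ?d t = 0"
      proof (rule E'.zero_ae_if_small[OF dE])
        fix e :: real assume e: "e > 0"
        obtain m :: nat and \<omega> b where v: "\<And>i. i < m \<Longrightarrow> \<omega> i \<in> sets M" "disjoint_family_on \<omega> {..<m}" "(\<Union>i<m. \<omega> i) = space M"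
          "\<And>i t. i < m \<Longrightarrow> t \<in> \<omega> i \<Longrightarrow> cmod (h t - b i) < e"
          using uniform_step_approx[OF hm hn e] by metis
        define s where "s t = (\<Sum>i<m. b i * indicator (\<omega> i) t)" for t
        have s: "cmod (h t - s t) \<le> e" if t: "t \<in> space M" for t
        proof -
          have "t \<in> (\<Union>i<m. \<omega> i)" using v(3) t by simp
          then obtain i where i: "i < m" "t \<in> \<omega> i" by auto
          have "s t = (\<Sum>j<m. if j = i then b i else 0)" unfolding s_def
            using i v(2) by (intro sum.cong) (auto simp: disjoint_family_on_def indicator_def)
          then show ?thesis using v(4)[OF i] i by simp
        qed
        have [measurable]: "s \<in> borel_measurable M" unfolding s_def using v(1) by measurable
        have sw: "(\<lambda>t. \<Sum>i<m. b i * rho (\<omega> i) w t) = (\<lambda>t. s t * w t)"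
          by (simp only: s_def sum_distrib_right rho_def mult.assoc)
        have rE: "rho (\<omega> i) w \<in> E" if "i < m" for i using E.rho_in[OF v(1)[OF that] w(1)] .
        have swE: "(\<lambda>t. s t * w t) \<in> E"
          unfolding sw[symmetric] by (intro E.sum_in E.scale rE) auto
        have "AE t in M'. V (\<lambda>t. \<Sum>i<m. b i * rho (\<omega> i) w t) t = (\<Sum>i<m. b i * V (rho (\<omega> i) w) t)"
          by (rule E.linear_map_sum[OF lin]) (use rE in auto)
        moreover have "AE t in M'. \<forall>i\<in>{..<m}. V (rho (\<omega> i) w) t = indicator (\<omega> i) (\<phi> t) * V w t"
          using comm v(1) w(1) by (subst AE_finite_all) auto
        ultimately have Vsw: "AE t in M'. V (\<lambda>t. s t * w t) t = s (\<phi> t) * V w t"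
          unfolding sw
        proof eventually_elim
          case (elim t)
          then have "(\<Sum>i<m. b i * V (rho (\<omega> i) w) t) = (\<Sum>i<m. b i * indicator (\<omega> i) (\<phi> t) * V w t)"
            by (intro sum.cong) auto
          then show ?case using elim(1) by (simp only: s_def sum_distrib_right)
        qed
        have dm: "(\<lambda>t. (s (\<phi> t) - h (\<phi> t)) * V w t) \<in> borel_measurable M'" by measurable
        have bd: "AE t in M'. cmod ((s (\<phi> t) - h (\<phi> t)) * V w t) \<le> e * cmod (V w t)"
          using s measurable_space[OF \<phi>] by (auto simp: norm_mult norm_minus_commute intro!: mult_right_mono AE_I2)
        note d2 = E'.bounded_dominated[OF VE dm less_imp_le[OF e] bd]
        have gs: "(\<lambda>t. ?g t - s t * w t) \<in> E" by (rule E.diff_in[OF gE swE])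
        have VgsE: "V (\<lambda>t. ?g t - s t * w t) \<in> E'" by (rule linear_map_in[OF lin gs])
        have "AE t in M'. ?d t = V (\<lambda>t. ?g t - s t * w t) t + (s (\<phi> t) - h (\<phi> t)) * V w t"
          using Vsw E.linear_map_diff[OF lin gE swE] by eventually_elim (simp add: algebra_simps)
        then have "N' ?d = N' (\<lambda>t. V (\<lambda>t. ?g t - s t * w t) t + (s (\<phi> t) - h (\<phi> t)) * V w t)"
          by (rule E'.norm_cong[OF dE E'.add[OF VgsE d2(1)]])
        also have "\<dots> \<le> N' (V (\<lambda>t. ?g t - s t * w t)) + N' (\<lambda>t. (s (\<phi> t) - h (\<phi> t)) * V w t)"
          by (rule E'.norm_triangle[OF VgsE d2(1)])
        \<comment> \<open>Both errors are relative to the weight: before \<open>V\<close> the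
          function is off by at most \<open>e \<bar>w\<bar>\<close>, after \<open>V\<close> by at
          most \<open>e \<bar>V w\<bar>\<close>.\<close>
        also have "\<dots> \<le> K * (e * N w) + e * N' (V w)"
        proof (rule add_mono[OF order_trans[OF V[OF gs]] d2(2)])
          have "AE t in M. cmod (?g t - s t * w t) \<le> e * cmod (w t)"
            using s by (auto intro!: AE_I2 mult_right_mono simp: gh left_diff_distrib[symmetric] norm_mult)
          then have "N (\<lambda>t. ?g t - s t * w t) \<le> e * N w"
            by (rule E.bounded_dominated(2)[OF w(1) E.meas[OF gs] less_imp_le[OF e]])
          then show "K * N (\<lambda>t. ?g t - s t * w t) \<le> K * (e * N w)" using K by (rule mult_left_mono)
        qed
        finally show "N' ?d \<le> e * (K * N w + N' (V w))" by (simp add: algebra_simps)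
      qed
      then show ?thesis using comm[OF Xm[of n] f] AE_space
      proof eventually_elim
        case (elim t)
        show ?case
        proof
          assume X: "\<phi> t \<in> X n"
          then have "V f t = h (\<phi> t) * V w t" using elim by simp
          then show "V f t = q t * f (\<phi> t)" using X by (simp add: h_def rho_apply q_def)
        qed
      qed
    qed
    then have "AE t in M'. \<forall>n. \<phi> t \<in> X n \<longrightarrow> V f t = q t * f (\<phi> t)" by (subst AE_all_countable) blast
    then show ?thesis using AE_space
    proof eventually_elim
      case (elim t)
      have "\<phi> t \<in> space M" using elim measurable_space[OF \<phi>] by blast
      moreover obtain n :: nat where "cmod (f (\<phi> t) / w (\<phi> t)) \<le> real n" using real_arch_simple by blast
      ultimately show ?case using elim by (auto simp: X_def)
    qed
  qed
  then show ?thesis using qm by blast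
qed

section \<open>Averaging projections and the norm of \<open>L\<^sub>2\<close>\<close>

lemma abs_diff_squares: "\<bar>x\<^sup>2 - y\<^sup>2\<bar> = \<bar>x - y\<bar> * \<bar>x + y\<bar>" for x y :: real
  unfolding abs_mult[symmetric] by (simp add: power2_eq_square algebra_simps)

lemma eq_mult_sqrtI:
  fixes x \<kappa> d :: real
  assumes "x\<^sup>2 = \<kappa>\<^sup>2 * d" "0 \<le> x" "0 \<le> \<kappa>"
  shows "x = \<kappa> * sqrt d"
proof -
  have "x = sqrt (x\<^sup>2)" using assms(2) by simp
  also have "\<dots> = sqrt (\<kappa>\<^sup>2) * sqrt d" unfolding assms(1) by (rule real_sqrt_mult)
  finally show ?thesis using assms(3) by simp
qed

context ideal_function_space
begin

lemma has_averaging_projection: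
  assumes pp: "projection_provided M E N"
  shows "has_averaging"
  unfolding has_averaging_def
proof (intro allI impI)
  fix n \<omega> assume fam: "finite_family n \<omega>"
  have w: "\<And>i. i < n \<Longrightarrow> \<omega> i \<in> sets M" using fam by (auto simp: finite_family_def)
  show "\<exists>\<phi>. averaging n \<omega> \<phi>"
  proof (cases "\<exists>i<n. emeasure M (\<omega> i) > 0")
    case False
    \<comment> \<open>If all pieces are null, no projector is provided, but the zero functionals
      satisfy every condition.\<close>
    then have "averaging n \<omega> (\<lambda>i f. 0)"
      unfolding averaging_def using norm_zero norm_nonneg by auto
    then show ?thesis by blast
  next
    case True
    then obtain P where P: "projector_onto M E (step_functions n \<omega>) P" "has_operator_norm E N N P 1"
      "\<forall>i<n. \<forall>f\<in>E. AE t in M. P (rho (\<omega> i) f) t = rho (\<omega> i) (P f) t"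
      using pp fam unfolding projection_provided_def finite_family_def by blast
    have lin: "linear_map M E M E P" and idem: "\<And>f. f \<in> E \<Longrightarrow> AE t in M. P (P f) t = P f t"
      and ran: "\<And>f. f \<in> E \<Longrightarrow> \<exists>s\<in>step_functions n \<omega>. AE t in M. P f t = s t"
      and onto: "\<And>s. s \<in> step_functions n \<omega> \<Longrightarrow> \<exists>f\<in>E. AE t in M. P f t = s t"
      using P(1) unfolding projector_onto_def by blast+
    have PE: "P f \<in> E" if "f \<in> E" for f by (rule linear_map_in[OF lin that])
    have "\<exists>c. AE t in M. P f t = (\<Sum>i<n. c i * indicator (\<omega> i) t)" if "f \<in> E" for f
      using ran[OF that] unfolding step_functions_def by blast
    then obtain c where c: "\<And>f. f \<in> E \<Longrightarrow> AE t in M. P f t = (\<Sum>i<n. c f i * indicator (\<omega> i) t)" by metis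
    \<comment> \<open>The coefficient of \<open>P f\<close> on a null piece is an arbitrary choice;
      setting it to 0 makes the coefficients unique and hence exactly linear.\<close>
    define \<phi> where "\<phi> i f = (if emeasure M (\<omega> i) = 0 then 0 else c f i)" for i f
    have on: "AE t in M. t \<in> \<omega> i \<longrightarrow> P f t = \<phi> i f" if "i < n" "f \<in> E" for i f
    proof (cases "emeasure M (\<omega> i) = 0")
      case True
      then have "AE t in M. t \<notin> \<omega> i" using w[OF that(1)] by (intro AE_not_in) auto
      then show ?thesis by eventually_elim simp
    next
      case False
      show ?thesis using c[OF that(2)]
        by eventually_elim (use step_at[OF fam that(1)] False in \<open>auto simp: \<phi>_def\<close>)
    qed
    have uniq: "\<phi> i f = a"
      if i: "i < n" and f: "f \<in> E" and "AE t in M. t \<in> \<omega> i \<longrightarrow> P f t = a" "emeasure M (\<omega> i) = 0 \<longrightarrow> a = 0" for i f a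
    proof (rule ccontr)
      assume ne: "\<phi> i f \<noteq> a"
      have "AE t in M. t \<notin> \<omega> i" using on[OF i f] that(3) by eventually_elim (use ne in auto)
      then have "emeasure M (\<omega> i) = 0" using AE_iff_null_sets[OF w[OF i]] by auto
      then show False using ne that(4) by (simp add: \<phi>_def)
    qed
    have z: "\<phi> i f = 0" if "emeasure M (\<omega> i) = 0" for i f using that by (simp add: \<phi>_def)
    have "averaging n \<omega> \<phi>" unfolding averaging_def
    proof (intro conjI allI impI ballI)
      fix i assume i: "i < n"
      { fix f g assume fg: "f \<in> E" "g \<in> E" "AE t in M. f t = g t"
        show "\<phi> i f = \<phi> i g"
          by (rule uniq[OF i fg(1)]) (use on[OF i fg(2)] linear_map_cong[OF lin fg] z in auto) }
      { fix f g assume fg: "f \<in> E" "g \<in> E"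
        have "AE t in M. t \<in> \<omega> i \<longrightarrow> P (\<lambda>t. f t + g t) t = \<phi> i f + \<phi> i g"
          using on[OF i fg(1)] on[OF i fg(2)] linear_map_add[OF lin fg] by eventually_elim simp
        then show "\<phi> i (\<lambda>t. f t + g t) = \<phi> i f + \<phi> i g" by (rule uniq[OF i add[OF fg]]) (simp add: z) }
      { fix a f assume f: "f \<in> E"
        have "AE t in M. t \<in> \<omega> i \<longrightarrow> P (\<lambda>t. a * f t) t = a * \<phi> i f"
          using on[OF i f] linear_map_scale[OF lin f, of a] by eventually_elim simp
        then show "\<phi> i (\<lambda>t. a * f t) = a * \<phi> i f" by (rule uniq[OF i scale[OF f]]) (simp add: z) }
      { fix f assume f: "f \<in> E"
        have "AE t in M. P (rho (\<omega> i) f) t = rho (\<omega> i) (P f) t" using P(3) i f by blast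
        with on[OF i f] have "AE t in M. t \<in> \<omega> i \<longrightarrow> P (rho (\<omega> i) f) t = \<phi> i f"
          by eventually_elim (simp add: rho_apply)
        then show "\<phi> i (rho (\<omega> i) f) = \<phi> i f" by (rule uniq[OF i rho_in[OF w[OF i] f]]) (simp add: z) }
      { assume pos: "emeasure M (\<omega> i) > 0"
        have iE: "indicator (\<omega> i) \<in> E" using fam i indicator_in by (auto simp: finite_family_def)
        have "(indicator (\<omega> i) :: 'a \<Rightarrow> complex) = (\<lambda>t. \<Sum>j<n. (if j = i then 1 else 0) * indicator (\<omega> j) t)"
        proof (rule ext)
          fix t
          have "(\<Sum>j<n. (if j = i then 1 else 0) * indicator (\<omega> j) t) = (\<Sum>j<n. if j = i then indicator (\<omega> i) t else (0::complex))"
            by (intro sum.cong) auto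
          then show "(indicator (\<omega> i) t :: complex) = (\<Sum>j<n. (if j = i then 1 else 0) * indicator (\<omega> j) t)"
            using i by (simp only: sum.delta finite_lessThan lessThan_iff if_True)
        qed
        \<comment> \<open>The indicator lies in the range of \<open>P\<close>, so idempotence makes
          \<open>P\<close> fix it, and its coefficient must be 1.\<close>
        then have "indicator (\<omega> i) \<in> step_functions n \<omega>" unfolding step_functions_def by (rule range_eqI[where x = "\<lambda>j. if j = i then 1 else 0"])
        then obtain h where h: "h \<in> E" "AE t in M. P h t = indicator (\<omega> i) t" using onto by blast
        have "AE t in M. t \<in> \<omega> i \<longrightarrow> P (indicator (\<omega> i)) t = 1"
          using linear_map_cong[OF lin PE[OF h(1)] iE h(2)] idem[OF h(1)] h(2)
          by eventually_elim (metis indicator_simps(1))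
        then show "\<phi> i (indicator (\<omega> i)) = 1" by (rule uniq[OF i iE]) (use pos in simp) }
    next
      fix f assume f: "f \<in> E"
      have "AE t in M. \<forall>i\<in>{..<n}. t \<in> \<omega> i \<longrightarrow> P f t = \<phi> i f"
        using on f by (subst AE_finite_all) auto
      then have "AE t in M. cmod (\<Sum>i<n. \<phi> i f * indicator (\<omega> i) t) \<le> cmod (P f t)"
      proof eventually_elim
        case (elim t)
        show ?case
        proof (cases "\<exists>m<n. t \<in> \<omega> m")
          case True
          then obtain m where "m < n" "t \<in> \<omega> m" by blast
          then show ?thesis using step_at[OF fam, of m t "\<lambda>i. \<phi> i f"] elim by simp
        next
          case False
          then show ?thesis using step_off[of n t \<omega> "\<lambda>i. \<phi> i f"] by simp
        qed
      qed
      then have "N (\<lambda>t. \<Sum>i<n. \<phi> i f * indicator (\<omega> i) t) \<le> N (P f)"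
        by (rule norm_mono_in[OF PE[OF f] family_step_in[OF fam]])
      also have "\<dots> \<le> 1 * N f" using P(2) f unfolding has_operator_norm_def by blast
      finally show "N (\<lambda>t. \<Sum>i<n. \<phi> i f * indicator (\<omega> i) t) \<le> N f" by simp
    qed
    then show ?thesis by blast
  qed
qed

section \<open>From a quadratic norm on step functions to an L_2 norm on a component\<close>

lemma step_cmod_square:
  assumes "finite_family n \<omega>"
  shows "(cmod (\<Sum>i<n. b i * indicator (\<omega> i) t))\<^sup>2 = (\<Sum>i<n. (cmod (b i))\<^sup>2 * indicator (\<omega> i) t)"
proof (cases "\<exists>m<n. t \<in> \<omega> m")
  case True
  then obtain m where m: "m < n" "t \<in> \<omega> m" by blast
  have "t \<notin> \<omega> i" if "i < n" "i \<noteq> m" for i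
    using assms m that by (auto simp: finite_family_def disjoint_family_on_def)
  then have "(\<Sum>i<n. (cmod (b i))\<^sup>2 * indicator (\<omega> i) t) = (\<Sum>i<n. if i = m then (cmod (b m))\<^sup>2 else 0)"
    using m by (intro sum.cong) auto
  then show ?thesis using step_at[OF assms m, of b] m by simp
next
  case False
  then have "(\<Sum>i<n. (cmod (b i))\<^sup>2 * indicator (\<omega> i) t) = 0" by (intro sum.neutral) auto
  then show ?thesis using step_off[of n t \<omega> b] False by simp
qed

text \<open>Uniform approximation extends the formula to bounded functions supported on a set of
  finite measure. For general \<open>f\<close> the truncations have a known norm, so their
  convergence in L_2 makes them Cauchy in \<open>E\<close>, and \<open>riesz_fischer\<close> makes
  them converge to \<open>f\<close>. It is applied with a measure built from the norm (case (a)) and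
  with \<open>M\<close> itself (case (b)).\<close>

lemma L2_norm_extension:
  assumes \<sigma>: "\<sigma> \<in> sets M" and sets: "sets \<nu> = sets (restrict_space M \<sigma>)" and \<kappa>: "\<kappa> > 0"
    and fin: "\<And>S. S \<in> sets M \<Longrightarrow> S \<subseteq> \<sigma> \<Longrightarrow> emeasure M S < \<infinity> \<Longrightarrow> emeasure \<nu> S < \<infinity>"
    and step: "\<And>n \<omega> b. finite_family n \<omega> \<Longrightarrow> (\<And>i. i < n \<Longrightarrow> \<omega> i \<subseteq> \<sigma>) \<Longrightarrow>
      (N (\<lambda>t. \<Sum>i<n. b i * indicator (\<omega> i) t))\<^sup>2 = \<kappa>\<^sup>2 * (\<Sum>i<n. (cmod (b i))\<^sup>2 * measure \<nu> (\<omega> i))"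
    and f: "f \<in> E" and f0: "\<And>t. t \<notin> \<sigma> \<Longrightarrow> f t = 0"
  shows "f \<in> L2_space \<nu> \<and> N f = \<kappa> * L2_norm \<nu> f"
proof -
  have space\<nu>: "space \<nu> = \<sigma>"
    using sets_eq_imp_space_eq[OF sets] sets.sets_into_space[OF \<sigma>] by (auto simp: space_restrict_space)
  have sets\<nu>: "S \<in> sets \<nu> \<longleftrightarrow> S \<in> sets M \<and> S \<subseteq> \<sigma>" for S
    using \<sigma> by (auto simp: sets sets_restrict_space_iff)
  have m\<nu>: "g \<in> borel_measurable \<nu>" if "g \<in> borel_measurable M" for g :: "'a \<Rightarrow> complex"
    using measurable_restrict_space1[OF that, of \<sigma>] measurable_cong_sets[OF sets refl] by blast
  have bounded: "integrable \<nu> (\<lambda>t. (cmod (g t))\<^sup>2)" "(N g)\<^sup>2 = \<kappa>\<^sup>2 * (\<integral>t. (cmod (g t))\<^sup>2 \<partial>\<nu>)"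
    if A: "A \<in> sets M" "A \<subseteq> \<sigma>" "emeasure M A < \<infinity>" and g: "g \<in> borel_measurable M"
     "\<And>t. t \<in> space M \<Longrightarrow> cmod (g t) \<le> K" "\<And>t. t \<in> space M \<Longrightarrow> t \<notin> A \<Longrightarrow> g t = 0" "0 \<le> K" for A g K
  proof -
    have [measurable]: "g \<in> borel_measurable \<nu>" by (rule m\<nu>[OF g(1)])
    have A\<nu>: "A \<in> sets \<nu>" "emeasure \<nu> A < \<infinity>" using A fin sets\<nu> by auto
    have gE: "g \<in> E" by (rule bounded_support(1)[OF A(1,3) g(1,4,2,3)])
    have \<sigma>s: "\<And>t. t \<in> \<sigma> \<Longrightarrow> t \<in> space M" using sets.sets_into_space[OF \<sigma>] by auto
    have gsq: "(cmod (g t))\<^sup>2 \<le> K\<^sup>2 * indicator A t" if "t \<in> space \<nu>" for t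
      using g(2)[of t] g(3)[of t] that space\<nu> \<sigma>s by (cases "t \<in> A") (auto intro!: power_mono)
    have intA: "integrable \<nu> (\<lambda>t. a * indicator A t)" for a :: real using A\<nu> by simp
    show int: "integrable \<nu> (\<lambda>t. (cmod (g t))\<^sup>2)"
      by (rule Bochner_Integration.integrable_bound[OF intA[of "K\<^sup>2"]]) (use gsq in auto)
    \<comment> \<open>Both sides of the formula are compared with those for a step function within
      \<open>e\<close> of \<open>g\<close>. Each difference of squares is the difference times the
      sum; for \<open>e <= 1\<close> the sums are at most \<open>2 N g + N (indicator A)\<close>
      and, pointwise, \<open>2 K + 1\<close>.\<close>
    have "\<bar>(N g)\<^sup>2 - \<kappa>\<^sup>2 * (\<integral>t. (cmod (g t))\<^sup>2 \<partial>\<nu>)\<bar> \<le> e * (N (indicator A) * (2 * N g + N (indicator A)) + \<kappa>\<^sup>2 * ((2 * K + 1) * measure \<nu> A))"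
      if e: "e > 0" "e \<le> 1" for e :: real
    proof -
      obtain n \<omega> b where v: "finite_family n \<omega>" "\<And>i. i < n \<Longrightarrow> \<omega> i \<subseteq> A"
        "\<And>t. t \<in> space M \<Longrightarrow> cmod (g t - (\<Sum>i<n. b i * indicator (\<omega> i) t)) \<le> e"
        "N (\<lambda>t. g t - (\<Sum>i<n. b i * indicator (\<omega> i) t)) \<le> e * N (indicator A)"
        by (rule bounded_step_approx[OF A(1,3) g(1,2,3) e(1)]) (assumption | rule that)+
      define s where "s t = (\<Sum>i<n. b i * indicator (\<omega> i) t)" for t
      have sE: "s \<in> E" unfolding s_def by (rule family_step_in[OF v(1)])
      have [measurable]: "s \<in> borel_measurable \<nu>" by (rule m\<nu>[OF meas[OF sE]])
      have w\<nu>: "\<omega> i \<in> sets \<nu>" "emeasure \<nu> (\<omega> i) < \<infinity>" if "i < n" for i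
      proof -
        have "\<omega> i \<in> sets M" "\<omega> i \<subseteq> \<sigma>" "emeasure M (\<omega> i) < \<infinity>"
          using v(1) v(2)[OF that] A(2) that by (auto simp: finite_family_def)
        then show "\<omega> i \<in> sets \<nu>" "emeasure \<nu> (\<omega> i) < \<infinity>" using fin sets\<nu> by auto
      qed
      have ints: "integrable \<nu> (\<lambda>t. (cmod (s t))\<^sup>2)" "(\<integral>t. (cmod (s t))\<^sup>2 \<partial>\<nu>) = (\<Sum>i<n. (cmod (b i))\<^sup>2 * measure \<nu> (\<omega> i))"
      proof -
        have ii: "integrable \<nu> (\<lambda>t. (cmod (b i))\<^sup>2 * indicator (\<omega> i) t)" if "i < n" for i
          using w\<nu>[OF that] by simp
        show "integrable \<nu> (\<lambda>t. (cmod (s t))\<^sup>2)"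
          unfolding s_def step_cmod_square[OF v(1)] by (intro Bochner_Integration.integrable_sum ii) auto
        have "(\<integral>t. (cmod (s t))\<^sup>2 \<partial>\<nu>) = (\<Sum>i<n. \<integral>t. (cmod (b i))\<^sup>2 * indicator (\<omega> i) t \<partial>\<nu>)"
          unfolding s_def step_cmod_square[OF v(1)] by (intro Bochner_Integration.integral_sum ii) auto
        also have "\<dots> = (\<Sum>i<n. (cmod (b i))\<^sup>2 * measure \<nu> (\<omega> i))"
          using w\<nu> by (intro sum.cong) (auto simp: Int_absorb1 sets.sets_into_space)
        finally show "(\<integral>t. (cmod (s t))\<^sup>2 \<partial>\<nu>) = (\<Sum>i<n. (cmod (b i))\<^sup>2 * measure \<nu> (\<omega> i))" .
      qed
      have Ns: "(N s)\<^sup>2 = \<kappa>\<^sup>2 * (\<integral>t. (cmod (s t))\<^sup>2 \<partial>\<nu>)"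
        unfolding ints(2) unfolding s_def using v(2) A(2) by (intro step[OF v(1)]) blast
      have Nd: "\<bar>N g - N s\<bar> \<le> e * N (indicator A)"
        using abs_norm_diff_le[OF gE sE] v(4) by (simp add: s_def[symmetric])
      have NA: "0 \<le> N (indicator A)" by (rule norm_nonneg[OF indicator_in[OF A(1,3)]])
      have "\<bar>(N g)\<^sup>2 - (N s)\<^sup>2\<bar> = \<bar>N g - N s\<bar> * \<bar>N g + N s\<bar>"
        by (rule abs_diff_squares)
      also have "\<dots> \<le> (e * N (indicator A)) * (2 * N g + N (indicator A))"
      proof (intro mult_mono Nd)
        have "N s \<le> N g + e * N (indicator A)" using Nd by linarith
        also have "e * N (indicator A) \<le> N (indicator A)" using e NA by (simp add: mult_left_le_one_le)
        finally show "\<bar>N g + N s\<bar> \<le> 2 * N g + N (indicator A)" using norm_nonneg[OF gE] norm_nonneg[OF sE] by simp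
      qed (use e NA in auto)
      finally have 1: "\<bar>(N g)\<^sup>2 - (N s)\<^sup>2\<bar> \<le> e * (N (indicator A) * (2 * N g + N (indicator A)))" by (simp add: mult.assoc)
      have "\<bar>(\<integral>t. (cmod (g t))\<^sup>2 \<partial>\<nu>) - (\<integral>t. (cmod (s t))\<^sup>2 \<partial>\<nu>)\<bar> = \<bar>\<integral>t. (cmod (g t))\<^sup>2 - (cmod (s t))\<^sup>2 \<partial>\<nu>\<bar>"
        using int ints by simp
      also have "\<dots> \<le> (\<integral>t. \<bar>(cmod (g t))\<^sup>2 - (cmod (s t))\<^sup>2\<bar> \<partial>\<nu>)"
        using integral_norm_bound[of \<nu> "\<lambda>t. (cmod (g t))\<^sup>2 - (cmod (s t))\<^sup>2"] by simp
      also have "\<dots> \<le> (\<integral>t. (e * (2 * K + 1)) * indicator A t \<partial>\<nu>)"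
      proof (rule integral_mono)
        fix t assume t: "t \<in> space \<nu>"
        then have tM: "t \<in> space M" using space\<nu> \<sigma>s by auto
        show "\<bar>(cmod (g t))\<^sup>2 - (cmod (s t))\<^sup>2\<bar> \<le> (e * (2 * K + 1)) * indicator A t"
        proof (cases "t \<in> A")
          case True
          have d: "\<bar>cmod (g t) - cmod (s t)\<bar> \<le> e"
            using norm_triangle_ineq3[of "g t" "s t"] v(3)[OF tM] by (simp add: s_def[symmetric])
          have "\<bar>(cmod (g t))\<^sup>2 - (cmod (s t))\<^sup>2\<bar> = \<bar>cmod (g t) - cmod (s t)\<bar> * \<bar>cmod (g t) + cmod (s t)\<bar>"
            by (rule abs_diff_squares)
          also have "\<dots> \<le> e * (2 * K + 1)"
            using d g(2)[OF tM] e by (intro mult_mono) auto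
          finally show ?thesis using True by simp
        next
          case False
          have "\<And>m. m < n \<Longrightarrow> t \<notin> \<omega> m" using v(2) False by blast
          then have "s t = 0" unfolding s_def by (rule step_off)
          then show ?thesis using False g(3)[OF tM] by simp
        qed
      qed (use int ints intA in auto)
      also have "\<dots> = e * ((2 * K + 1) * measure \<nu> A)" using A\<nu> by (simp add: Int_absorb1 sets.sets_into_space)
      finally have 2: "\<bar>(\<integral>t. (cmod (g t))\<^sup>2 \<partial>\<nu>) - (\<integral>t. (cmod (s t))\<^sup>2 \<partial>\<nu>)\<bar> \<le> e * ((2 * K + 1) * measure \<nu> A)" .
      have "\<bar>(N g)\<^sup>2 - \<kappa>\<^sup>2 * (\<integral>t. (cmod (g t))\<^sup>2 \<partial>\<nu>)\<bar>
        \<le> \<bar>(N g)\<^sup>2 - (N s)\<^sup>2\<bar> + \<bar>\<kappa>\<^sup>2 * (\<integral>t. (cmod (s t))\<^sup>2 \<partial>\<nu>) - \<kappa>\<^sup>2 * (\<integral>t. (cmod (g t))\<^sup>2 \<partial>\<nu>)\<bar>"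
        unfolding Ns by linarith
      also have "\<bar>\<kappa>\<^sup>2 * (\<integral>t. (cmod (s t))\<^sup>2 \<partial>\<nu>) - \<kappa>\<^sup>2 * (\<integral>t. (cmod (g t))\<^sup>2 \<partial>\<nu>)\<bar>
        = \<kappa>\<^sup>2 * \<bar>(\<integral>t. (cmod (g t))\<^sup>2 \<partial>\<nu>) - (\<integral>t. (cmod (s t))\<^sup>2 \<partial>\<nu>)\<bar>"
        by (simp add: right_diff_distrib[symmetric] abs_mult abs_minus_commute)
      also have "\<dots> \<le> \<kappa>\<^sup>2 * (e * ((2 * K + 1) * measure \<nu> A))" using 2 by (intro mult_left_mono) auto
      finally show ?thesis using 1 by (simp add: algebra_simps)
    qed
    note small = this
    let ?L = "N (indicator A) * (2 * N g + N (indicator A)) + \<kappa>\<^sup>2 * ((2 * K + 1) * measure \<nu> A)"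
    have "\<bar>(N g)\<^sup>2 - \<kappa>\<^sup>2 * (\<integral>t. (cmod (g t))\<^sup>2 \<partial>\<nu>)\<bar> \<le> 0"
    proof (rule tendsto_lowerbound[of "\<lambda>k::nat. (1 / real (Suc k)) * ?L"])
      show "(\<lambda>k. 1 / real (Suc k) * ?L) \<longlonglongrightarrow> 0"
        using tendsto_mult_right[OF LIMSEQ_Suc[OF lim_const_over_n[of "1::real"]], of ?L] by simp
      show "\<forall>\<^sub>F k in sequentially. \<bar>(N g)\<^sup>2 - \<kappa>\<^sup>2 * (\<integral>t. (cmod (g t))\<^sup>2 \<partial>\<nu>)\<bar> \<le> 1 / real (Suc k) * ?L"
        by (intro always_eventually allI small) auto
    qed simp
    then show "(N g)\<^sup>2 = \<kappa>\<^sup>2 * (\<integral>t. (cmod (g t))\<^sup>2 \<partial>\<nu>)" by simp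
  qed
  have [measurable]: "f \<in> borel_measurable M" "f \<in> borel_measurable \<nu>" by (rule meas[OF f]) (rule m\<nu>[OF meas[OF f]])
  obtain A :: "nat \<Rightarrow> 'a set" where A: "range A \<subseteq> sets M" "(\<Union>i. A i) = space M" "\<And>i. emeasure M (A i) \<noteq> \<infinity>" "incseq A"
    using sigma_finite_incseq by blast
  have Am[measurable]: "A i \<in> sets M" for i using A(1) by auto
  define X where "X k = {t \<in> space M. cmod (f t) \<le> real k \<and> t \<in> A k}" for k :: nat
  have Xm[measurable]: "X k \<in> sets M" for k unfolding X_def by measurable
  have Xinc: "incseq X"
    unfolding incseq_def
  proof (intro allI impI subsetI)
    fix k j :: nat and t assume "k \<le> j" "t \<in> X k"
    moreover have "A k \<subseteq> A j" using A(4) \<open>k \<le> j\<close> by (simp add: incseq_def)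
    ultimately show "t \<in> X j" using of_nat_mono[of k j, where 'a = real] by (auto simp: X_def)
  qed
  have XU: "(\<Union>k. X k) = space M"
  proof (intro equalityI subsetI)
    fix t assume t: "t \<in> space M"
    then have "t \<in> (\<Union>i. A i)" using A(2) by simp
    then obtain i where i: "t \<in> A i" by (rule UN_E)
    obtain j :: nat where j: "cmod (f t) \<le> real j" using real_arch_simple by blast
    have "t \<in> A (max i j)" using incseqD[OF A(4), of i "max i j"] i by auto
    then have "t \<in> X (max i j)" using t j by (auto simp: X_def)
    then show "t \<in> (\<Union>k. X k)" by blast
  qed (auto simp: X_def)
  have Xfin: "emeasure M (S \<inter> \<sigma>) < \<infinity>" if "S \<subseteq> X k" for S k
  proof -
    have "S \<inter> \<sigma> \<subseteq> A k" using that by (auto simp: X_def)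
    then have "emeasure M (S \<inter> \<sigma>) \<le> emeasure M (A k)" by (intro emeasure_mono Am)
    then show ?thesis using A(3)[of k] by (simp add: less_top order_le_less_trans)
  qed
  have fk: "integrable \<nu> (\<lambda>t. (cmod (rho S f t))\<^sup>2)" "(N (rho S f))\<^sup>2 = \<kappa>\<^sup>2 * (\<integral>t. (cmod (rho S f t))\<^sup>2 \<partial>\<nu>)"
    if S: "S \<in> sets M" "S \<subseteq> X k" for S k
  proof -
    have *: "S \<inter> \<sigma> \<in> sets M" "S \<inter> \<sigma> \<subseteq> \<sigma>" "rho S f \<in> borel_measurable M" using S \<sigma> by auto
    have **: "cmod (rho S f t) \<le> real k" for t using S(2) by (auto simp: rho_apply X_def)
    have ***: "rho S f t = 0" if "t \<notin> S \<inter> \<sigma>" for t using that f0 by (auto simp: rho_apply)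
    show "integrable \<nu> (\<lambda>t. (cmod (rho S f t))\<^sup>2)" "(N (rho S f))\<^sup>2 = \<kappa>\<^sup>2 * (\<integral>t. (cmod (rho S f t))\<^sup>2 \<partial>\<nu>)"
      using bounded[OF *(1,2) Xfin[OF S(2)] *(3) ** ***] by auto
  qed
  have lim_pt: "(\<lambda>k. rho (X k) f t) \<longlonglongrightarrow> f t" if "t \<in> space M" for t
  proof -
    have "t \<in> (\<Union>k. X k)" using XU that by simp
    then obtain k where "t \<in> X k" by (rule UN_E)
    then have "\<forall>\<^sub>F j in sequentially. rho (X j) f t = f t"
      using Xinc by (auto simp: eventually_sequentially rho_apply incseq_def intro!: exI[of _ k])
    then show ?thesis by (rule tendsto_eventually)
  qed
  have \<sigma>s: "\<And>t. t \<in> \<sigma> \<Longrightarrow> t \<in> space M" using sets.sets_into_space[OF \<sigma>] by auto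
  have mono: "(cmod (rho (X k) f t))\<^sup>2 \<le> (cmod (rho (X j) f t))\<^sup>2" if "k \<le> j" for k j t
    using Xinc that by (auto simp: rho_apply incseq_def)
  \<comment> \<open>Truncating does not increase \<open>N\<close>, so the integrals are bounded, and
    monotone convergence puts \<open>f\<close> into L_2 before \<open>N f\<close> itself has been
    computed.\<close>
  have le: "(\<integral>t. (cmod (rho (X k) f t))\<^sup>2 \<partial>\<nu>) \<le> (N f)\<^sup>2 / \<kappa>\<^sup>2" for k
  proof -
    have "(N (rho (X k) f))\<^sup>2 \<le> (N f)\<^sup>2"
      using norm_rho_le[OF Xm f] norm_nonneg[OF rho_in[OF Xm f]] by (rule power_mono)
    then show ?thesis unfolding fk(2)[OF Xm order_refl] using \<kappa> by (simp add: field_simps)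
  qed
  have conv: "convergent (\<lambda>k. \<integral>t. (cmod (rho (X k) f t))\<^sup>2 \<partial>\<nu>)"
  proof (rule Bseq_mono_convergent)
    show "Bseq (\<lambda>k. \<integral>t. (cmod (rho (X k) f t))\<^sup>2 \<partial>\<nu>)"
      by (rule BseqI'[of _ "(N f)\<^sup>2 / \<kappa>\<^sup>2"]) (use le in simp)
    show "\<forall>m n. m \<le> n \<longrightarrow> (\<integral>t. (cmod (rho (X m) f t))\<^sup>2 \<partial>\<nu>) \<le> (\<integral>t. (cmod (rho (X n) f t))\<^sup>2 \<partial>\<nu>)"
      by (intro allI impI integral_mono fk(1)[OF Xm order_refl] mono)
  qed
  then obtain l where l: "(\<lambda>k. \<integral>t. (cmod (rho (X k) f t))\<^sup>2 \<partial>\<nu>) \<longlonglongrightarrow> l" by (auto simp: convergent_def)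
  have mc: "integrable \<nu> (\<lambda>t. (cmod (f t))\<^sup>2)" "(\<integral>t. (cmod (f t))\<^sup>2 \<partial>\<nu>) = l"
  proof -
    have a: "AE t in \<nu>. mono (\<lambda>k. (cmod (rho (X k) f t))\<^sup>2)" using mono by (intro AE_I2 monoI) auto
    have b: "AE t in \<nu>. (\<lambda>k. (cmod (rho (X k) f t))\<^sup>2) \<longlonglongrightarrow> (cmod (f t))\<^sup>2"
      using lim_pt \<sigma>s space\<nu> by (intro AE_I2 tendsto_intros) auto
    have c: "(\<lambda>t. (cmod (f t))\<^sup>2) \<in> borel_measurable \<nu>" by measurable
    show "integrable \<nu> (\<lambda>t. (cmod (f t))\<^sup>2)" "(\<integral>t. (cmod (f t))\<^sup>2 \<partial>\<nu>) = l"
      using integrable_monotone_convergence[OF fk(1)[OF Xm order_refl] a b l c]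
        integral_monotone_convergence[OF fk(1)[OF Xm order_refl] a b l c] by auto
  qed
  \<comment> \<open>The difference of two truncations is the truncation to \<open>X m - X n\<close>,
    so its norm is again given exactly.\<close>
  have cauchyI: "N (\<lambda>t. rho (X m) f t - rho (X n) f t) = \<kappa> * sqrt ((\<integral>t. (cmod (rho (X m) f t))\<^sup>2 \<partial>\<nu>) - (\<integral>t. (cmod (rho (X n) f t))\<^sup>2 \<partial>\<nu>))"
    if "n \<le> m" for m n
  proof -
    have sub: "X n \<subseteq> X m" using Xinc that by (simp add: incseq_def)
    have eq: "(\<lambda>t. rho (X m) f t - rho (X n) f t) = rho (X m - X n) f"
      using sub by (auto simp: rho_apply fun_eq_iff)
    have S: "X m - X n \<in> sets M" "X m - X n \<subseteq> X m" by auto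
    have "(\<integral>t. (cmod (rho (X m - X n) f t))\<^sup>2 \<partial>\<nu>) = (\<integral>t. (cmod (rho (X m) f t))\<^sup>2 - (cmod (rho (X n) f t))\<^sup>2 \<partial>\<nu>)"
      using sub by (intro Bochner_Integration.integral_cong) (auto simp: rho_apply)
    also have "\<dots> = (\<integral>t. (cmod (rho (X m) f t))\<^sup>2 \<partial>\<nu>) - (\<integral>t. (cmod (rho (X n) f t))\<^sup>2 \<partial>\<nu>)"
      by (rule Bochner_Integration.integral_diff[OF fk(1)[OF Xm order_refl] fk(1)[OF Xm order_refl]])
    finally have "(N (rho (X m - X n) f))\<^sup>2 = \<kappa>\<^sup>2 * ((\<integral>t. (cmod (rho (X m) f t))\<^sup>2 \<partial>\<nu>) - (\<integral>t. (cmod (rho (X n) f t))\<^sup>2 \<partial>\<nu>))"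
      using fk(2)[OF S] by simp
    moreover have "N (rho (X m - X n) f) \<ge> 0" by (rule norm_nonneg[OF rho_in[OF S(1) f]])
    ultimately show ?thesis unfolding eq using \<kappa> by (intro eq_mult_sqrtI) auto
  qed
  have rf: "(\<lambda>k. N (\<lambda>t. rho (X k) f t - f t)) \<longlonglongrightarrow> 0"
  proof (rule riesz_fischer(2)[OF meas[OF f]])
    show "range X \<subseteq> sets M" "incseq X" "(\<Union>n. X n) = space M" using Xinc XU by auto
    show "rho (X n) f \<in> E" for n by (rule rho_in[OF Xm f])
    fix e :: real assume e: "e > 0"
    have "Cauchy (\<lambda>k. \<integral>t. (cmod (rho (X k) f t))\<^sup>2 \<partial>\<nu>)" using l LIMSEQ_imp_Cauchy by blast
    then obtain K where K: "\<And>m n. m \<ge> K \<Longrightarrow> n \<ge> K \<Longrightarrow>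
        \<bar>(\<integral>t. (cmod (rho (X m) f t))\<^sup>2 \<partial>\<nu>) - (\<integral>t. (cmod (rho (X n) f t))\<^sup>2 \<partial>\<nu>)\<bar> < (e / \<kappa>)\<^sup>2"
      using e \<kappa> metric_CauchyD[of "\<lambda>k. \<integral>t. (cmod (rho (X k) f t))\<^sup>2 \<partial>\<nu>" "(e / \<kappa>)\<^sup>2"]
      unfolding dist_real_def by (metis divide_pos_pos zero_less_power)
    have main: "N (\<lambda>t. rho (X m) f t - rho (X n) f t) < e" if "n \<le> m" "n \<ge> K" for m n
    proof -
      have "(\<integral>t. (cmod (rho (X m) f t))\<^sup>2 \<partial>\<nu>) - (\<integral>t. (cmod (rho (X n) f t))\<^sup>2 \<partial>\<nu>) < (e / \<kappa>)\<^sup>2"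
        using K[of m n] that by auto
      then have "sqrt ((\<integral>t. (cmod (rho (X m) f t))\<^sup>2 \<partial>\<nu>) - (\<integral>t. (cmod (rho (X n) f t))\<^sup>2 \<partial>\<nu>)) < sqrt ((e / \<kappa>)\<^sup>2)"
        by (rule real_sqrt_less_mono)
      also have "\<dots> = e / \<kappa>" using e \<kappa> by simp
      finally show ?thesis unfolding cauchyI[OF that(1)] using \<kappa> by (simp add: field_simps)
    qed
    have "N (\<lambda>t. rho (X m) f t - rho (X n) f t) < e" if "m \<ge> K" "n \<ge> K" for m n
      using main[of n m] main[of m n] that norm_minus_commute[OF rho_in[OF Xm f] rho_in[OF Xm f], of m n]
      by (cases "n \<le> m") auto
    then show "\<exists>K. \<forall>m\<ge>K. \<forall>n\<ge>K. N (\<lambda>t. rho (X m) f t - rho (X n) f t) < e" by blast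
  qed
  have "(\<lambda>k. N (rho (X k) f)) \<longlonglongrightarrow> N f"
  proof (rule LIM_zero_cancel, rule Lim_null_comparison[OF _ rf])
    show "\<forall>\<^sub>F k in sequentially. norm (N (rho (X k) f) - N f) \<le> N (\<lambda>t. rho (X k) f t - f t)"
      using abs_norm_diff_le[OF rho_in[OF Xm f] f] by simp
  qed
  then have "(\<lambda>k. (N (rho (X k) f))\<^sup>2) \<longlonglongrightarrow> (N f)\<^sup>2" by (rule tendsto_power)
  moreover have "(\<lambda>k. (N (rho (X k) f))\<^sup>2) \<longlonglongrightarrow> \<kappa>\<^sup>2 * l"
    unfolding fk(2)[OF Xm order_refl] by (intro tendsto_intros l)
  ultimately have "(N f)\<^sup>2 = \<kappa>\<^sup>2 * l" using LIMSEQ_unique by blast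
  then have "N f = \<kappa> * sqrt l"
    using norm_nonneg[OF f] \<kappa> by (intro eq_mult_sqrtI) auto
  then show ?thesis using mc by (simp add: L2_space_def L2_norm_def)
qed


text \<open>If the average of \<open>g\<close> on \<open>v j\<close> were 0, that of
  \<open>g - c\<close> would be \<open>- c\<close>; but \<open>g - c\<close> is at most
  \<open>\<bar>c\<bar> / 2\<close> there, and averaging has norm one. This shows that closeness to a
  nonzero constant is detected by every averaging and on every smaller piece of positive
  measure.\<close>

lemma averaging_nonzero:
  assumes fam: "finite_family n v" and \<phi>: "averaging n v \<phi>" and j: "j < n" and pos: "emeasure M (v j) > 0"
    and g: "g \<in> E" and c: "c \<noteq> 0" and near: "\<And>t. t \<in> v j \<Longrightarrow> cmod (g t - c) \<le> cmod c / 2"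
  shows "\<phi> j g \<noteq> 0"
proof
  assume 0: "\<phi> j g = 0"
  have jm: "v j \<in> sets M" "emeasure M (v j) < \<infinity>" using fam j by (auto simp: finite_family_def)
  have jE: "indicator (v j) \<in> E" using jm by (rule indicator_in)
  let ?g = "\<lambda>t. g t + (- c) * indicator (v j) t"
  have gE: "?g \<in> E" by (rule add[OF g scale[OF jE]])
  let ?h = "rho (v j) ?g"
  have hE: "?h \<in> E" by (rule rho_in[OF jm(1) gE])
  have "\<phi> j ?h = \<phi> j ?g" by (rule averaging_rho[OF \<phi> j gE])
  also have "\<dots> = \<phi> j g + (- c) * \<phi> j (indicator (v j))"
    using averaging_add[OF \<phi> j g scale[OF jE, of "- c"]] averaging_scale[OF \<phi> j jE, of "- c"] by (simp only:)
  finally have h: "\<phi> j ?h = - c" using 0 averaging_one[OF \<phi> j pos] by simp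
  have "cmod c * N (indicator (v j)) = cmod (\<phi> j ?h) * N (indicator (v j))" unfolding h by simp
  also have "\<dots> \<le> N (\<lambda>t. \<Sum>i<n. \<phi> i ?h * indicator (v i) t)"
    by (rule step_component_le[OF fam j])
  also have "\<dots> \<le> N ?h" by (rule averaging_le[OF \<phi> hE])
  also have "\<dots> \<le> cmod c / 2 * N (indicator (v j))"
    by (rule bounded_support(2)[OF jm meas[OF hE]]) (use near in \<open>auto simp: rho_apply\<close>)
  finally have "cmod c * N (indicator (v j)) \<le> cmod c / 2 * N (indicator (v j))" .
  moreover have "0 < cmod c * N (indicator (v j))" using c norm_indicator_pos[OF jm pos] by simp
  ultimately show False by simp
qed

text \<open>\<open>A\<close> is adjoined as coordinate \<open>n\<close>. It is coupled to every
  non-null piece of \<open>B\<close>, so the coefficients on \<open>B\<close> can be merged into the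
  one at \<open>A\<close>, one after the other. What remains is a multiple of the indicator of
  \<open>A\<close>, with the root of a weighted sum of squares as its coefficient.\<close>

lemma coupled_square_sum:
  assumes av: "has_averaging" and T: "hermitian T C"
    and A: "A \<in> sets M" "emeasure M A < \<infinity>" and AB: "A \<inter> B = {}" and c: "c \<noteq> 0"
    and near: "\<And>t. t \<in> B \<Longrightarrow> cmod (T (indicator A) t - c) \<le> cmod c / 2"
    and fam: "finite_family n \<omega>" and sub: "\<And>i. i < n \<Longrightarrow> \<omega> i \<subseteq> B"
  shows "(N (\<lambda>t. \<Sum>i<n. b i * indicator (\<omega> i) t))\<^sup>2 = (\<Sum>i<n. (cmod (b i))\<^sup>2 * (N (indicator (\<omega> i)))\<^sup>2)"
proof -
  have lin: "linear_map M E M E T" using T by (simp add: hermitian_def)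
  define v where "v = (\<lambda>i. if i = n then A else \<omega> i)"
  have fam': "finite_family (Suc n) v"
    unfolding finite_family_def
  proof (intro conjI allI impI)
    show "disjoint_family_on v {..<Suc n}"
      using fam sub AB unfolding finite_family_def disjoint_family_on_def v_def
      by (auto simp: less_Suc_eq) blast+
  qed (use fam A in \<open>auto simp: finite_family_def v_def less_Suc_eq\<close>)
  obtain \<phi> where \<phi>: "averaging (Suc n) v \<phi>" using av fam' unfolding has_averaging_def by blast
  have AE: "indicator A \<in> E" using A by (rule indicator_in)
  define F where "F d = N (\<lambda>t. \<Sum>m<Suc n. d m * indicator (v m) t)" for d
  have Fcong: "F d = F d'" if "\<And>m. m < Suc n \<Longrightarrow> cmod (d m) = cmod (d' m)" for d d'
    unfolding F_def by (rule step_cong_cmod[OF fam' that])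
  have "\<exists>\<theta>\<ge>0. \<forall>d. F d = F (d(n := complex_of_real (sqrt ((cmod (d n))\<^sup>2 + \<theta> * (cmod (d j))\<^sup>2)), j := 0))"
    if j: "j < n" for j
  proof (cases "emeasure M (\<omega> j) = 0")
    case True
    \<comment> \<open>A null piece is not coupled to anything; it is merged with weight 0.\<close>
    have "F d = F (d(n := complex_of_real (sqrt ((cmod (d n))\<^sup>2 + 0 * (cmod (d j))\<^sup>2)), j := 0))" for d
      unfolding F_def
    proof (rule norm_cong_cmod[OF family_step_in[OF fam'] family_step_in[OF fam']])
      have "AE t in M. t \<notin> \<omega> j" using True fam j by (intro AE_not_in) (auto simp: finite_family_def)
      then show "AE t in M. cmod (\<Sum>m<Suc n. d m * indicator (v m) t) =
        cmod (\<Sum>m<Suc n. (d(n := complex_of_real (sqrt ((cmod (d n))\<^sup>2 + 0 * (cmod (d j))\<^sup>2)), j := 0)) m * indicator (v m) t)"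
      proof eventually_elim
        case (elim t)
        show ?case
        proof (cases "\<exists>m<Suc n. t \<in> v m")
          case True
          then obtain m where m: "m < Suc n" "t \<in> v m" by blast
          then have "m \<noteq> j" using elim j by (auto simp: v_def)
          then show ?thesis unfolding step_at[OF fam' m] by auto
        next
          case False
          then show ?thesis using step_off[of "Suc n" t v] by simp
        qed
      qed
    qed
    then show ?thesis by blast
  next
    case False
    then have pos: "emeasure M (\<omega> j) > 0" by (simp add: zero_less_iff_neq_zero)
    have vj: "v j = \<omega> j" "v n = A" using j by (auto simp: v_def)
    have jm: "\<omega> j \<in> sets M" "emeasure M (\<omega> j) < \<infinity>" using fam j by (auto simp: finite_family_def)
    have jE: "indicator (\<omega> j) \<in> E" using jm by (rule indicator_in)
    have TE: "T (indicator A) \<in> E" by (rule linear_map_in[OF lin AE])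
    have "\<phi> j (T (indicator (v n))) \<noteq> 0"
      unfolding vj by (rule averaging_nonzero[OF fam' \<phi> _ _ TE c]) (use j pos near sub[OF j] vj in auto)
    then have "\<exists>\<theta>>0. \<forall>d. F d = F (d(n := complex_of_real (sqrt ((cmod (d n))\<^sup>2 + \<theta> * (cmod (d j))\<^sup>2)), j := 0))"
      unfolding F_def by (intro coupling[OF fam' \<phi> T]) (use j in \<open>simp_all del: sum.lessThan_Suc\<close>)
    then show ?thesis by (meson less_imp_le)
  qed
  then obtain \<theta> where \<theta>0: "\<And>j. j < n \<Longrightarrow> \<theta> j \<ge> 0"
    and \<theta>: "\<And>j d. j < n \<Longrightarrow> F d = F (d(n := complex_of_real (sqrt ((cmod (d n))\<^sup>2 + \<theta> j * (cmod (d j))\<^sup>2)), j := 0))"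
    by metis
  have merge: "F d = F (\<lambda>m. if m < k then 0 else if m = n then complex_of_real (sqrt ((cmod (d n))\<^sup>2 + (\<Sum>j<k. \<theta> j * (cmod (d j))\<^sup>2))) else d m)"
    if "k \<le> n" for k d
    using that
  proof (induction k)
    case 0
    show ?case by (rule Fcong) simp
  next
    case (Suc k)
    define e where "e = (\<lambda>m. if m < k then 0 else if m = n then complex_of_real (sqrt ((cmod (d n))\<^sup>2 + (\<Sum>j<k. \<theta> j * (cmod (d j))\<^sup>2))) else d m)"
    have k: "k < n" using Suc by simp
    have nn: "0 \<le> (cmod (d n))\<^sup>2 + (\<Sum>j<k. \<theta> j * (cmod (d j))\<^sup>2)"
      using \<theta>0 k by (intro add_nonneg_nonneg sum_nonneg mult_nonneg_nonneg) auto
    have "F d = F e" using Suc by (simp add: e_def)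
    also have "\<dots> = F (e(n := complex_of_real (sqrt ((cmod (e n))\<^sup>2 + \<theta> k * (cmod (e k))\<^sup>2)), k := 0))" by (rule \<theta>[OF k])
    also have "e(n := complex_of_real (sqrt ((cmod (e n))\<^sup>2 + \<theta> k * (cmod (e k))\<^sup>2)), k := 0)
      = (\<lambda>m. if m < Suc k then 0 else if m = n then complex_of_real (sqrt ((cmod (d n))\<^sup>2 + (\<Sum>j<Suc k. \<theta> j * (cmod (d j))\<^sup>2))) else d m)"
      using k nn by (auto simp: e_def fun_eq_iff less_Suc_eq add.assoc)
    finally show ?case .
  qed
  have Fn: "F d = sqrt (\<Sum>j<n. \<theta> j * (cmod (d j))\<^sup>2) * N (indicator A)" if "d n = 0" for d
  proof -
    have "F d = F (\<lambda>m. if m < n then 0 else if m = n then complex_of_real (sqrt (\<Sum>j<n. \<theta> j * (cmod (d j))\<^sup>2)) else d m)"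
      using merge[of n d] that by (simp cong: if_cong)
    also have "\<dots> = N (\<lambda>t. complex_of_real (sqrt (\<Sum>j<n. \<theta> j * (cmod (d j))\<^sup>2)) * indicator A t)"
      unfolding F_def by (simp add: v_def)
    also have "\<dots> = \<bar>sqrt (\<Sum>j<n. \<theta> j * (cmod (d j))\<^sup>2)\<bar> * N (indicator A)"
      using norm_scale[OF AE] by simp
    also have "\<bar>sqrt (\<Sum>j<n. \<theta> j * (cmod (d j))\<^sup>2)\<bar> = sqrt (\<Sum>j<n. \<theta> j * (cmod (d j))\<^sup>2)"
      using \<theta>0 by (intro abs_of_nonneg real_sqrt_ge_zero sum_nonneg mult_nonneg_nonneg) auto
    finally show ?thesis .
  qed
  have Fo: "F d = N (\<lambda>t. \<Sum>i<n. d i * indicator (\<omega> i) t)" if "d n = 0" for d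
  proof -
    have "(\<Sum>m<Suc n. d m * indicator (v m) t) = (\<Sum>i<n. d i * indicator (\<omega> i) t)" for t
      unfolding sum.lessThan_Suc that by (simp only: mult_zero_left add_0_right) (rule sum.cong, auto simp: v_def)
    then show ?thesis unfolding F_def by presburger
  qed
  have sq: "F d ^ 2 = (\<Sum>j<n. \<theta> j * (cmod (d j))\<^sup>2) * (N (indicator A))\<^sup>2" if "d n = 0" for d
    unfolding Fn[of d, OF that] power_mult_distrib
    using \<theta>0 by (subst real_sqrt_pow2) (auto intro!: sum_nonneg)
  \<comment> \<open>The weights are identified by evaluating the quadratic formula on a single
    indicator.\<close>
  have \<theta>N: "(N (indicator (\<omega> j)))\<^sup>2 = \<theta> j * (N (indicator A))\<^sup>2" if j: "j < n" for j
  proof -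
    define d where "d = (\<lambda>m. if m = j then 1 else 0 :: complex)"
    have dn: "d n = 0" using j by (simp add: d_def)
    have "(\<Sum>i<n. d i * indicator (\<omega> i) t) = (indicator (\<omega> j) t :: complex)" for t
    proof -
      have "(\<Sum>i<n. d i * indicator (\<omega> i) t) = (\<Sum>i<n. if i = j then indicator (\<omega> j) t else (0::complex))"
        by (intro sum.cong) (auto simp: d_def)
      then show ?thesis using j by (simp only: sum.delta finite_lessThan lessThan_iff if_True)
    qed
    then have "F d = N (indicator (\<omega> j))" using Fo[of d, OF dn] by presburger
    moreover have "(\<Sum>i<n. \<theta> i * (cmod (d i))\<^sup>2) = \<theta> j"
    proof -
      have "(\<Sum>i<n. \<theta> i * (cmod (d i))\<^sup>2) = (\<Sum>i<n. if i = j then \<theta> j else 0)"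
        by (intro sum.cong) (auto simp: d_def)
      then show ?thesis using j by simp
    qed
    ultimately show ?thesis using sq[of d, OF dn] by simp
  qed
  define d where "d = b(n := 0)"
  have dn: "d n = 0" by (simp add: d_def)
  have "(\<Sum>i<n. d i * indicator (\<omega> i) t) = (\<Sum>i<n. b i * indicator (\<omega> i) t)" for t
    by (intro sum.cong) (auto simp: d_def)
  then have "(N (\<lambda>t. \<Sum>i<n. b i * indicator (\<omega> i) t))\<^sup>2 = (F d)\<^sup>2" using Fo[of d, OF dn] by presburger
  also have "\<dots> = (\<Sum>j<n. \<theta> j * (cmod (d j))\<^sup>2) * (N (indicator A))\<^sup>2" by (rule sq[of d, OF dn])
  also have "\<dots> = (\<Sum>i<n. (cmod (b i))\<^sup>2 * (N (indicator (\<omega> i)))\<^sup>2)"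
    unfolding sum_distrib_right by (intro sum.cong) (auto simp: \<theta>N d_def)
  finally show ?thesis .
qed

text \<open>The measure is \<open>S \<mapsto> (N (indicator S))^2\<close>. Finite additivity is the
  assumed Pythagorean identity; for countable additivity, the bound by
  \<open>N (indicator B)\<close> makes the partial unions Cauchy, and completeness makes them
  converge in norm to the whole union.\<close>

lemma not_free_from_L2_components:
  assumes B: "B \<in> sets M" "emeasure M B < \<infinity>" "emeasure M B > 0"
    and step: "\<And>n \<omega> b. finite_family n \<omega> \<Longrightarrow> (\<And>i. i < n \<Longrightarrow> \<omega> i \<subseteq> B) \<Longrightarrow>
      (N (\<lambda>t. \<Sum>i<n. b i * indicator (\<omega> i) t))\<^sup>2 = (\<Sum>i<n. (cmod (b i))\<^sup>2 * (N (indicator (\<omega> i)))\<^sup>2)"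
  shows "\<not> free_from_L2_components M E N"
proof -
  have sets: "S \<in> sets (restrict_space M B) \<longleftrightarrow> S \<in> sets M \<and> S \<subseteq> B" for S
    using B by (auto simp: sets_restrict_space_iff)
  have finS: "emeasure M S < \<infinity>" if "S \<subseteq> B" for S
    using emeasure_mono[OF that B(1)] B(2) by (rule order_le_less_trans)
  have SE: "indicator S \<in> E" if "S \<in> sets M" "S \<subseteq> B" for S using indicator_in[OF that(1) finS[OF that(2)]] .
  define \<mu> where "\<mu> S = ennreal ((N (indicator S))\<^sup>2)" for S
  define \<nu> where "\<nu> = measure_of B (sets (restrict_space M B)) \<mu>"
  have sp: "space (restrict_space M B) = B" using sets.sets_into_space[OF B(1)] by (auto simp: space_restrict_space)
  have sa: "sigma_algebra B (sets (restrict_space M B))"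
    using sets.sigma_algebra_axioms[of "restrict_space M B"] sp by simp
  have sets\<nu>: "sets \<nu> = sets (restrict_space M B)"
    unfolding \<nu>_def using sa sigma_algebra.sets_measure_of_eq by blast
  have union: "(N (indicator (\<Union>i\<in>{m..<n}. S i)))\<^sup>2 = (\<Sum>i\<in>{m..<n}. (N (indicator (S i)))\<^sup>2)"
    if S: "range S \<subseteq> sets (restrict_space M B)" "disjoint_family S" for S :: "nat \<Rightarrow> 'a set" and m n
  proof -
    have Si: "S i \<in> sets M" "S i \<subseteq> B" for i using S(1) sets by auto
    \<comment> \<open>Zero coefficients below \<open>m\<close> let one identity serve both the
      partial unions (\<open>m = 0\<close>) and the tails in the Cauchy condition.\<close>
    define b where "b i = (if m \<le> i then 1 else 0 :: complex)" for i
    have fam: "finite_family n S"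
      unfolding finite_family_def using Si finS S(2) by (auto simp: disjoint_family_on_def)
    have "(\<Sum>i<n. b i * indicator (S i) t) = (indicator (\<Union>i\<in>{m..<n}. S i) t :: complex)" for t
    proof (cases "\<exists>i<n. t \<in> S i")
      case True
      then obtain i where i: "i < n" "t \<in> S i" by blast
      have "t \<notin> S j" if "j \<noteq> i" for j using S(2) that i by (auto simp: disjoint_family_on_def)
      then have "t \<in> (\<Union>i\<in>{m..<n}. S i) \<longleftrightarrow> m \<le> i" using i by (auto; metis)
      then show ?thesis using step_at[OF fam i, of b] by (simp add: b_def)
    next
      case False
      then show ?thesis using step_off[of n t S b] by auto
    qed
    then have "(N (indicator (\<Union>i\<in>{m..<n}. S i)))\<^sup>2 = (\<Sum>i<n. (cmod (b i))\<^sup>2 * (N (indicator (S i)))\<^sup>2)"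
      using step[OF fam Si(2), of b] by presburger
    also have "\<dots> = (\<Sum>i\<in>{m..<n}. (N (indicator (S i)))\<^sup>2)"
      by (rule sum.mono_neutral_cong_right) (auto simp: b_def)
    finally show ?thesis .
  qed
  have ca: "countably_additive (sets (restrict_space M B)) \<mu>"
    unfolding countably_additive_def
  proof (intro allI impI)
    fix S :: "nat \<Rightarrow> 'a set"
    assume S: "range S \<subseteq> sets (restrict_space M B)" "disjoint_family S" "(\<Union> (range S)) \<in> sets (restrict_space M B)"
    have Si: "S i \<in> sets M" "S i \<subseteq> B" for i using S(1) sets by auto
    have U: "(\<Union>i. S i) \<in> sets M" "(\<Union>i. S i) \<subseteq> B" using S(3) sets by auto
    define u where "u i = (N (indicator (S i)))\<^sup>2" for i
    define R where "R n = (\<Union>i\<in>{0..<n}. S i)" for n :: nat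
    have Rm: "R n \<in> sets M" "R n \<subseteq> B" for n unfolding R_def using Si by auto
    have Rsum: "(N (indicator (R n)))\<^sup>2 = (\<Sum>i<n. u i)" for n
      unfolding R_def u_def using union[OF S(1,2), of 0 n] by (simp add: atLeast0LessThan)
    have "(N (indicator (R n)))\<^sup>2 \<le> (N (indicator B))\<^sup>2" for n
      by (intro power_mono norm_mono_in SE B norm_nonneg Rm) (use Rm in \<open>auto simp: indicator_def\<close>)
    then have su: "summable u" unfolding Rsum
      by (intro summableI_nonneg_bounded[of u "(N (indicator B))\<^sup>2"]) (auto simp: u_def)
    \<comment> \<open>The complement of the union is added so that the sets exhaust the space; it
      does not change the truncations of an indicator supported on the union.\<close>
    define X where "X n = R n \<union> (space M - (\<Union>i. S i))" for n
    have Xr: "rho (X n) (indicator (\<Union>i. S i)) = indicator (R n)" for n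
      by (auto simp: rho_apply X_def R_def fun_eq_iff indicator_def)
    have "(\<lambda>n. N (\<lambda>t. rho (X n) (indicator (\<Union>i. S i)) t - indicator (\<Union>i. S i) t)) \<longlonglongrightarrow> 0"
    proof (rule riesz_fischer(2))
      show "(indicator (\<Union>i. S i) :: 'a \<Rightarrow> complex) \<in> borel_measurable M" using U by measurable
      show "range X \<subseteq> sets M" using Rm U by (auto simp: X_def)
      show "incseq X" by (fastforce simp: incseq_def X_def R_def)
      show "(\<Union>n. X n) = space M"
      proof (intro equalityI subsetI)
        fix t assume t: "t \<in> space M"
        show "t \<in> (\<Union>n. X n)"
        proof (cases "t \<in> (\<Union>i. S i)")
          case True
          then obtain i where "t \<in> S i" by blast
          then have "t \<in> X (Suc i)" by (auto simp: X_def R_def)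
          then show ?thesis by blast
        qed (use t in \<open>auto simp: X_def\<close>)
      next
        fix t assume "t \<in> (\<Union>n. X n)"
        then show "t \<in> space M" using sets.sets_into_space[OF Rm(1)] by (fastforce simp: X_def)
      qed
      show "rho (X n) (indicator (\<Union>i. S i)) \<in> E" for n unfolding Xr by (rule SE[OF Rm])
      fix e :: real assume e: "e > 0"
      then have e2: "e\<^sup>2 > 0" by simp
      obtain K where K: "\<And>m n. m \<ge> K \<Longrightarrow> norm (\<Sum>i\<in>{m..<n}. u i) < e\<^sup>2"
        using su e2 unfolding summable_Cauchy by blast
      have main: "N (\<lambda>t. rho (X m) (indicator (\<Union>i. S i)) t - rho (X n) (indicator (\<Union>i. S i)) t) < e"
        if "n \<le> m" "n \<ge> K" for m n
      proof -
        have "(\<lambda>t. rho (X m) (indicator (\<Union>i. S i)) t - rho (X n) (indicator (\<Union>i. S i)) t) = (indicator (\<Union>i\<in>{n..<m}. S i) :: 'a \<Rightarrow> complex)"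
        proof
          fix t
          show "rho (X m) (indicator (\<Union>i. S i)) t - rho (X n) (indicator (\<Union>i. S i)) t = (indicator (\<Union>i\<in>{n..<m}. S i) t :: complex)"
          proof (cases "\<exists>i. t \<in> S i")
            case True
            then obtain i where i: "t \<in> S i" by blast
            have "t \<in> S j \<longleftrightarrow> j = i" for j using S(2) i by (auto simp: disjoint_family_on_def)
            then show ?thesis unfolding Xr R_def using that by (auto simp: indicator_def)
          qed (auto simp: Xr R_def indicator_def)
        qed
        moreover have "(N (indicator (\<Union>i\<in>{n..<m}. S i)))\<^sup>2 < e\<^sup>2"
          using K[OF that(2), of m] union[OF S(1,2), of n m] by (simp add: u_def)
        ultimately show ?thesis using e by (simp add: power2_less_imp_less)
      qed
      have "N (\<lambda>t. rho (X m) (indicator (\<Union>i. S i)) t - rho (X n) (indicator (\<Union>i. S i)) t) < e" if "m \<ge> K" "n \<ge> K" for m n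
        using main[of n m] main[of m n] that norm_minus_commute[OF SE[OF Rm] SE[OF Rm], of m n] unfolding Xr
        by (cases "n \<le> m") auto
      then show "\<exists>K. \<forall>m\<ge>K. \<forall>n\<ge>K. N (\<lambda>t. rho (X m) (indicator (\<Union>i. S i)) t - rho (X n) (indicator (\<Union>i. S i)) t) < e" by blast
    qed
    then have rf: "(\<lambda>n. N (\<lambda>t. indicator (R n) t - indicator (\<Union>i. S i) t)) \<longlonglongrightarrow> 0" unfolding Xr .
    have "(\<lambda>n. N (indicator (R n))) \<longlonglongrightarrow> N (indicator (\<Union>i. S i))"
    proof (rule LIM_zero_cancel, rule Lim_null_comparison[OF _ rf])
      show "\<forall>\<^sub>F k in sequentially. norm (N (indicator (R k)) - N (indicator (\<Union>i. S i))) \<le> N (\<lambda>t. indicator (R k) t - indicator (\<Union>i. S i) t)"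
        using abs_norm_diff_le[OF SE[OF Rm] SE[OF U]] by simp
    qed
    then have "(\<lambda>n. (N (indicator (R n)))\<^sup>2) \<longlonglongrightarrow> (N (indicator (\<Union>i. S i)))\<^sup>2" by (rule tendsto_power)
    then have "u sums (N (indicator (\<Union>i. S i)))\<^sup>2" unfolding Rsum sums_def .
    then have "(\<Sum>i. ennreal (u i)) = ennreal ((N (indicator (\<Union>i. S i)))\<^sup>2)"
      using suminf_ennreal2[OF _ su] sums_unique by (metis u_def zero_le_power2)
    then show "(\<Sum>i. \<mu> (S i)) = \<mu> (\<Union> (range S))" by (simp add: \<mu>_def u_def)
  qed
  have pos: "positive (sets (restrict_space M B)) \<mu>"
  proof -
    have "indicator {} = (\<lambda>t::'a. 0 :: complex)" by (rule ext) simp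
    then show ?thesis using norm_zero by (simp add: positive_def \<mu>_def)
  qed
  have em: "emeasure \<nu> S = \<mu> S" if "S \<in> sets M" "S \<subseteq> B" for S
    unfolding \<nu>_def by (rule emeasure_measure_of_sigma[OF sa pos ca]) (use that sets in auto)
  have me: "measure \<nu> S = (N (indicator S))\<^sup>2" if "S \<in> sets M" "S \<subseteq> B" for S
    using em[OF that] by (simp add: measure_def \<mu>_def)
  have L2: "f \<in> L2_space \<nu> \<and> N f = 1 * L2_norm \<nu> f" if "f \<in> E" "\<And>t. t \<notin> B \<Longrightarrow> f t = 0" for f
  proof (rule L2_norm_extension[OF B(1) sets\<nu> zero_less_one _ _ that])
    show "emeasure \<nu> S < \<infinity>" if "S \<in> sets M" "S \<subseteq> B" for S using em[OF that] by (simp add: \<mu>_def)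
    show "(N (\<lambda>t. \<Sum>i<n. b i * indicator (\<omega> i) t))\<^sup>2 = 1\<^sup>2 * (\<Sum>i<n. (cmod (b i))\<^sup>2 * measure \<nu> (\<omega> i))"
      if "finite_family n \<omega>" "\<And>i. i < n \<Longrightarrow> \<omega> i \<subseteq> B" for n \<omega> b
    proof -
      have "(\<Sum>i<n. (cmod (b i))\<^sup>2 * (N (indicator (\<omega> i)))\<^sup>2) = (\<Sum>i<n. (cmod (b i))\<^sup>2 * measure \<nu> (\<omega> i))"
        using that me by (intro sum.cong) (auto simp: finite_family_def)
      then show ?thesis using step[OF that, of b] by simp
    qed
  qed
  have "f \<in> L2_space \<nu> \<and> N f = L2_norm \<nu> f" if "f \<in> rho B ` E" for f
  proof -
    have "f \<in> E" "\<And>t. t \<notin> B \<Longrightarrow> f t = 0" using that rho_in[OF B(1)] by (auto simp: rho_apply)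
    then show ?thesis using L2 by simp
  qed
  then show ?thesis unfolding free_from_L2_components_def using B(1,3) sets\<nu> by blast
qed

lemma local_if_free:
  assumes "has_averaging" "free_from_L2_components M E N" and T: "hermitian T C"
  shows "local_map T"
proof (rule local_map_if_no_coupling[OF T])
  fix A B c assume *: "A \<in> sets M" "B \<in> sets M" "A \<inter> B = {}" "emeasure M A < \<infinity>" "emeasure M B > 0"
    "emeasure M B < \<infinity>" "c \<noteq> (0::complex)"
  show "\<not> (\<forall>t\<in>B. cmod (T (indicator A) t - c) \<le> cmod c / 2)"
  proof
    assume "\<forall>t\<in>B. cmod (T (indicator A) t - c) \<le> cmod c / 2"
    then have "\<not> free_from_L2_components M E N"
      using * by (intro not_free_from_L2_components[of B] coupled_square_sum[OF assms(1) T, of A B c]) auto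
    then show False using assms(2) by simp
  qed
qed

end

section \<open>Symmetric spaces over atomless measures\<close>

lemma bij_betw_add_mod: "bij_betw (\<lambda>i. (i + s) mod k) {..<k} {..<k::nat}"
proof -
  have *: "i = j" if "j \<le> i" "i < k" "(i + s) mod k = (j + s) mod k" for i j
  proof (rule ccontr)
    assume "i \<noteq> j"
    have "k dvd (i + s) - (j + s)" using that mod_eq_dvd_iff_nat[of "j + s" "i + s" k] by simp
    then show False using that \<open>i \<noteq> j\<close> by (auto dest!: dvd_imp_le)
  qed
  have inj: "inj_on (\<lambda>i. (i + s) mod k) {..<k}"
  proof (rule inj_onI)
    fix i j assume "i \<in> {..<k}" "j \<in> {..<k}" "(i + s) mod k = (j + s) mod k"
    then show "i = j" using *[of j i] *[of i j] by (cases "j \<le> i") auto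
  qed
  moreover have "(\<lambda>i. (i + s) mod k) ` {..<k} = {..<k}"
    by (rule endo_inj_surj[OF _ _ inj]) auto
  ultimately show ?thesis by (simp add: bij_betw_def)
qed

lemma disjoint_family_on_fun_upd:
  assumes "disjoint_family_on S {..<k}" "\<And>i. i < k \<Longrightarrow> S i \<inter> B = {}"
  shows "disjoint_family_on (S(k := B)) {..<Suc k}"
  unfolding disjoint_family_on_def
proof (intro ballI impI)
  fix m n assume mn: "m \<in> {..<Suc k}" "n \<in> {..<Suc k}" "m \<noteq> n"
  have "S i \<inter> S j = {}" if "i < k" "j < k" "i \<noteq> j" for i j
    using assms(1) that by (auto simp: disjoint_family_on_def)
  then show "(S(k := B)) m \<inter> (S(k := B)) n = {}"
    using mn assms(2)[of m] assms(2)[of n]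
    by (cases "m = k"; cases "n = k") (simp_all add: less_Suc_eq Int_commute)
qed

lemma integral_indicator_complex:
  assumes "B \<in> sets M"
  shows "integral\<^sup>L M (indicator B) = complex_of_real (measure M B)"
proof -
  have "(indicator B :: _ \<Rightarrow> complex) = (\<lambda>t. complex_of_real (indicator B t))"
    by (auto simp: indicator_def)
  then have "integral\<^sup>L M (indicator B) = complex_of_real (integral\<^sup>L M (indicator B))"
    by (simp only: integral_complex_of_real)
  then show ?thesis using sets.sets_into_space[OF assms] by (simp add: Int_absorb2)
qed

text \<open>Atomlessness is assumed in Sierpinski's intermediate-value form, also for sets of
  infinite measure, since what is needed is to cut pieces of prescribed measure.\<close>

locale atomless_symmetric_space = ideal_function_space M E N + symmetric_space M E N
  for M :: "'a measure" and E N +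
  assumes atomless: "A \<in> sets M \<Longrightarrow> 0 \<le> r \<Longrightarrow> ennreal r \<le> emeasure M A \<Longrightarrow>
    \<exists>B\<in>sets M. B \<subseteq> A \<and> emeasure M B = ennreal r"
begin

lemma split_equal:
  assumes "A \<in> sets M" "0 \<le> \<delta>" "ennreal (real k * \<delta>) \<le> emeasure M A"
  shows "\<exists>S. (\<forall>i<k. S i \<in> sets M \<and> S i \<subseteq> A \<and> emeasure M (S i) = ennreal \<delta>) \<and> disjoint_family_on S {..<k::nat}"
  using assms
proof (induction k arbitrary: A)
  case 0
  show ?case by (auto simp: disjoint_family_on_def)
next
  case (Suc k)
  have "ennreal \<delta> \<le> ennreal (real (Suc k) * \<delta>)" using Suc.prems(2) by (intro ennreal_leI) (simp add: algebra_simps)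
  then have "ennreal \<delta> \<le> emeasure M A" using Suc.prems(3) by (rule order_trans)
  then obtain B where B: "B \<in> sets M" "B \<subseteq> A" "emeasure M B = ennreal \<delta>"
    using atomless[OF Suc.prems(1,2)] by blast
  have AB: "A - B \<in> sets M" using Suc.prems B by auto
  have "ennreal (real k * \<delta>) + ennreal \<delta> = ennreal (real (Suc k) * \<delta>)"
    using Suc.prems(2) by (subst ennreal_plus[symmetric]) (auto simp: algebra_simps)
  also have "\<dots> \<le> emeasure M A" by (rule Suc.prems(3))
  also have "\<dots> = emeasure M (A - B) + ennreal \<delta>"
    using plus_emeasure[OF AB B(1)] B by (simp add: Un_absorb2 Diff_disjoint[of B A, unfolded Int_commute[of B]])
  finally have "ennreal (real k * \<delta>) \<le> emeasure M (A - B)" by simp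
  then obtain S where S: "\<forall>i<k. S i \<in> sets M \<and> S i \<subseteq> A - B \<and> emeasure M (S i) = ennreal \<delta>" "disjoint_family_on S {..<k}"
    using Suc.IH[OF AB Suc.prems(2)] by blast
  show ?case
  proof (intro exI conjI)
    show "\<forall>i<Suc k. (S(k := B)) i \<in> sets M \<and> (S(k := B)) i \<subseteq> A \<and> emeasure M ((S(k := B)) i) = ennreal \<delta>"
      using S(1) B by (auto simp: less_Suc_eq)
    show "disjoint_family_on (S(k := B)) {..<Suc k}"
      by (rule disjoint_family_on_fun_upd[OF S(2)]) (use S(1) in blast)
  qed
qed

lemma union_equal:
  assumes "finite_family k S" "\<And>i. i < k \<Longrightarrow> emeasure M (S i) = ennreal \<delta>" "0 \<le> \<delta>"
  shows "emeasure M (\<Union>i<k. S i) = ennreal (real k * \<delta>)"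
proof -
  have "emeasure M (\<Union>i<k. S i) = (\<Sum>i<k. emeasure M (S i))"
    using assms(1) by (intro sum_emeasure[symmetric]) (auto simp: finite_family_def)
  also have "\<dots> = (\<Sum>i<k. ennreal \<delta>)" using assms(2) by (intro sum.cong) auto
  also have "\<dots> = ennreal (real k * \<delta>)" using assms(3) by (simp add: ennreal_mult ennreal_of_nat_eq_real_of_nat)
  finally show ?thesis .
qed

lemma equal_partition:
  assumes A: "A \<in> sets M" "emeasure M A = ennreal (real k * \<delta>)" and \<delta>: "0 \<le> \<delta>"
  obtains S where "finite_family k S" "\<And>i. i < k \<Longrightarrow> S i \<subseteq> A" "\<And>i. i < k \<Longrightarrow> emeasure M (S i) = ennreal \<delta>"
    "AE t in M. indicator A t = (\<Sum>i<k. 1 * indicator (S i) t :: complex)"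
proof -
  obtain S where S: "\<forall>i<k. S i \<in> sets M \<and> S i \<subseteq> A \<and> emeasure M (S i) = ennreal \<delta>" "disjoint_family_on S {..<k}"
    using split_equal[OF A(1) \<delta>, of k] A(2) by auto
  have fS: "finite_family k S" unfolding finite_family_def using S by auto
  have U: "(\<Union>i<k. S i) \<in> sets M" "(\<Union>i<k. S i) \<subseteq> A" using S(1) by auto
  have emU: "emeasure M (\<Union>i<k. S i) = emeasure M A"
    using union_equal[OF fS, of \<delta>] S(1) \<delta> A by simp
  have "emeasure M (A - (\<Union>i<k. S i)) = 0"
    using emeasure_Diff[of M "\<Union>i<k. S i" A] emU U A by simp
  then have "A - (\<Union>i<k. S i) \<in> null_sets M" using A U by auto
  from AE_not_in[OF this] have "AE t in M. indicator A t = (\<Sum>i<k. 1 * indicator (S i) t :: complex)"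
  proof eventually_elim
    case (elim t)
    show ?case
    proof (cases "\<exists>i<k. t \<in> S i")
      case True
      then obtain i where i: "i < k" "t \<in> S i" by blast
      then have "t \<in> A" using S(1) by blast
      then show ?thesis using step_at[OF fS i, of "\<lambda>i. 1"] by simp
    next
      case False
      then show ?thesis using step_off[of k t S "\<lambda>i. 1"] elim by auto
    qed
  qed
  then show ?thesis using that fS S(1) by blast
qed

text \<open>With pieces of equal measure the distribution function sees only how many coefficients
  exceed each level, not which piece carries them. This turns permutations of coefficients into
  equimeasurable rearrangements.\<close>

lemma step_distribution:
  assumes fam: "finite_family k S" and em: "\<And>i. i < k \<Longrightarrow> emeasure M (S i) = ennreal \<delta>"
    and g[measurable]: "g \<in> borel_measurable M" and x: "0 \<le> (x::real)"
  shows "emeasure M {t \<in> space M. x < cmod ((\<Sum>i<k. c i * indicator (S i) t) + (if t \<in> (\<Union>i<k. S i) then 0 else g t))}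
    = of_nat (card {i. i < k \<and> x < cmod (c i)}) * ennreal \<delta> + emeasure M {t \<in> space M. t \<notin> (\<Union>i<k. S i) \<and> x < cmod (g t)}"
proof -
  have Sm: "S i \<in> sets M" if "i < k" for i using fam that by (auto simp: finite_family_def)
  let ?I = "{i. i < k \<and> x < cmod (c i)}"
  let ?R = "{t \<in> space M. t \<notin> (\<Union>i<k. S i) \<and> x < cmod (g t)}"
  have U[measurable]: "(\<Union>i<k. S i) \<in> sets M" using Sm by auto
  have Rm: "?R \<in> sets M" by measurable
  have Im: "(\<Union>i\<in>?I. S i) \<in> sets M" using Sm by auto
  have "{t \<in> space M. x < cmod ((\<Sum>i<k. c i * indicator (S i) t) + (if t \<in> (\<Union>i<k. S i) then 0 else g t))} = (\<Union>i\<in>?I. S i) \<union> ?R"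
  proof (intro set_eqI)
    fix t
    show "t \<in> {t \<in> space M. x < cmod ((\<Sum>i<k. c i * indicator (S i) t) + (if t \<in> (\<Union>i<k. S i) then 0 else g t))} \<longleftrightarrow> t \<in> (\<Union>i\<in>?I. S i) \<union> ?R"
    proof (cases "\<exists>m<k. t \<in> S m")
      case True
      then obtain m where m: "m < k" "t \<in> S m" by blast
      have "t \<in> S i \<longleftrightarrow> i = m" if "i < k" for i
        using fam m that by (auto simp: finite_family_def disjoint_family_on_def)
      then have "t \<in> (\<Union>i\<in>?I. S i) \<longleftrightarrow> x < cmod (c m)" using m by auto
      moreover have "t \<in> space M" using Sm[OF m(1)] m(2) sets.sets_into_space by blast
      ultimately show ?thesis using m step_at[OF fam m, of c] by auto
    next
      case False
      then have "(\<Sum>i<k. c i * indicator (S i) t) = 0" by (intro step_off) auto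
      then show ?thesis using False by auto
    qed
  qed
  moreover have "emeasure M ((\<Union>i\<in>?I. S i) \<union> ?R) = emeasure M (\<Union>i\<in>?I. S i) + emeasure M ?R"
    by (rule plus_emeasure[symmetric]) (use Im Rm in auto)
  moreover have "emeasure M (\<Union>i\<in>?I. S i) = (\<Sum>i\<in>?I. emeasure M (S i))"
    by (rule sum_emeasure[symmetric]) (use fam Sm in \<open>auto simp: finite_family_def disjoint_family_on_def\<close>)
  moreover have "\<dots> = (\<Sum>i\<in>?I. ennreal \<delta>)" using em by (intro sum.cong) auto
  ultimately show ?thesis by simp
qed

text \<open>Zero coefficients never exceed a level \<open>x >= 0\<close>, so families with different
  numbers of pieces can be compared after padding with zeros.\<close>

lemma norm_step_equidistributed:
  assumes C: "finite_family k C" "\<And>i. i < k \<Longrightarrow> emeasure M (C i) = ennreal \<delta>"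
    and D: "finite_family l D" "\<And>i. i < l \<Longrightarrow> emeasure M (D i) = ennreal \<delta>"
    and card: "\<And>x::real. 0 \<le> x \<Longrightarrow> card {i. i < k \<and> x < cmod (c i)} = card {i. i < l \<and> x < cmod (d i)}"
  shows "N (\<lambda>t. \<Sum>i<k. c i * indicator (C i) t) = N (\<lambda>t. \<Sum>i<l. d i * indicator (D i) t)"
proof -
  have "equimeasurable M (\<lambda>t. cmod (\<Sum>i<l. d i * indicator (D i) t)) (\<lambda>t. cmod (\<Sum>i<k. c i * indicator (C i) t))"
    unfolding equimeasurable_def
  proof (intro allI impI)
    fix x :: real assume x: "0 \<le> x"
    show "emeasure M {t \<in> space M. x < cmod (\<Sum>i<l. d i * indicator (D i) t)} = emeasure M {t \<in> space M. x < cmod (\<Sum>i<k. c i * indicator (C i) t)}"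
      using step_distribution[OF C, of "\<lambda>t. 0" x c] step_distribution[OF D, of "\<lambda>t. 0" x d] x card[OF x]
      by (simp add: if_cancel)
  qed
  then show ?thesis
    using symmetric[OF family_step_in[OF D(1)] meas[OF family_step_in[OF C(1)]]] by blast
qed

lemma norm_indicator_equal:
  assumes "A \<in> sets M" "B \<in> sets M" "emeasure M A = emeasure M B" "emeasure M A < \<infinity>"
  shows "N (indicator A) = N (indicator B)"
proof -
  have "equimeasurable M (\<lambda>t. cmod (indicator A t :: complex)) (\<lambda>t. cmod (indicator B t :: complex))"
    unfolding equimeasurable_def
  proof (intro allI impI)
    fix x :: real assume "0 \<le> x"
    have "{t \<in> space M. x < cmod (indicator S t :: complex)} = (if x < 1 then S else {})" if "S \<in> sets M" for S
      using \<open>0 \<le> x\<close> sets.sets_into_space[OF that] by (auto simp: indicator_def split: if_splits)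
    then show "emeasure M {t \<in> space M. x < cmod (indicator A t :: complex)} = emeasure M {t \<in> space M. x < cmod (indicator B t :: complex)}"
      using assms by simp
  qed
  moreover have "(indicator B :: 'a \<Rightarrow> complex) \<in> borel_measurable M" using assms by measurable
  ultimately show ?thesis using symmetric[OF indicator_in[OF assms(1,4)]] by metis
qed

text \<open>
  The average is the mean of the \<open>k\<close> cyclic shifts of the values, which are all equimeasurable with \<open>g\<close>.
\<close>

lemma norm_average_pieces:
  assumes fam: "finite_family k S" and k: "k > 0" and em: "\<And>i. i < k \<Longrightarrow> emeasure M (S i) = ennreal \<delta>"
    and g: "g \<in> E" and on: "\<And>i t. i < k \<Longrightarrow> t \<in> S i \<Longrightarrow> g t = a i"
  shows "N (\<lambda>t. if t \<in> (\<Union>i<k. S i) then (\<Sum>i<k. a i) / of_nat k else g t) \<le> N g"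
proof -
  have Sm: "S i \<in> sets M" if "i < k" for i using fam that by (auto simp: finite_family_def)
  define U where "U = (\<Union>i<k. S i)"
  have U[measurable]: "U \<in> sets M" unfolding U_def using Sm by auto
  have gm[measurable]: "g \<in> borel_measurable M" by (rule meas[OF g])
  define h where "h s t = (\<Sum>i<k. a ((i + s) mod k) * indicator (S i) t) + (if t \<in> U then 0 else g t)" for s t
  have hm: "h s \<in> borel_measurable M" for s
    unfolding h_def using meas[OF family_step_in[OF fam]] by measurable
  have h0: "h 0 t = g t" for t
  proof (cases "\<exists>m<k. t \<in> S m")
    case True
    then obtain m where m: "m < k" "t \<in> S m" by blast
    then show ?thesis using on[OF m] step_at[OF fam m, of "\<lambda>i. a ((i + 0) mod k)"] by (auto simp: h_def U_def)
  next
    case False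
    then show ?thesis using step_off[of k t S "\<lambda>i. a ((i + 0) mod k)"] by (auto simp: h_def U_def)
  qed
  have eqm: "equimeasurable M (\<lambda>t. cmod (g t)) (\<lambda>t. cmod (h s t))" for s
    unfolding equimeasurable_def
  proof (intro allI impI)
    fix x :: real assume x: "0 \<le> x"
    have bij: "bij_betw (\<lambda>i. (i + s) mod k) {..<k} {..<k}" by (rule bij_betw_add_mod)
    then have inj: "inj_on (\<lambda>i. (i + s) mod k) {..<k}" by (rule bij_betw_imp_inj_on)
    have "bij_betw (\<lambda>i. (i + s) mod k) {i. i < k \<and> x < cmod (a ((i + s) mod k))} {i. i < k \<and> x < cmod (a i)}"
      unfolding bij_betw_def
    proof
      show "inj_on (\<lambda>i. (i + s) mod k) {i. i < k \<and> x < cmod (a ((i + s) mod k))}"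
        by (rule inj_on_subset[OF inj]) auto
      show "(\<lambda>i. (i + s) mod k) ` {i. i < k \<and> x < cmod (a ((i + s) mod k))} = {i. i < k \<and> x < cmod (a i)}"
      proof (intro equalityI subsetI)
        fix j assume j: "j \<in> {i. i < k \<and> x < cmod (a i)}"
        then have "j \<in> (\<lambda>i. (i + s) mod k) ` {..<k}" using bij by (simp add: bij_betw_def)
        then show "j \<in> (\<lambda>i. (i + s) mod k) ` {i. i < k \<and> x < cmod (a ((i + s) mod k))}" using j by auto
      qed (use k in auto)
    qed
    then have "card {i. i < k \<and> x < cmod (a ((i + s) mod k))} = card {i. i < k \<and> x < cmod (a i)}"
      by (rule bij_betw_same_card)
    moreover have "card {i. i < k \<and> x < cmod (a ((i + 0) mod k))} = card {i. i < k \<and> x < cmod (a i)}"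
      by (rule arg_cong[where f = card]) auto
    ultimately have "emeasure M {t \<in> space M. x < cmod (h 0 t)} = emeasure M {t \<in> space M. x < cmod (h s t)}"
      using step_distribution[OF fam em gm x, of "\<lambda>i. a ((i + 0) mod k)"] step_distribution[OF fam em gm x, of "\<lambda>i. a ((i + s) mod k)"]
      unfolding h_def U_def by presburger
    then show "emeasure M {t \<in> space M. x < cmod (g t)} = emeasure M {t \<in> space M. x < cmod (h s t)}" by (simp only: h0)
  qed
  have hE: "h s \<in> E" and hN: "N (h s) = N g" for s using symmetric[OF g hm eqm] by auto
  have "(\<lambda>t. if t \<in> U then (\<Sum>i<k. a i) / of_nat k else g t) = (\<lambda>t. \<Sum>s<k. (1 / of_nat k) * h s t)"
  proof
    fix t
    show "(if t \<in> U then (\<Sum>i<k. a i) / of_nat k else g t) = (\<Sum>s<k. (1 / of_nat k) * h s t)"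
    proof (cases "\<exists>m<k. t \<in> S m")
      case True
      then obtain m where m: "m < k" "t \<in> S m" by blast
      have "h s t = a ((m + s) mod k)" for s
        using step_at[OF fam m, of "\<lambda>i. a ((i + s) mod k)"] m by (auto simp: h_def U_def)
      then have "(\<Sum>s<k. (1 / of_nat k) * h s t) = (1 / of_nat k) * (\<Sum>s<k. a ((m + s) mod k))"
        by (simp only: sum_distrib_left)
      also have "(\<Sum>s<k. a ((m + s) mod k)) = (\<Sum>i<k. a i)"
        using sum.reindex_bij_betw[OF bij_betw_add_mod[of m k], of a] by (simp only: add.commute)
      finally show ?thesis using m by (auto simp: U_def)
    next
      case False
      have "h s t = g t" for s
        using step_off[of k t S "\<lambda>i. a ((i + s) mod k)"] False by (auto simp: h_def U_def)
      then have "(\<Sum>s<k. (1 / of_nat k) * h s t) = (\<Sum>s<k. (1 / of_nat k) * g t)" by simp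
      also have "\<dots> = g t" using k by simp
      finally show ?thesis using False by (auto simp: U_def)
    qed
  qed
  then have "N (\<lambda>t. if t \<in> U then (\<Sum>i<k. a i) / of_nat k else g t) \<le> (\<Sum>s<k. N (\<lambda>t. (1 / of_nat k) * h s t))"
    by (simp only:) (rule norm_sum_le[OF finite_lessThan scale[OF hE]])
  also have "\<dots> = (\<Sum>s<k. (1 / real k) * N g)"
    using norm_scale[OF hE, of "1 / of_nat k"] hN by (intro sum.cong refl) (simp add: norm_divide)
  also have "\<dots> = N g" using k by simp
  finally show ?thesis unfolding U_def .
qed

text \<open>
  Greedy choice: as long as some level set still has measure at least \<open>\<delta>\<close>, cut a piece out of it. When this
  stops, less than \<open>n \<delta>\<close> is left; those pieces get the value \<open>a i = 0\<close>.
\<close>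

lemma equal_pieces:
  fixes h :: "'a \<Rightarrow> complex"
  assumes h: "h \<in> borel_measurable M" and V: "finite V" "card V \<le> n" and K: "0 \<le> K" "\<And>t. t \<in> space M \<Longrightarrow> cmod (h t) \<le> K" and \<delta>: "\<delta> > 0"
    and A: "A \<in> sets M" "emeasure M A = ennreal (real k * \<delta>)" "h ` A \<subseteq> V"
  shows "\<exists>S a. (\<forall>i<k. S i \<in> sets M \<and> S i \<subseteq> A \<and> emeasure M (S i) = ennreal \<delta> \<and> (a i = 0 \<or> (\<forall>t\<in>S i. h t = a i))) \<and>
    disjoint_family_on S {..<k} \<and> cmod ((\<integral>t. rho A h t \<partial>M) - complex_of_real \<delta> * (\<Sum>i<k. a i)) \<le> real n * \<delta> * K"
  using A
proof (induction k arbitrary: A)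
  case 0
  then have "A \<in> null_sets M" by auto
  then have "AE t in M. rho A h t = 0" using AE_not_in by (fastforce simp: rho_apply)
  then have "(\<integral>t. rho A h t \<partial>M) = 0" by (rule integral_eq_zero_AE)
  then show ?case using K \<delta> by (auto simp: disjoint_family_on_def)
next
  case (Suc k)
  have [measurable]: "A \<in> sets M" "h \<in> borel_measurable M" using Suc.prems h by auto
  have int: "integrable M (rho S h)" if "S \<in> sets M" "S \<subseteq> A" for S
  proof -
    have "emeasure M S \<le> emeasure M A" using that by (intro emeasure_mono) auto
    then have f: "emeasure M S < \<infinity>" using Suc.prems by (simp add: order_le_less_trans)
    have "integrable M (\<lambda>t. K * indicator S t)" using f that by simp
    then show ?thesis
    proof (rule Bochner_Integration.integrable_bound)
      show "rho S h \<in> borel_measurable M" using that h by (intro measurable_rho)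
      show "AE t in M. norm (rho S h t) \<le> norm (K * indicator S t)"
        using K by (intro AE_I2) (auto simp: rho_apply)
    qed
  qed
  show ?case
  proof (cases "\<exists>y\<in>V. ennreal \<delta> \<le> emeasure M {t \<in> space M. t \<in> A \<and> h t = y}")
    case True
    then obtain y where y: "y \<in> V" "ennreal \<delta> \<le> emeasure M {t \<in> space M. t \<in> A \<and> h t = y}" by blast
    obtain B where B: "B \<in> sets M" "B \<subseteq> {t \<in> space M. t \<in> A \<and> h t = y}" "emeasure M B = ennreal \<delta>"
      using atomless[OF _ _ y(2)] \<delta> by auto
    have BA: "B \<subseteq> A" "\<And>t. t \<in> B \<Longrightarrow> h t = y" using B(2) by auto
    have AB: "A - B \<in> sets M" using B by auto
    have "emeasure M (A - B) = emeasure M A - emeasure M B"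
      using B BA by (intro emeasure_Diff) auto
    also have "\<dots> = ennreal (real (Suc k) * \<delta> - \<delta>)" unfolding Suc.prems(2) B(3) using \<delta> by (intro ennreal_minus) auto
    finally have emAB: "emeasure M (A - B) = ennreal (real k * \<delta>)" by (simp add: algebra_simps)
    have hV: "h ` (A - B) \<subseteq> V" using Suc.prems(3) by auto
    obtain S a where S: "\<forall>i<k. S i \<in> sets M \<and> S i \<subseteq> A - B \<and> emeasure M (S i) = ennreal \<delta> \<and> (a i = 0 \<or> (\<forall>t\<in>S i. h t = a i))"
      "disjoint_family_on S {..<k}" "cmod ((\<integral>t. rho (A - B) h t \<partial>M) - complex_of_real \<delta> * (\<Sum>i<k. a i)) \<le> real n * \<delta> * K"
      using Suc.IH[OF AB emAB hV] by blast
    have "(\<integral>t. rho A h t \<partial>M) = (\<integral>t. rho (A - B) h t + rho B h t \<partial>M)"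
      using BA by (intro Bochner_Integration.integral_cong) (auto simp: rho_apply)
    also have "\<dots> = (\<integral>t. rho (A - B) h t \<partial>M) + (\<integral>t. rho B h t \<partial>M)"
      using int[OF AB] int[OF B(1) BA(1)] by (intro Bochner_Integration.integral_add) auto
    also have "(\<integral>t. rho B h t \<partial>M) = (\<integral>t. y * indicator B t \<partial>M)"
      using BA by (intro Bochner_Integration.integral_cong) (auto simp: rho_apply)
    also have "\<dots> = y * \<delta>"
      using integral_indicator_complex[OF B(1)] B(1,3) \<delta> by (simp add: measure_def)
    finally have I: "(\<integral>t. rho A h t \<partial>M) = (\<integral>t. rho (A - B) h t \<partial>M) + y * \<delta>" .
    show ?thesis
    proof (intro exI conjI)
      show "\<forall>i<Suc k. (S(k := B)) i \<in> sets M \<and> (S(k := B)) i \<subseteq> A \<and> emeasure M ((S(k := B)) i) = ennreal \<delta>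
         \<and> ((a(k := y)) i = 0 \<or> (\<forall>t\<in>(S(k := B)) i. h t = (a(k := y)) i))"
        using S(1) B BA by (auto simp: less_Suc_eq)
      show "disjoint_family_on (S(k := B)) {..<Suc k}"
        by (rule disjoint_family_on_fun_upd[OF S(2)]) (use S(1) in blast)
      have "(\<Sum>i<Suc k. (a(k := y)) i) = (\<Sum>i<k. a i) + y" by simp
      then have "(\<integral>t. rho A h t \<partial>M) - complex_of_real \<delta> * (\<Sum>i<Suc k. (a(k := y)) i) = (\<integral>t. rho (A - B) h t \<partial>M) - complex_of_real \<delta> * (\<Sum>i<k. a i)"
        unfolding I by (simp only:) (simp add: algebra_simps)
      then show "cmod ((\<integral>t. rho A h t \<partial>M) - complex_of_real \<delta> * (\<Sum>i<Suc k. (a(k := y)) i)) \<le> real n * \<delta> * K" using S(3) by (simp only:)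
    qed
  next
    case False
    have "ennreal (real (Suc k) * \<delta>) = emeasure M (\<Union>y\<in>V. {t \<in> space M. t \<in> A \<and> h t = y})"
      unfolding Suc.prems(2)[symmetric] using Suc.prems(3) sets.sets_into_space[OF Suc.prems(1)] by (intro arg_cong[where f = "emeasure M"]) auto
    also have "\<dots> \<le> (\<Sum>y\<in>V. emeasure M {t \<in> space M. t \<in> A \<and> h t = y})"
      by (rule emeasure_subadditive_finite[OF V(1)]) auto
    also have "\<dots> \<le> (\<Sum>y\<in>V. ennreal \<delta>)" using False by (intro sum_mono) (auto simp: not_le intro: less_imp_le)
    also have "\<dots> = ennreal (real (card V) * \<delta>)" using \<delta> by (simp add: ennreal_mult ennreal_of_nat_eq_real_of_nat)
    finally have "real (Suc k) * \<delta> \<le> real (card V) * \<delta>" using \<delta> by (subst (asm) ennreal_le_iff) auto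
    then have "Suc k \<le> card V" using \<delta> by simp
    then have kn: "Suc k \<le> n" using V(2) by simp
    obtain S where S: "\<forall>i<Suc k. S i \<in> sets M \<and> S i \<subseteq> A \<and> emeasure M (S i) = ennreal \<delta>" "disjoint_family_on S {..<Suc k}"
      using split_equal[OF Suc.prems(1), of \<delta> "Suc k"] \<delta> Suc.prems(2) by auto
    have "cmod (\<integral>t. rho A h t \<partial>M) \<le> (\<integral>t. cmod (rho A h t) \<partial>M)" by (rule integral_norm_bound)
    also have "\<dots> \<le> (\<integral>t. K * indicator A t \<partial>M)"
    proof (rule integral_mono)
      show "integrable M (\<lambda>t. cmod (rho A h t))" using int[OF Suc.prems(1)] by simp
      show "integrable M (\<lambda>t. K * indicator A t)" using Suc.prems by simp
      show "cmod (rho A h t) \<le> K * indicator A t" if "t \<in> space M" for t using K that by (auto simp: rho_apply)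
    qed
    also have "\<dots> = K * (real (Suc k) * \<delta>)"
      using Suc.prems(1,2) \<delta> sets.sets_into_space[OF Suc.prems(1)] by (simp add: measure_def Int_absorb1)
    also have "\<dots> \<le> real n * \<delta> * K"
    proof -
      have "real (Suc k) * (\<delta> * K) \<le> real n * (\<delta> * K)" using kn \<delta> K by (intro mult_right_mono) auto
      then show ?thesis by (simp add: algebra_simps)
    qed
    finally have "cmod ((\<integral>t. rho A h t \<partial>M) - complex_of_real \<delta> * (\<Sum>i<Suc k. 0)) \<le> real n * \<delta> * K" by simp
    then show ?thesis using S by (intro exI[of _ S] exI[of _ "\<lambda>i. 0"]) auto
  qed
qed


section \<open>Mean values and their norm estimate in a symmetric space\<close>

definition avg where "avg A f = (\<integral>t. rho A f t \<partial>M) / complex_of_real (measure M A)"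

lemma replace_in:
  assumes "A \<in> sets M" "emeasure M A < \<infinity>" "f \<in> E"
  shows "(\<lambda>t. if t \<in> A then c else f t) \<in> E"
proof -
  have Ac: "space M - A \<in> sets M" using assms by auto
  have [measurable]: "f \<in> borel_measurable M" "A \<in> sets M" using meas assms by auto
  have "(\<lambda>t. c * indicator A t + rho (space M - A) f t) \<in> E"
    by (intro add scale indicator_in rho_in Ac assms)
  then show ?thesis
    by (rule cong_in) (auto simp: rho_apply indicator_def)
qed

text \<open>The function is changed on \<open>A\<close> in four moves: to a step function
  \<open>h\<close> within \<open>e\<close>; to constants on \<open>k\<close> pieces of equal
  measure, which cannot increase the norm; to the mean of these constants, by
  \<open>norm_average_pieces\<close>; and to the true mean, which differs by at most
  \<open>2 e\<close>.\<close>

lemma norm_average_bounded: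
  assumes f: "f \<in> E" and A: "A \<in> sets M" "emeasure M A < \<infinity>" "0 < emeasure M A"
    and K: "0 \<le> K" "\<And>t. t \<in> A \<Longrightarrow> cmod (f t) \<le> K"
  shows "N (\<lambda>t. if t \<in> A then avg A f else f t) \<le> N f"
proof (rule field_le_epsilon)
  fix e0 :: real assume e0: "e0 > 0"
  define m where "m = measure M A"
  have em: "emeasure M A = ennreal m" unfolding m_def using A(2) by (intro emeasure_eq_ennreal_measure) auto
  have m: "m > 0" using A(3) em by simp
  have NA: "N (indicator A) > 0" by (rule norm_indicator_pos[OF A])
  \<comment> \<open>One third pays for replacing \<open>f\<close> by \<open>h\<close>, two thirds
    for the difference between the two means.\<close>
  define e where "e = e0 / (3 * N (indicator A))"
  have e: "e > 0" using e0 NA by (simp add: e_def)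
  have Am[measurable]: "A \<in> sets M" by fact
  have fm[measurable]: "f \<in> borel_measurable M" by (rule meas[OF f])
  have AM: "A \<subseteq> space M" using sets.sets_into_space[OF A(1)] .
  have gb: "cmod (rho A f t) \<le> K" for t using K by (auto simp: rho_apply)
  have g0: "rho A f t = 0" if "t \<notin> A" for t using that by (simp add: rho_apply)
  obtain n \<omega> b where v: "finite_family n \<omega>" "\<And>i. i < n \<Longrightarrow> \<omega> i \<subseteq> A"
    "\<And>t. t \<in> space M \<Longrightarrow> cmod (rho A f t - (\<Sum>i<n. b i * indicator (\<omega> i) t)) \<le> e"
    by (rule bounded_step_approx[OF A(1,2) measurable_rho[OF Am fm] gb g0 e]) (assumption | rule that)+
  define h where "h t = (\<Sum>i<n. b i * indicator (\<omega> i) t)" for t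
  have hE: "h \<in> E" unfolding h_def by (rule family_step_in[OF v(1)])
  have hm[measurable]: "h \<in> borel_measurable M" by (rule meas[OF hE])
  have hd: "cmod (f t - h t) \<le> e" if "t \<in> A" for t
    using v(3)[of t] that AM by (auto simp: h_def rho_apply)
  have hK: "cmod (h t) \<le> K + e" if "t \<in> space M" for t
  proof -
    have "cmod (h t) \<le> cmod (rho A f t) + cmod (rho A f t - h t)"
      using norm_triangle_sub[of "h t" "rho A f t"] by (simp add: Real_Vector_Spaces.norm_minus_commute)
    then show ?thesis using gb[of t] v(3)[OF that] by (simp add: h_def)
  qed
  \<comment> \<open>The value 0 is included because \<open>h\<close> vanishes outside the steps;
    this gives up to \<open>Suc n\<close> levels.\<close>
  define V where "V = insert 0 (b ` {..<n})"
  have V: "finite V" "card V \<le> Suc n"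
    unfolding V_def using card_insert_le_m1[of "Suc n" "b ` {..<n}" 0] card_image_le[of "{..<n}" b] by auto
  have hV: "h ` A \<subseteq> V"
  proof
    fix y assume "y \<in> h ` A"
    then obtain t where t: "t \<in> A" "y = h t" by blast
    show "y \<in> V"
    proof (cases "\<exists>i<n. t \<in> \<omega> i")
      case True
      then obtain i where i: "i < n" "t \<in> \<omega> i" by blast
      then show ?thesis using step_at[OF v(1) i, of b] t by (simp add: h_def V_def)
    next
      case False
      then show ?thesis using step_off[of n t \<omega> b] t by (simp add: h_def V_def)
    qed
  qed
  \<comment> \<open>So many pieces that the at most \<open>Suc n\<close> of them that do not fit
    into a level set change the integral by at most \<open>e * m\<close>.\<close>
  obtain k :: nat where k: "real (Suc n) * (K + e) / e < real k" using reals_Archimedean2 by blast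
  have "0 \<le> real (Suc n) * (K + e) / e" using K e by simp
  then have k0: "k > 0" using k by (metis of_nat_0_less_iff order_le_less_trans)
  define \<delta> where "\<delta> = m / real k"
  have \<delta>: "\<delta> > 0" using m k0 by (simp add: \<delta>_def)
  have emk: "emeasure M A = ennreal (real k * \<delta>)" using em k0 by (simp add: \<delta>_def)
  have Ke: "0 \<le> K + e" using K e by simp
  obtain S and a :: "nat \<Rightarrow> complex" where S: "\<forall>i<k. S i \<in> sets M \<and> S i \<subseteq> A \<and> emeasure M (S i) = ennreal \<delta> \<and> (a i = 0 \<or> (\<forall>t\<in>S i. h t = a i))"
    "disjoint_family_on S {..<k}" "cmod ((\<integral>t. rho A h t \<partial>M) - complex_of_real \<delta> * (\<Sum>i<k. a i)) \<le> real (Suc n) * \<delta> * (K + e)"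
    using equal_pieces[OF hm V Ke hK \<delta> A(1) emk hV] by blast
  have fam: "finite_family k S" using S(1,2) by (simp add: finite_family_def)
  define U where "U = (\<Union>i<k. S i)"
  have UA: "U \<subseteq> A" unfolding U_def using S(1) by auto
  have U[measurable]: "U \<in> sets M" unfolding U_def using S(1) by auto
  have emU: "emeasure M U = emeasure M A" unfolding U_def emk
    by (rule union_equal[OF fam]) (use S(1) \<delta> in auto)
  have null: "AE t in M. t \<in> A \<longrightarrow> t \<in> U"
  proof -
    have "emeasure M (A - U) = emeasure M A - emeasure M U"
      using A UA emU by (intro emeasure_Diff) auto
    then have "A - U \<in> null_sets M" using emU A by (intro null_setsI) (auto simp: em)
    from AE_not_in[OF this] show ?thesis by eventually_elim auto
  qed
  let ?F1 = "\<lambda>t. h t + rho (space M - A) f t"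
  have Ac: "space M - A \<in> sets M" using A by auto
  have F1E: "?F1 \<in> E" by (intro add hE rho_in Ac f)
  have h0: "h t = 0" if "t \<notin> A" for t
    unfolding h_def using v(2) that by (intro step_off) auto
  have d1: "N (\<lambda>t. ?F1 t - f t) \<le> e * N (indicator A)"
    by (rule bounded_support(2)[OF A(1,2) meas[OF diff_in[OF F1E f]]])
      (use e hd h0 in \<open>auto simp: rho_apply Real_Vector_Spaces.norm_minus_commute\<close>)
  let ?s = "\<lambda>t. \<Sum>i<k. a i * indicator (S i) t"
  have sE: "?s \<in> E" by (rule family_step_in[OF fam])
  let ?F2 = "\<lambda>t. ?s t + rho (space M - A) f t"
  have F2E: "?F2 \<in> E" by (intro add sE rho_in Ac f)
  have s_off: "?s t = 0" if "t \<notin> U" for t using that by (intro step_off) (auto simp: U_def)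
  \<comment> \<open>On each piece the new value is either that of \<open>h\<close> or 0, so the
    modulus only decreases.\<close>
  have N2: "N ?F2 \<le> N ?F1"
  proof (rule norm_mono_in[OF F1E F2E], rule AE_I2)
    fix t assume t: "t \<in> space M"
    show "cmod (?F2 t) \<le> cmod (?F1 t)"
    proof (cases "t \<in> U")
      case True
      then obtain i where i: "i < k" "t \<in> S i" by (auto simp: U_def)
      then have "a i = 0 \<or> h t = a i" using S(1) by auto
      then show ?thesis using step_at[OF fam i, of a] True UA by (auto simp: rho_apply)
    next
      case False
      then show ?thesis using s_off[OF False] h0 by (cases "t \<in> A") (auto simp: rho_apply)
    qed
  qed
  let ?F3 = "\<lambda>t. if t \<in> U then (\<Sum>i<k. a i) / of_nat k else ?F2 t"
  have F3E: "?F3 \<in> E"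
    using emU A by (intro replace_in F2E U) auto
  have N3: "N ?F3 \<le> N ?F2"
    unfolding U_def
  proof (rule norm_average_pieces[OF fam k0 _ F2E])
    show "emeasure M (S i) = ennreal \<delta>" if "i < k" for i using S(1) that by auto
    show "?F2 t = a i" if "i < k" "t \<in> S i" for i t
      using step_at[OF fam that, of a] S(1) that by (auto simp: rho_apply)
  qed
  let ?F4 = "\<lambda>t. if t \<in> A then avg A f else f t"
  have F4E: "?F4 \<in> E" by (rule replace_in[OF A(1,2) f])
  have intA: "integrable M (\<lambda>t. c * indicator A t)" for c :: real using A by simp
  have intf: "integrable M (rho A f)"
  proof (rule Bochner_Integration.integrable_bound[OF intA[of K] measurable_rho[OF Am fm]])
    show "AE t in M. norm (rho A f t) \<le> norm (K * indicator A t)"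
      using K by (intro AE_I2) (auto simp: rho_apply)
  qed
  have inth: "integrable M (rho A h)"
  proof (rule Bochner_Integration.integrable_bound[OF intA[of "K + e"] measurable_rho[OF Am hm]])
    show "AE t in M. norm (rho A h t) \<le> norm ((K + e) * indicator A t)"
      using hK Ke by (intro AE_I2) (auto simp: rho_apply)
  qed
  have "cmod ((\<integral>t. rho A f t \<partial>M) - (\<integral>t. rho A h t \<partial>M)) = cmod (\<integral>t. rho A f t - rho A h t \<partial>M)"
    using intf inth by simp
  also have "\<dots> \<le> (\<integral>t. cmod (rho A f t - rho A h t) \<partial>M)" by (rule integral_norm_bound)
  also have "\<dots> \<le> (\<integral>t. e * indicator A t \<partial>M)"
  proof (rule integral_mono)
    show "integrable M (\<lambda>t. cmod (rho A f t - rho A h t))" using intf inth by simp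
    show "cmod (rho A f t - rho A h t) \<le> e * indicator A t" for t using hd by (simp add: rho_apply)
  qed (rule intA)
  also have "\<dots> = e * m" using AM by (simp add: m_def Int_absorb2)
  finally have I1: "cmod ((\<integral>t. rho A f t \<partial>M) - (\<integral>t. rho A h t \<partial>M)) \<le> e * m" .
  have "real (Suc n) * (K + e) \<le> e * real k" using k e by (simp add: field_simps)
  then have "(real (Suc n) * (K + e)) * \<delta> \<le> (e * real k) * \<delta>" using \<delta> by (intro mult_right_mono) auto
  then have I2: "real (Suc n) * \<delta> * (K + e) \<le> e * m" using k0 by (simp add: \<delta>_def field_simps)
  have "cmod ((\<integral>t. rho A f t \<partial>M) - complex_of_real \<delta> * (\<Sum>i<k. a i)) \<le> 2 * e * m"
  proof -
    have "cmod ((\<integral>t. rho A f t \<partial>M) - complex_of_real \<delta> * (\<Sum>i<k. a i))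
      \<le> cmod ((\<integral>t. rho A f t \<partial>M) - (\<integral>t. rho A h t \<partial>M)) + cmod ((\<integral>t. rho A h t \<partial>M) - complex_of_real \<delta> * (\<Sum>i<k. a i))"
      by (rule order_trans[OF _ norm_triangle_ineq]) simp
    then show ?thesis using I1 I2 S(3) by linarith
  qed
  moreover have avq: "avg A f - (\<Sum>i<k. a i) / of_nat k = ((\<integral>t. rho A f t \<partial>M) - complex_of_real \<delta> * (\<Sum>i<k. a i)) / complex_of_real m"
    using m k0 by (simp add: avg_def m_def[symmetric] \<delta>_def field_simps)
  ultimately have avd: "cmod (avg A f - (\<Sum>i<k. a i) / of_nat k) \<le> 2 * e"
    unfolding avq norm_divide norm_of_real using m by (simp add: field_simps)
  have d3: "N (\<lambda>t. ?F4 t - ?F3 t) \<le> (2 * e) * N (indicator A)"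
  proof (rule bounded_dominated(2)[OF indicator_in[OF A(1,2)] meas[OF diff_in[OF F4E F3E]]])
    show "0 \<le> 2 * e" using e by simp
    show "AE t in M. cmod (?F4 t - ?F3 t) \<le> 2 * e * cmod (indicator A t :: complex)"
      using null AE_space
    proof eventually_elim
      case (elim t)
      show ?case
      proof (cases "t \<in> A")
        case True
        then show ?thesis using elim avd by simp
      next
        case False
        then have "t \<notin> U" using UA by auto
        then show ?thesis using False s_off elim by (simp add: rho_apply)
      qed
    qed
  qed
  have "N ?F4 \<le> N ?F3 + N (\<lambda>t. ?F4 t - ?F3 t)" by (rule norm_le_add_diff[OF F4E F3E])
  also have "\<dots> \<le> N ?F1 + (2 * e) * N (indicator A)" using N2 N3 d3 by linarith
  also have "N ?F1 \<le> N f + e * N (indicator A)" using norm_le_add_diff[OF F1E f] d1 by linarith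
  finally have "N ?F4 \<le> N f + 3 * e * N (indicator A)" by simp
  also have "3 * e * N (indicator A) = e0" using NA by (simp add: e_def)
  finally show "N ?F4 \<le> N f + e0" .
qed

text \<open>The average of a bounded truncation \<open>r j\<close> of \<open>\<bar>f\<bar>\<close>
  on \<open>A\<close> is a multiple of the indicator of \<open>A\<close> with norm at most
  \<open>N f\<close>, which bounds the integrals of all truncations; monotone convergence does the
  rest.\<close>

lemma integrable_on_finite:
  assumes f: "f \<in> E" and A: "A \<in> sets M" "emeasure M A < \<infinity>"
  shows "integrable M (rho A f)"
proof (cases "emeasure M A = 0")
  case True
  then have "AE t in M. t \<notin> A" using A by (intro AE_not_in) auto
  then have "AE t in M. rho A f t = 0" by eventually_elim (simp add: rho_apply)
  then show ?thesis using measurable_rho[OF A(1) meas[OF f]]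
    by (subst integrable_cong_AE[where g = "\<lambda>t. 0"]) auto
next
  case False
  then have pos: "0 < emeasure M A" by (simp add: zero_less_iff_neq_zero)
  have fm[measurable]: "f \<in> borel_measurable M" "A \<in> sets M" using meas[OF f] A by auto
  have AM: "A \<subseteq> space M" using sets.sets_into_space[OF A(1)] .
  define m where "m = measure M A"
  have em: "emeasure M A = ennreal m" unfolding m_def using A(2) by (intro emeasure_eq_ennreal_measure) auto
  have m: "m > 0" using pos em by simp
  have NA: "N (indicator A) > 0" by (rule norm_indicator_pos[OF A pos])
  define r where "r j t = (if t \<in> A \<and> cmod (f t) \<le> real j then cmod (f t) else 0)" for j :: nat and t
  have rm[measurable]: "r j \<in> borel_measurable M" for j unfolding r_def by measurable
  have r0: "r j t = 0" if "t \<notin> A" for j t using that by (simp add: r_def)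
  have rint: "integrable M (r j)" for j
  proof (rule Bochner_Integration.integrable_bound[of M "\<lambda>t. real j * indicator A t"])
    show "integrable M (\<lambda>t. real j * indicator A t)" using A by simp
    show "AE t in M. norm (r j t) \<le> norm (real j * indicator A t)" by (intro AE_I2) (auto simp: r_def)
  qed auto
  have rle: "(\<integral>t. r j t \<partial>M) \<le> N f * m / N (indicator A)" for j
  proof -
    let ?u = "\<lambda>t. complex_of_real (r j t)"
    have um: "?u \<in> borel_measurable M" by measurable
    have ule: "cmod (?u t) \<le> cmod (f t)" for t by (auto simp: r_def)
    have uE: "?u \<in> E" by (rule dominated_in[OF f um]) (use ule in auto)
    have uN: "N ?u \<le> N f" by (rule norm_mono[OF f um]) (use ule in auto)
    have "rho A ?u = ?u" by (auto simp: rho_apply r_def fun_eq_iff)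
    then have av: "avg A ?u = complex_of_real ((\<integral>t. r j t \<partial>M) / m)"
      unfolding avg_def by (simp add: m_def)
    have nn: "0 \<le> (\<integral>t. r j t \<partial>M)" by (intro Bochner_Integration.integral_nonneg) (auto simp: r_def)
    have "N (\<lambda>t. if t \<in> A then avg A ?u else ?u t) = N (\<lambda>t. complex_of_real ((\<integral>t. r j t \<partial>M) / m) * indicator A t)"
      unfolding av by (rule arg_cong[where f = N]) (auto simp: fun_eq_iff r0)
    also have "\<dots> = ((\<integral>t. r j t \<partial>M) / m) * N (indicator A)"
      using norm_scale[OF indicator_in[OF A], of "complex_of_real ((\<integral>t. r j t \<partial>M) / m)"] nn m
      by (simp only: norm_of_real) simp
    moreover have "N (\<lambda>t. if t \<in> A then avg A ?u else ?u t) \<le> N ?u"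
      by (rule norm_average_bounded[OF uE A pos, of "real j"]) (auto simp: r_def)
    ultimately have "((\<integral>t. r j t \<partial>M) / m) * N (indicator A) \<le> N f" using uN by linarith
    then show ?thesis using m NA by (simp add: field_simps)
  qed
  have rmono: "r i t \<le> r j t" if "i \<le> j" for i j t using that by (auto simp: r_def)
  have rnn: "0 \<le> (\<integral>t. r j t \<partial>M)" for j by (intro Bochner_Integration.integral_nonneg) (auto simp: r_def)
  have "convergent (\<lambda>j. \<integral>t. r j t \<partial>M)"
  proof (rule Bseq_mono_convergent)
    show "Bseq (\<lambda>j. \<integral>t. r j t \<partial>M)"
      by (rule BseqI'[of _ "N f * m / N (indicator A)"]) (use rle rnn in simp)
    show "\<forall>i j. i \<le> j \<longrightarrow> (\<integral>t. r i t \<partial>M) \<le> (\<integral>t. r j t \<partial>M)"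
      by (intro allI impI integral_mono rint rmono)
  qed
  then obtain l where l: "(\<lambda>j. \<integral>t. r j t \<partial>M) \<longlonglongrightarrow> l" by (auto simp: convergent_def)
  have "integrable M (\<lambda>t. cmod (rho A f t))"
  proof (rule integrable_monotone_convergence[OF rint _ _ l])
    show "AE t in M. mono (\<lambda>j. r j t)" using rmono by (intro AE_I2 monoI) auto
    show "AE t in M. (\<lambda>j. r j t) \<longlonglongrightarrow> cmod (rho A f t)"
    proof (intro AE_I2 tendsto_eventually)
      fix t
      obtain j0 :: nat where j0: "cmod (f t) \<le> real j0" using real_arch_simple by blast
      show "\<forall>\<^sub>F j in sequentially. r j t = cmod (rho A f t)"
        using eventually_ge_at_top[of j0]
      proof eventually_elim
        case (elim j)
        then have "cmod (f t) \<le> real j" using j0 by (meson of_nat_le_iff order_trans)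
        then show ?case by (simp add: r_def rho_apply)
      qed
    qed
    show "(\<lambda>t. cmod (rho A f t)) \<in> borel_measurable M" using measurable_rho[OF A(1) meas[OF f]] by measurable
  qed
  then show ?thesis using integrable_norm_iff[OF measurable_rho[OF A(1) meas[OF f]]] by simp
qed

text \<open>Large values of \<open>f\<close> on \<open>A\<close> are replaced by 0. The bounded case
  applies to these functions, and their means converge to that of \<open>f\<close> by dominated
  convergence, so only the convergence of scalars is used.\<close>

lemma norm_average:
  assumes f: "f \<in> E" and A: "A \<in> sets M" "emeasure M A < \<infinity>" "0 < emeasure M A"
  shows "N (\<lambda>t. if t \<in> A then avg A f else f t) \<le> N f"
proof -
  have fm[measurable]: "f \<in> borel_measurable M" "A \<in> sets M" using meas[OF f] A by auto
  let ?F = "\<lambda>t. if t \<in> A then avg A f else f t"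
  have FE: "?F \<in> E" by (rule replace_in[OF A(1,2) f])
  define g where "g j t = (if t \<in> A \<and> cmod (f t) > real j then 0 else f t)" for j :: nat and t
  have gm[measurable]: "g j \<in> borel_measurable M" for j unfolding g_def by measurable
  have gle: "cmod (g j t) \<le> cmod (f t)" for j t by (auto simp: g_def)
  have gE: "g j \<in> E" for j by (rule dominated_in[OF f gm]) (use gle in auto)
  have gN: "N (g j) \<le> N f" for j by (rule norm_mono[OF f gm]) (use gle in auto)
  have le: "N ?F \<le> N f + cmod (avg A f - avg A (g j)) * N (indicator A)" for j
  proof -
    let ?G = "\<lambda>t. if t \<in> A then avg A (g j) else g j t"
    have GE: "?G \<in> E" by (rule replace_in[OF A(1,2) gE])
    have "N ?G \<le> N (g j)" by (rule norm_average_bounded[OF gE A, of "real j"]) (auto simp: g_def)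
    moreover have "N ?F \<le> N ?G + N (\<lambda>t. ?F t - ?G t)" by (rule norm_le_add_diff[OF FE GE])
    moreover have "N (\<lambda>t. ?F t - ?G t) \<le> cmod (avg A f - avg A (g j)) * N (indicator A)"
      by (rule bounded_support(2)[OF A(1,2) meas[OF diff_in[OF FE GE]]]) (auto simp: g_def)
    ultimately show ?thesis using gN[of j] by linarith
  qed
  have "(\<lambda>j. \<integral>t. rho A (g j) t \<partial>M) \<longlonglongrightarrow> (\<integral>t. rho A f t \<partial>M)"
  proof (rule integral_dominated_convergence[where w = "\<lambda>t. cmod (rho A f t)"])
    show "rho A f \<in> borel_measurable M" "\<And>j. rho A (g j) \<in> borel_measurable M"
      using measurable_rho[OF A(1)] fm gm by auto
    show "integrable M (\<lambda>t. cmod (rho A f t))" using integrable_on_finite[OF f A(1,2)] by simp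
    show "AE t in M. (\<lambda>j. rho A (g j) t) \<longlonglongrightarrow> rho A f t"
    proof (intro AE_I2 tendsto_eventually)
      fix t
      obtain j0 :: nat where j0: "cmod (f t) \<le> real j0" using real_arch_simple by blast
      show "\<forall>\<^sub>F j in sequentially. rho A (g j) t = rho A f t"
        using eventually_ge_at_top[of j0]
      proof eventually_elim
        case (elim j)
        then have "cmod (f t) \<le> real j" using j0 by (meson of_nat_le_iff order_trans)
        then show ?case by (simp add: g_def rho_apply)
      qed
    qed
    show "AE t in M. norm (rho A (g j) t) \<le> cmod (rho A f t)" for j
      using gle by (auto simp: rho_apply)
  qed
  then have "(\<lambda>j. avg A (g j)) \<longlonglongrightarrow> avg A f"
    unfolding avg_def using A by (intro tendsto_divide tendsto_const) (auto simp: measure_def enn2real_eq_0_iff)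
  then have "(\<lambda>j. N f + cmod (avg A f - avg A (g j)) * N (indicator A)) \<longlonglongrightarrow> N f + cmod (avg A f - avg A f) * N (indicator A)"
    by (intro tendsto_intros)
  then have "N ?F \<le> N f + cmod (avg A f - avg A f) * N (indicator A)"
    by (rule tendsto_lowerbound) (use le in auto)
  then show ?thesis by simp
qed

text \<open>The functionals are the mean values over the pieces; integrability on sets of finite
  measure makes them linear on all of \<open>E\<close>.\<close>

lemma has_averaging_symmetric: "has_averaging"
  unfolding has_averaging_def
proof (intro allI impI)
  fix n \<omega> assume fam: "finite_family n \<omega>"
  have w: "\<And>i. i < n \<Longrightarrow> \<omega> i \<in> sets M" "\<And>i. i < n \<Longrightarrow> emeasure M (\<omega> i) < \<infinity>"
    using fam by (auto simp: finite_family_def)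
  define \<phi> where "\<phi> i f = avg (\<omega> i) f" for i f
  have int: "integrable M (rho (\<omega> i) f)" if "i < n" "f \<in> E" for i f
    using integrable_on_finite[OF that(2) w[OF that(1)]] .
  have "averaging n \<omega> \<phi>"
    unfolding averaging_def
  proof (intro conjI allI impI ballI)
    fix i assume i: "i < n"
    { fix f g assume fg: "f \<in> E" "g \<in> E" "AE t in M. f t = g t"
      have "(\<integral>t. rho (\<omega> i) f t \<partial>M) = (\<integral>t. rho (\<omega> i) g t \<partial>M)"
        by (rule integral_cong_AE) (use fg w[OF i] meas in \<open>auto simp: rho_apply\<close>)
      then show "\<phi> i f = \<phi> i g" by (simp add: \<phi>_def avg_def) }
    { fix f g assume fg: "f \<in> E" "g \<in> E"
      have "(\<integral>t. rho (\<omega> i) (\<lambda>t. f t + g t) t \<partial>M) = (\<integral>t. rho (\<omega> i) f t + rho (\<omega> i) g t \<partial>M)"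
        by (intro Bochner_Integration.integral_cong) (auto simp: rho_apply)
      also have "\<dots> = (\<integral>t. rho (\<omega> i) f t \<partial>M) + (\<integral>t. rho (\<omega> i) g t \<partial>M)"
        by (rule Bochner_Integration.integral_add[OF int[OF i fg(1)] int[OF i fg(2)]])
      finally show "\<phi> i (\<lambda>t. f t + g t) = \<phi> i f + \<phi> i g" by (simp add: \<phi>_def avg_def add_divide_distrib) }
    { fix c f assume f: "f \<in> E"
      have "(\<integral>t. rho (\<omega> i) (\<lambda>t. c * f t) t \<partial>M) = (\<integral>t. c * rho (\<omega> i) f t \<partial>M)"
        by (intro Bochner_Integration.integral_cong) (auto simp: rho_apply)
      then show "\<phi> i (\<lambda>t. c * f t) = c * \<phi> i f" by (simp add: \<phi>_def avg_def) }
    { fix f show "\<phi> i (rho (\<omega> i) f) = \<phi> i f" by (simp add: \<phi>_def avg_def rho_rho) }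
    { assume "emeasure M (\<omega> i) > 0"
      then have "measure M (\<omega> i) \<noteq> 0" using w[OF i] by (auto simp: measure_def enn2real_eq_0_iff)
      then show "\<phi> i (indicator (\<omega> i)) = 1"
        by (simp add: \<phi>_def avg_def rho_indicator integral_indicator_complex[OF w(1)[OF i]]) }
  next
    fix f assume f: "f \<in> E"
    \<comment> \<open>\<open>F m\<close> has been averaged on the first \<open>m\<close> pieces
      only, so that each step is an instance of averaging on one set. Dropping what lies off all
      pieces at the end decreases the modulus.\<close>
    define F where "F m t = (if \<exists>i<m. t \<in> \<omega> i then (\<Sum>i<n. \<phi> i f * indicator (\<omega> i) t) else f t)" for m t
    have "F m \<in> E \<and> N (F m) \<le> N f" if "m \<le> n" for m
      using that
    proof (induction m)
      case 0
      then show ?case using f by (simp add: F_def[abs_def])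
    next
      case (Suc m)
      have m: "m < n" using Suc.prems by simp
      have IH: "F m \<in> E" "N (F m) \<le> N f" using Suc by auto
      have on: "F m t = f t" if "t \<in> \<omega> m" for t
      proof -
        have "t \<notin> \<omega> i" if "i < m" for i
        proof -
          have "\<omega> i \<inter> \<omega> m = {}"
            using fam that m unfolding finite_family_def disjoint_family_on_def by simp
          then show ?thesis using \<open>t \<in> \<omega> m\<close> by blast
        qed
        then show ?thesis by (auto simp: F_def)
      qed
      then have "rho (\<omega> m) (F m) = rho (\<omega> m) f" by (auto simp: rho_apply fun_eq_iff)
      then have av: "avg (\<omega> m) (F m) = \<phi> m f" by (simp add: avg_def \<phi>_def)
      have eq: "F (Suc m) = (\<lambda>t. if t \<in> \<omega> m then avg (\<omega> m) (F m) else F m t)"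
      proof
        fix t
        show "F (Suc m) t = (if t \<in> \<omega> m then avg (\<omega> m) (F m) else F m t)"
        proof (cases "t \<in> \<omega> m")
          case True
          then show ?thesis using step_at[OF fam m True, of "\<lambda>i. \<phi> i f"] unfolding av by (auto simp: F_def)
        next
          case False
          then show ?thesis by (auto simp: F_def less_Suc_eq)
        qed
      qed
      have in1: "F (Suc m) \<in> E" unfolding eq by (rule replace_in[OF w(1)[OF m] w(2)[OF m] IH(1)])
      moreover have "N (F (Suc m)) \<le> N (F m)"
      proof (cases "emeasure M (\<omega> m) = 0")
        case True
        then have "AE t in M. t \<notin> \<omega> m" using w[OF m] by (intro AE_not_in) auto
        then have "AE t in M. F (Suc m) t = F m t" unfolding eq by eventually_elim simp
        then show ?thesis using norm_cong[OF in1 IH(1)] by simp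
      next
        case False
        then show ?thesis unfolding eq
          by (intro norm_average[OF IH(1) w(1)[OF m] w(2)[OF m]]) (simp add: zero_less_iff_neq_zero)
      qed
      ultimately show ?case using IH by auto
    qed
    then have Fn: "F n \<in> E" "N (F n) \<le> N f" by auto
    have "N (\<lambda>t. \<Sum>i<n. \<phi> i f * indicator (\<omega> i) t) \<le> N (F n)"
    proof (rule norm_mono_in[OF Fn(1) family_step_in[OF fam]], rule AE_I2)
      fix t
      show "cmod (\<Sum>i<n. \<phi> i f * indicator (\<omega> i) t) \<le> cmod (F n t)"
      proof (cases "\<exists>i<n. t \<in> \<omega> i")
        case True
        then show ?thesis by (simp add: F_def)
      next
        case False
        then show ?thesis using step_off[of n t \<omega> "\<lambda>i. \<phi> i f"] by simp
      qed
    qed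
    then show "N (\<lambda>t. \<Sum>i<n. \<phi> i f * indicator (\<omega> i) t) \<le> N f" using Fn by simp
  qed
  then show "\<exists>\<phi>. averaging n \<omega> \<phi>" by blast
qed

end

text \<open>This moves the one pair of coordinates known to be coupled to any other pair.\<close>

lemma transpose_pair_permutation:
  fixes i j k l n :: nat
  assumes "i < n" "j < n" "i \<noteq> j" "k < n" "l < n" "k \<noteq> l"
  obtains p where "bij_betw p {..<n} {..<n}" "p i = k" "p j = l"
proof -
  have b: "bij_betw (Transposition.transpose a b) {..<n} {..<n}" if "a < n" "b < n" for a b :: nat
    by (rule permutes_imp_bij, rule permutes_swap_id) (use that in auto)
  \<comment> \<open>The place of \<open>j\<close> after the first transposition. It differs from
    \<open>k\<close>, so the second transposition can send it to \<open>l\<close> and leave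
    \<open>k\<close> fixed.\<close>
  define y where "y = Transposition.transpose i k j"
  have y: "y < n" "y \<noteq> k"
    using assms bij_betwE[OF b[OF assms(1,4)]] by (auto simp: y_def transpose_eq_iff)
  show ?thesis
  proof (rule that)
    show "bij_betw (Transposition.transpose y l \<circ> Transposition.transpose i k) {..<n} {..<n}"
      by (rule bij_betw_trans[OF b[OF assms(1,4)] b[OF y(1) assms(5)]])
    show "(Transposition.transpose y l \<circ> Transposition.transpose i k) i = k"
      using y assms by (simp add: transpose_apply_other)
    show "(Transposition.transpose y l \<circ> Transposition.transpose i k) j = l"
      by (simp add: y_def)
  qed
qed

section \<open>Pythagoras on pieces of equal measure and proportionality to L_2\<close>

context ideal_function_space
begin

definition square_additive where
  "square_additive \<delta> \<longleftrightarrow> (\<forall>k C c. finite_family k C \<and> (\<forall>i<k. emeasure M (C i) = ennreal \<delta>) \<longrightarrow>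
     (N (\<lambda>t. \<Sum>i<k. c i * indicator (C i) t))\<^sup>2 = (\<Sum>i<k. (cmod (c i))\<^sup>2 * (N (indicator (C i)))\<^sup>2))"

end

context atomless_symmetric_space
begin

text \<open>
  \<open>A\<close> is cut into pieces of measure \<open>\<delta> = a / m\<close>; one of them is still coupled to a piece of \<open>B\<close>, for the given
  averaging \<open>\<phi>\<close>. By symmetry the resulting rotation invariance holds for every pair of coefficients.
\<close>

lemma square_additive_if_coupled:
  assumes T: "hermitian T C0"
    and A: "A \<in> sets M" "emeasure M A = ennreal a" "a > 0" and B: "B \<in> sets M" and AB: "A \<inter> B = {}" and c: "c \<noteq> 0"
    and near: "\<And>t. t \<in> B \<Longrightarrow> cmod (T (indicator A) t - c) \<le> cmod c / 2"
    and m: "m > 0" "ennreal (a / real m) \<le> emeasure M B"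
  shows "square_additive (a / real m)"
  unfolding square_additive_def
proof (intro allI impI, elim conjE)
  fix K C d assume C: "finite_family K C" "\<forall>i<K. emeasure M (C i) = ennreal (a / real m)"
  define \<delta> where "\<delta> = a / real m"
  have \<delta>: "\<delta> > 0" using A m by (simp add: \<delta>_def)
  have lin: "linear_map M E M E T" using T by (simp add: hermitian_def)
  have Afin: "emeasure M A < \<infinity>" using A by simp
  have AE: "indicator A \<in> E" using A(1) Afin by (rule indicator_in)
  obtain B1 where B1: "B1 \<in> sets M" "B1 \<subseteq> B" "emeasure M B1 = ennreal \<delta>"
    using atomless[OF B _ m(2)] \<delta> by (auto simp: \<delta>_def)
  have emA: "emeasure M A = ennreal (real m * \<delta>)" using A(2) m by (simp add: \<delta>_def)
  obtain S where fS: "finite_family m S" and S0: "\<And>i. i < m \<Longrightarrow> S i \<subseteq> A" "\<And>i. i < m \<Longrightarrow> emeasure M (S i) = ennreal \<delta>"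
    and ae: "AE t in M. indicator A t = (\<Sum>i<m. 1 * indicator (S i) t :: complex)"
    by (rule equal_partition[OF A(1) emA less_imp_le[OF \<delta>]]) (rule that)
  have S: "\<forall>i<m. S i \<in> sets M \<and> S i \<subseteq> A \<and> emeasure M (S i) = ennreal \<delta>" "disjoint_family_on S {..<m}"
    using fS S0 by (auto simp: finite_family_def)
  \<comment> \<open>The frame must contain the \<open>m\<close> pieces of \<open>A\<close> and the
    piece \<open>B1\<close>, and offer at least as many coordinates as the given family
    \<open>C\<close>.\<close>
  define L where "L = max K (Suc m)"
  define R where "R = space M - (A \<union> B1)"
  have Rm: "R \<in> sets M" unfolding R_def using A B1 by auto
  have emAB: "emeasure M (A \<union> B1) = ennreal (real (Suc m) * \<delta>)"
  proof -
    have "emeasure M (A \<union> B1) = emeasure M A + emeasure M B1"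
      by (rule plus_emeasure[symmetric]) (use A B1 AB in auto)
    also have "\<dots> = ennreal (a + \<delta>)" using A B1 \<delta> by (simp add: ennreal_plus)
    also have "a + \<delta> = real (Suc m) * \<delta>" using m by (simp add: \<delta>_def field_simps)
    finally show ?thesis .
  qed
  \<comment> \<open>There is room for the frame: either the pieces of \<open>A\<close> and
    \<open>B1\<close> already suffice, or the given disjoint sets \<open>C i\<close> witness that
    the space is large enough.\<close>
  have "ennreal (real L * \<delta>) \<le> emeasure M (space M)"
  proof (cases "K \<le> Suc m")
    case True
    then have "ennreal (real L * \<delta>) = emeasure M (A \<union> B1)" unfolding emAB L_def by (simp add: max_def)
    also have "\<dots> \<le> emeasure M (space M)" by (rule emeasure_space)
    finally show ?thesis .
  next
    case False
    then have "ennreal (real L * \<delta>) = emeasure M (\<Union>i<K. C i)"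
      using union_equal[OF C(1), of \<delta>] C(2) \<delta> by (simp add: L_def max_def \<delta>_def)
    also have "\<dots> \<le> emeasure M (space M)" by (rule emeasure_space)
    finally show ?thesis .
  qed
  also have "emeasure M (space M) = emeasure M (A \<union> B1) + emeasure M R"
  proof -
    have sub: "A \<union> B1 \<subseteq> space M" using A B1 sets.sets_into_space by blast
    have "emeasure M (A \<union> B1) + emeasure M R = emeasure M ((A \<union> B1) \<union> R)"
      by (rule plus_emeasure) (use A B1 Rm in \<open>auto simp: R_def\<close>)
    also have "(A \<union> B1) \<union> R = space M" using sub by (auto simp: R_def)
    finally show ?thesis by simp
  qed
  finally have le: "ennreal (real L * \<delta>) \<le> ennreal (real (Suc m) * \<delta>) + emeasure M R" unfolding emAB .
  have "real L = real (Suc m) + real (L - Suc m)" by (simp add: L_def of_nat_diff)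
  then have "real L * \<delta> = real (Suc m) * \<delta> + real (L - Suc m) * \<delta>" by (metis distrib_right)
  moreover have "0 \<le> real (Suc m) * \<delta>" "0 \<le> real (L - Suc m) * \<delta>" using \<delta> by auto
  ultimately have "ennreal (real L * \<delta>) = ennreal (real (Suc m) * \<delta>) + ennreal (real (L - Suc m) * \<delta>)"
    by (simp only: ennreal_plus)
  with le have "ennreal (real (Suc m) * \<delta>) + ennreal (real (L - Suc m) * \<delta>) \<le> ennreal (real (Suc m) * \<delta>) + emeasure M R"
    by simp
  then have "ennreal (real (L - Suc m) * \<delta>) \<le> emeasure M R"
    by (subst (asm) ennreal_add_left_cancel_le) auto
  then obtain Q where Q: "\<forall>i<L - Suc m. Q i \<in> sets M \<and> Q i \<subseteq> R \<and> emeasure M (Q i) = ennreal \<delta>" "disjoint_family_on Q {..<L - Suc m}"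
    using split_equal[OF Rm, of \<delta> "L - Suc m"] \<delta> by auto
  define \<omega> where "\<omega> i = (if i < m then S i else if i = m then B1 else Q (i - Suc m))" for i
  have \<omega>1: "\<omega> i \<in> sets M \<and> emeasure M (\<omega> i) = ennreal \<delta>" if "i < L" for i
    using S(1) B1 Q(1) that by (auto simp: \<omega>_def)
  have \<omega>d: "\<omega> i \<inter> \<omega> j = {}" if "i < j" "j < L" for i j
  proof -
    consider "j < m" | "j = m" | "i < m" "m < j" | "i = m" "m < j" | "m < i" "m < j" using that by linarith
    then show ?thesis
    proof cases
      case 1
      then show ?thesis using S(2) that by (simp add: \<omega>_def disjoint_family_on_def)
    next
      case 2
      then have "\<omega> i \<subseteq> A" "\<omega> j \<subseteq> B" using S(1) B1 that by (auto simp: \<omega>_def)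
      then show ?thesis using AB by blast
    next
      case 3
      then have "\<omega> i \<subseteq> A" "\<omega> j \<subseteq> R" using S(1) Q(1) that by (auto simp: \<omega>_def)
      then show ?thesis by (auto simp: R_def)
    next
      case 4
      then have "\<omega> i \<subseteq> B1" "\<omega> j \<subseteq> R" using Q(1) that by (auto simp: \<omega>_def)
      then show ?thesis by (auto simp: R_def)
    next
      case 5
      then have "\<omega> i = Q (i - Suc m)" "\<omega> j = Q (j - Suc m)" "i - Suc m < L - Suc m" "j - Suc m < L - Suc m" "i - Suc m \<noteq> j - Suc m"
        using that by (auto simp: \<omega>_def)
      then show ?thesis using Q(2) by (simp add: disjoint_family_on_def)
    qed
  qed
  have fam: "finite_family L \<omega>"
    unfolding finite_family_def
  proof (intro conjI allI impI)
    show "\<omega> i \<in> sets M" "emeasure M (\<omega> i) < \<infinity>" if "i < L" for i using \<omega>1[OF that] by auto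
    show "disjoint_family_on \<omega> {..<L}" unfolding disjoint_family_on_def
    proof (intro ballI impI)
      fix i j assume "i \<in> {..<L}" "j \<in> {..<L}" "i \<noteq> j"
      then show "\<omega> i \<inter> \<omega> j = {}" using \<omega>d[of i j] \<omega>d[of j i] by (cases "i < j") (auto simp: Int_commute)
    qed
  qed
  obtain \<phi> where \<phi>: "averaging L \<omega> \<phi>" using has_averaging_symmetric fam unfolding has_averaging_def by blast
  have mL: "m < L" by (simp add: L_def)
  have TE: "T (indicator A) \<in> E" by (rule linear_map_in[OF lin AE])
  have nz: "\<phi> m (T (indicator A)) \<noteq> 0"
  proof (rule averaging_nonzero[OF fam \<phi> mL _ TE c])
    show "0 < emeasure M (\<omega> m)" using \<omega>1[OF mL] \<delta> by simp
    show "cmod (T (indicator A) t - c) \<le> cmod c / 2" if "t \<in> \<omega> m" for t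
      using near that B1 by (auto simp: \<omega>_def)
  qed
  have \<omega>E: "indicator (\<omega> i) \<in> E" if "i < L" for i using \<omega>1[OF that] by (intro indicator_in) auto
  have pad: "\<phi> m (\<lambda>t. \<Sum>i\<in>I. g i t) = (\<Sum>i\<in>I. \<phi> m (g i))" if "finite I" "\<And>i. i \<in> I \<Longrightarrow> g i \<in> E" for I :: "nat set" and g
    using that
  proof (induction I rule: finite_induct)
    case empty
    then show ?case using averaging_zero[OF \<phi> mL] by simp
  next
    case (insert x F)
    then show ?case
      using averaging_add[OF \<phi> mL, of "g x" "\<lambda>t. \<Sum>i\<in>F. g i t"] sum_in[of F g] by simp
  qed
  have ex: "\<exists>i<m. \<phi> m (T (indicator (\<omega> i))) \<noteq> 0"
  proof (rule ccontr)
    assume "\<not> ?thesis"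
    then have z: "\<phi> m (T (indicator (\<omega> i))) = 0" if "i < m" for i using that by blast
    have SE: "indicator (S i) \<in> E" if "i < m" for i using S(1) that by (intro indicator_in) auto
    have sE: "(\<lambda>t. \<Sum>i<m. 1 * indicator (S i) t) \<in> E" using family_step_in[OF fS, of "\<lambda>i. 1"] .
    have "AE t in M. T (indicator A) t = T (\<lambda>t. \<Sum>i<m. 1 * indicator (S i) t) t"
      by (rule linear_map_cong[OF lin AE sE ae])
    moreover have "AE t in M. T (\<lambda>t. \<Sum>i<m. 1 * indicator (S i) t) t = (\<Sum>i<m. 1 * T (indicator (S i)) t)"
      by (rule linear_map_sum[OF lin]) (use SE in auto)
    ultimately have ae2: "AE t in M. T (indicator A) t = (\<Sum>i<m. T (indicator (S i)) t)"
      by eventually_elim simp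
    have TSE: "T (indicator (S i)) \<in> E" if "i < m" for i by (rule linear_map_in[OF lin SE[OF that]])
    have "\<phi> m (T (indicator A)) = \<phi> m (\<lambda>t. \<Sum>i<m. T (indicator (S i)) t)"
      by (rule averaging_cong[OF \<phi> mL TE sum_in ae2]) (use TSE in auto)
    also have "\<dots> = (\<Sum>i<m. \<phi> m (T (indicator (S i))))" by (rule pad) (use TSE in auto)
    also have "\<dots> = 0" using z by (intro sum.neutral) (auto simp: \<omega>_def)
    finally show False using nz by simp
  qed
  then obtain i0 where i0: "i0 < m" "\<phi> m (T (indicator (\<omega> i0))) \<noteq> 0" by blast
  have i0L: "i0 < L" "i0 \<noteq> m" using i0 mL by auto
  define F where "F e = N (\<lambda>t. \<Sum>i<L. e i * indicator (\<omega> i) t)" for e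
  have "\<exists>\<theta>>0. \<forall>e. F e = F (e(i0 := complex_of_real (sqrt ((cmod (e i0))\<^sup>2 + \<theta> * (cmod (e m))\<^sup>2)), m := 0))"
    unfolding F_def by (rule coupling[OF fam \<phi> T i0L(1) mL i0L(2) i0(2)])
  then obtain \<theta> where \<theta>: "\<theta> > 0" "\<And>e. F e = F (e(i0 := complex_of_real (sqrt ((cmod (e i0))\<^sup>2 + \<theta> * (cmod (e m))\<^sup>2)), m := 0))"
    by blast
  define \<beta> where "\<beta> = N (indicator (\<omega> i0))"
  have \<beta>: "\<beta> > 0" unfolding \<beta>_def using \<omega>1[OF i0L(1)] \<delta> by (intro norm_indicator_pos) auto
  have Neq: "N (indicator X) = \<beta>" if "X \<in> sets M" "emeasure M X = ennreal \<delta>" for X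
    unfolding \<beta>_def using \<omega>1[OF i0L(1)] that by (intro norm_indicator_equal) auto
  have single: "F (\<lambda>i. if i = j then x else 0) = cmod x * \<beta>" if "j < L" for j x
  proof -
    have "(\<Sum>i<L. (if i = j then x else 0) * indicator (\<omega> i) t) = x * indicator (\<omega> j) t" for t
    proof -
      have "(\<Sum>i<L. (if i = j then x else 0) * indicator (\<omega> i) t) = (\<Sum>i<L. if i = j then x * indicator (\<omega> j) t else 0)"
        by (intro sum.cong) auto
      then show ?thesis using that by (simp only: sum.delta finite_lessThan lessThan_iff if_True)
    qed
    then have "F (\<lambda>i. if i = j then x else 0) = N (\<lambda>t. x * indicator (\<omega> j) t)" unfolding F_def by presburger
    then show ?thesis using norm_scale[OF \<omega>E[OF that]] Neq \<omega>1[OF that] by simp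
  qed
  \<comment> \<open>Indicators of sets of equal measure have equal norms, so merging the unit vector
    at \<open>m\<close> into \<open>i0\<close> must not change its size.\<close>
  have "\<theta> = 1"
  proof -
    have "\<beta> = F (\<lambda>i. if i = m then 1 else 0)" using single[OF mL, of 1] by simp
    also have "\<dots> = F ((\<lambda>i. if i = m then 1 else 0)(i0 := complex_of_real (sqrt ((cmod (if i0 = m then 1 else 0))\<^sup>2 + \<theta> * (cmod (if m = m then 1 else 0))\<^sup>2)), m := 0))"
      by (rule \<theta>(2))
    also have "\<dots> = F (\<lambda>i. if i = i0 then complex_of_real (sqrt \<theta>) else 0)"
      using i0L by (intro arg_cong[where f = F]) (auto simp: fun_eq_iff)
    also have "\<dots> = sqrt \<theta> * \<beta>" using single[OF i0L(1)] \<theta>(1) by simp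
    finally show ?thesis using \<beta> \<theta>(1) by simp
  qed
  then have merge: "F e = F (e(i0 := complex_of_real (sqrt ((cmod (e i0))\<^sup>2 + (cmod (e m))\<^sup>2)), m := 0))" for e
    using \<theta>(2)[of e] by simp
  \<comment> \<open>The last two coefficients are carried to the coupled places \<open>i0\<close>
    and \<open>m\<close> by a permutation, merged there, and carried back; this reduces the number
    of coefficients by one.\<close>
  have main: "N (\<lambda>t. \<Sum>i<k. d i * indicator (D i) t) = sqrt (\<Sum>i<k. (cmod (d i))\<^sup>2) * \<beta>"
    if "k \<le> L" "finite_family k D" "\<And>i. i < k \<Longrightarrow> emeasure M (D i) = ennreal \<delta>" for k d D
    using that
  proof (induction k arbitrary: d)
    case 0
    then show ?case using norm_zero by simp
  next
    case (Suc k)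
    have famk: "finite_family k D" using Suc.prems(2) unfolding finite_family_def disjoint_family_on_def by auto
    show ?case
    proof (cases k)
      case 0
      have "D 0 \<in> sets M" "emeasure M (D 0) = ennreal \<delta>" using Suc.prems 0 by (auto simp: finite_family_def)
      then show ?thesis using norm_scale[OF indicator_in, of "D 0" "d 0"] Neq[of "D 0"] 0 by simp
    next
      case (Suc k')
      have k': "k' < L" "k < L" "k' \<noteq> k" using Suc Suc.prems(1) by auto
      obtain p where p: "bij_betw p {..<L} {..<L}" "p i0 = k'" "p m = k"
        using transpose_pair_permutation[OF i0L(1) mL i0L(2) k'(1,2,3)] by blast
      \<comment> \<open>Padding with zeros lets step functions with at most \<open>L\<close>
        coefficients be transported to the fixed frame.\<close>
      define ext where "ext l e = (\<lambda>i. if i < l then e i else 0 :: complex)" for l :: nat and e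
      have cardp: "card {i. i < L \<and> x < cmod (ext l e (p i))} = card {i. i < l \<and> x < cmod (e i)}"
        if "l \<le> L" "0 \<le> x" for l e and x :: real
      proof -
        have "bij_betw p {i. i < L \<and> x < cmod (ext l e (p i))} {i. i < L \<and> x < cmod (ext l e i)}"
          unfolding bij_betw_def
        proof
          show "inj_on p {i. i < L \<and> x < cmod (ext l e (p i))}"
            by (rule inj_on_subset[OF bij_betw_imp_inj_on[OF p(1)]]) auto
          show "p ` {i. i < L \<and> x < cmod (ext l e (p i))} = {i. i < L \<and> x < cmod (ext l e i)}"
          proof (intro equalityI subsetI)
            fix j assume j: "j \<in> {i. i < L \<and> x < cmod (ext l e i)}"
            then have "j \<in> p ` {..<L}" using p(1) by (simp add: bij_betw_def)
            then show "j \<in> p ` {i. i < L \<and> x < cmod (ext l e (p i))}" using j by auto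
          next
            fix j assume "j \<in> p ` {i. i < L \<and> x < cmod (ext l e (p i))}"
            then show "j \<in> {i. i < L \<and> x < cmod (ext l e i)}" using bij_betwE[OF p(1)] by auto
          qed
        qed
        then have "card {i. i < L \<and> x < cmod (ext l e (p i))} = card {i. i < L \<and> x < cmod (ext l e i)}"
          by (rule bij_betw_same_card)
        also have "{i. i < L \<and> x < cmod (ext l e i)} = {i. i < l \<and> x < cmod (e i)}"
          using that by (auto simp: ext_def)
        finally show ?thesis .
      qed
      have eqF: "N (\<lambda>t. \<Sum>i<l. e i * indicator (D i) t) = F (\<lambda>i. ext l e (p i))" if "l \<le> Suc k" "finite_family l D" for l e
        unfolding F_def
      proof (rule norm_step_equidistributed[OF that(2) _ fam])
        show "emeasure M (D i) = ennreal \<delta>" if "i < l" for i using Suc.prems(3) that \<open>l \<le> Suc k\<close> by simp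
        show "emeasure M (\<omega> i) = ennreal \<delta>" if "i < L" for i using \<omega>1[OF that] by simp
        show "card {i. i < l \<and> x < cmod (e i)} = card {i. i < L \<and> x < cmod (ext l e (p i))}" if "0 \<le> x" for x
          using cardp[of l x e] that \<open>l \<le> Suc k\<close> Suc.prems(1) by simp
      qed
      define d' where "d' = d(k' := complex_of_real (sqrt ((cmod (d k'))\<^sup>2 + (cmod (d k))\<^sup>2)))"
      have "N (\<lambda>t. \<Sum>i<Suc k. d i * indicator (D i) t) = F (\<lambda>i. ext (Suc k) d (p i))"
        by (rule eqF[OF order_refl Suc.prems(2)])
      also have "\<dots> = F ((\<lambda>i. ext (Suc k) d (p i))(i0 := complex_of_real (sqrt ((cmod (ext (Suc k) d (p i0)))\<^sup>2 + (cmod (ext (Suc k) d (p m)))\<^sup>2)), m := 0))"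
        by (rule merge)
      also have "\<dots> = F (\<lambda>i. ext k d' (p i))"
        unfolding F_def
      proof (rule step_cong_cmod[OF fam])
        fix i assume i: "i < L"
        have inj: "p i = p j \<Longrightarrow> i = j" if "j < L" for j
          using bij_betw_imp_inj_on[OF p(1)] i that by (auto simp: inj_on_def)
        consider "i = i0" | "i = m" | "i \<noteq> i0" "i \<noteq> m" by blast
        then show "cmod (((\<lambda>i. ext (Suc k) d (p i))(i0 := complex_of_real (sqrt ((cmod (ext (Suc k) d (p i0)))\<^sup>2 + (cmod (ext (Suc k) d (p m)))\<^sup>2)), m := 0)) i) = cmod (ext k d' (p i))"
        proof cases
          case 1
          then show ?thesis using i0L p Suc by (simp add: ext_def d'_def)
        next
          case 2
          then show ?thesis using p by (simp add: ext_def)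
        next
          case 3
          then have "p i \<noteq> k'" "p i \<noteq> k" using inj[OF i0L(1)] inj[OF mL] p by auto
          then show ?thesis using 3 by (auto simp: ext_def d'_def less_Suc_eq)
        qed
      qed
      also have "\<dots> = N (\<lambda>t. \<Sum>i<k. d' i * indicator (D i) t)"
        by (rule eqF[symmetric]) (use famk in auto)
      also have "\<dots> = sqrt (\<Sum>i<k. (cmod (d' i))\<^sup>2) * \<beta>"
        by (rule Suc.IH[OF _ famk]) (use Suc.prems in auto)
      also have "(\<Sum>i<k. (cmod (d' i))\<^sup>2) = (\<Sum>i<Suc k. (cmod (d i))\<^sup>2)"
      proof -
        have "(\<Sum>i<k'. (cmod (d' i))\<^sup>2) = (\<Sum>i<k'. (cmod (d i))\<^sup>2)" by (intro sum.cong) (auto simp: d'_def)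
        then show ?thesis unfolding Suc by (simp add: d'_def Suc)
      qed
      finally show ?thesis .
    qed
  qed
  have "N (\<lambda>t. \<Sum>i<K. d i * indicator (C i) t) = sqrt (\<Sum>i<K. (cmod (d i))\<^sup>2) * \<beta>"
    by (rule main[OF _ C(1)]) (use C(2) in \<open>auto simp: L_def \<delta>_def\<close>)
  then have "(N (\<lambda>t. \<Sum>i<K. d i * indicator (C i) t))\<^sup>2 = (\<Sum>i<K. (cmod (d i))\<^sup>2) * \<beta>\<^sup>2"
    by (simp add: power_mult_distrib sum_nonneg)
  also have "\<dots> = (\<Sum>i<K. (cmod (d i))\<^sup>2 * (N (indicator (C i)))\<^sup>2)"
    unfolding sum_distrib_right
  proof (rule sum.cong[OF refl])
    fix i assume "i \<in> {..<K}"
    then have "C i \<in> sets M" "emeasure M (C i) = ennreal \<delta>" using C by (auto simp: finite_family_def \<delta>_def)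
    then show "(cmod (d i))\<^sup>2 * \<beta>\<^sup>2 = (cmod (d i))\<^sup>2 * (N (indicator (C i)))\<^sup>2" using Neq by simp
  qed
  finally show "(N (\<lambda>t. \<Sum>i<K. d i * indicator (C i) t))\<^sup>2 = (\<Sum>i<K. (cmod (d i))\<^sup>2 * (N (indicator (C i)))\<^sup>2)" .
qed


lemma norm_indicator_mono_measure:
  assumes A: "A \<in> sets M" and B: "B \<in> sets M" "emeasure M B < \<infinity>" and le: "emeasure M A \<le> emeasure M B"
  shows "N (indicator A) \<le> N (indicator B)"
proof -
  have fA: "emeasure M A < \<infinity>" using le B(2) by (rule order_le_less_trans)
  have eq: "emeasure M A = ennreal (measure M A)" using fA by (intro emeasure_eq_ennreal_measure) auto
  obtain A' where A': "A' \<in> sets M" "A' \<subseteq> B" "emeasure M A' = emeasure M A"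
    using atomless[OF B(1), of "measure M A"] le eq by auto
  have iE: "indicator A' \<in> E" "indicator B \<in> E" using A' B fA by (auto intro!: indicator_in)
  have "N (indicator A) = N (indicator A')" using A A' fA by (intro norm_indicator_equal) auto
  also have "\<dots> \<le> N (indicator B)"
    by (rule norm_mono_in[OF iE(2,1)]) (use A'(2) in \<open>auto simp: indicator_def\<close>)
  finally show ?thesis .
qed

lemma square_additiveD:
  assumes "square_additive \<delta>" "finite_family k C" "\<And>i. i < k \<Longrightarrow> emeasure M (C i) = ennreal \<delta>"
  shows "(N (\<lambda>t. \<Sum>i<k. c i * indicator (C i) t))\<^sup>2 = (\<Sum>i<k. (cmod (c i))\<^sup>2 * (N (indicator (C i)))\<^sup>2)"
  using assms unfolding square_additive_def by blast

lemma square_additive_sum: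
  assumes sq: "square_additive \<delta>" and I: "finite I"
    and C: "\<And>i. i \<in> I \<Longrightarrow> C i \<in> sets M \<and> emeasure M (C i) = ennreal \<delta>" "disjoint_family_on C I"
  shows "(N (\<lambda>t. \<Sum>i\<in>I. c i * indicator (C i) t))\<^sup>2 = (\<Sum>i\<in>I. (cmod (c i))\<^sup>2 * (N (indicator (C i)))\<^sup>2)"
proof -
  obtain h where h: "bij_betw h {0..<card I} I" using ex_bij_betw_nat_finite[OF I] by blast
  have h': "bij_betw h {..<card I} I" using h by (simp add: atLeast0LessThan)
  have hI: "h i \<in> I" if "i < card I" for i using bij_betwE[OF h'] that by auto
  have "finite_family (card I) (C \<circ> h)"
    unfolding finite_family_def
  proof (intro conjI allI impI)
    show "(C \<circ> h) i \<in> sets M" "emeasure M ((C \<circ> h) i) < \<infinity>" if "i < card I" for i using C(1)[OF hI[OF that]] by auto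
    show "disjoint_family_on (C \<circ> h) {..<card I}"
      unfolding disjoint_family_on_def
    proof (intro ballI impI)
      fix i j assume ij: "i \<in> {..<card I}" "j \<in> {..<card I}" "i \<noteq> j"
      then have "h i \<noteq> h j" using bij_betw_imp_inj_on[OF h'] by (auto dest: inj_onD)
      moreover have "h i \<in> I" "h j \<in> I" using hI ij by auto
      ultimately have "C (h i) \<inter> C (h j) = {}" using C(2) unfolding disjoint_family_on_def by blast
      then show "(C \<circ> h) i \<inter> (C \<circ> h) j = {}" by simp
    qed
  qed
  then have "(N (\<lambda>t. \<Sum>i<card I. (c \<circ> h) i * indicator ((C \<circ> h) i) t))\<^sup>2 = (\<Sum>i<card I. (cmod ((c \<circ> h) i))\<^sup>2 * (N (indicator ((C \<circ> h) i)))\<^sup>2)"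
    by (rule square_additiveD[OF sq]) (use C(1) hI in simp)
  moreover have "(\<Sum>i<card I. (c \<circ> h) i * indicator ((C \<circ> h) i) t) = (\<Sum>i\<in>I. c i * indicator (C i) t)" for t
    using sum.reindex_bij_betw[OF h', of "\<lambda>i. c i * indicator (C i) t"] by (simp only: comp_apply)
  moreover have "(\<Sum>i<card I. (cmod ((c \<circ> h) i))\<^sup>2 * (N (indicator ((C \<circ> h) i)))\<^sup>2) = (\<Sum>i\<in>I. (cmod (c i))\<^sup>2 * (N (indicator (C i)))\<^sup>2)"
    using sum.reindex_bij_betw[OF h', of "\<lambda>i. (cmod (c i))\<^sup>2 * (N (indicator (C i)))\<^sup>2"] by (simp only: comp_apply)
  ultimately show ?thesis by (simp only:)
qed

text \<open>Cutting \<open>X\<close> into \<open>r\<close> pieces fixes the squared norm of every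
  set of measure \<open>a / r\<close> as \<open>\<kappa>^2 a / r\<close>. An arbitrary step function
  is filled from inside by such pieces; the remainders have norm of order \<open>1 / sqrt r\<close>,
  so the formula passes to the limit, and \<open>L2_norm_extension\<close> carries it to all of
  \<open>E\<close>.\<close>

lemma proportional_if_square_additive:
  assumes a: "a > 0" and X: "X \<in> sets M" "emeasure M X = ennreal a"
    and sq: "\<And>r::nat. r > 0 \<Longrightarrow> square_additive (a / real r)"
  shows "proportional_to_L2 M E N"
proof -
  have XE: "indicator X \<in> E" using X by (intro indicator_in) auto
  define \<beta> where "\<beta> = N (indicator X)"
  have \<beta>: "\<beta> > 0" unfolding \<beta>_def using X a by (intro norm_indicator_pos) auto
  define \<kappa> where "\<kappa> = \<beta> / sqrt a"
  have \<kappa>: "\<kappa> > 0" using \<beta> a by (simp add: \<kappa>_def)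
  have \<kappa>2: "\<kappa>\<^sup>2 * a = \<beta>\<^sup>2" using a by (simp add: \<kappa>_def power_divide)
  have small: "(N (indicator Y))\<^sup>2 = \<kappa>\<^sup>2 * (a / real r)"
    if r: "r > 0" and Y: "Y \<in> sets M" "emeasure M Y = ennreal (a / real r)" for r Y
  proof -
    have pos: "0 \<le> a / real r" using a by simp
    have emX: "emeasure M X = ennreal (real r * (a / real r))" using X(2) r by simp
    obtain S where fS: "finite_family r S" and S: "\<And>i. i < r \<Longrightarrow> S i \<subseteq> X" "\<And>i. i < r \<Longrightarrow> emeasure M (S i) = ennreal (a / real r)"
      and ae: "AE t in M. indicator X t = (\<Sum>i<r. 1 * indicator (S i) t :: complex)"
      by (rule equal_partition[OF X(1) emX pos]) (rule that)
    have "\<beta> = N (\<lambda>t. \<Sum>i<r. 1 * indicator (S i) t)"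
      unfolding \<beta>_def by (rule norm_cong[OF XE family_step_in[OF fS, of "\<lambda>i. 1"] ae])
    moreover have "(N (\<lambda>t. \<Sum>i<r. 1 * indicator (S i) t))\<^sup>2 = (\<Sum>i<r. (cmod 1)\<^sup>2 * (N (indicator (S i)))\<^sup>2)"
      by (rule square_additiveD[OF sq[OF r] fS S(2)])
    moreover have "N (indicator (S i)) = N (indicator Y)" if "i < r" for i
      using fS S(2)[OF that] Y that by (intro norm_indicator_equal) (auto simp: finite_family_def)
    ultimately have "\<beta>\<^sup>2 = real r * (N (indicator Y))\<^sup>2" by simp
    then show ?thesis using \<kappa>2 r by (simp add: field_simps)
  qed
  have step: "(N (\<lambda>t. \<Sum>i<n. b i * indicator (\<omega> i) t))\<^sup>2 = \<kappa>\<^sup>2 * (\<Sum>i<n. (cmod (b i))\<^sup>2 * measure M (\<omega> i))"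
    if fam: "finite_family n \<omega>" for n \<omega> b
  proof -
    define w where "w t = (\<Sum>i<n. b i * indicator (\<omega> i) t)" for t
    have wE: "w \<in> E" unfolding w_def by (rule family_step_in[OF fam])
    have \<omega>m: "\<omega> i \<in> sets M" "emeasure M (\<omega> i) = ennreal (measure M (\<omega> i))" if "i < n" for i
      using fam that by (auto simp: finite_family_def intro!: emeasure_eq_ennreal_measure)
    \<comment> \<open>Two errors of an approximation \<open>v\<close> of \<open>w\<close> by pieces
      of measure \<open>a / (r + 1)\<close>: in the norm, and in the weighted sum of measures. Both
      bounds tend to 0 with \<open>r\<close>.\<close>
    define good where "good r v \<longleftrightarrow> v \<in> E \<and> \<bar>N w - N v\<bar> \<le> (\<Sum>i<n. cmod (b i)) * (\<beta> / sqrt (real (Suc r))) \<and>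
       \<bar>(N v)\<^sup>2 - \<kappa>\<^sup>2 * (\<Sum>i<n. (cmod (b i))\<^sup>2 * measure M (\<omega> i))\<bar> \<le> \<kappa>\<^sup>2 * (\<Sum>i<n. (cmod (b i))\<^sup>2) * (a / real (Suc r))" for r v
    have good: "\<exists>v. good r v" for r
    proof -
      define \<delta> where "\<delta> = a / real (Suc r)"
      have \<delta>: "\<delta> > 0" using a by (simp add: \<delta>_def)
      define q where "q i = nat \<lfloor>measure M (\<omega> i) / \<delta>\<rfloor>" for i
      have q: "real (q i) * \<delta> \<le> measure M (\<omega> i)" "measure M (\<omega> i) \<le> real (q i) * \<delta> + \<delta>" for i
      proof -
        have nn: "0 \<le> measure M (\<omega> i) / \<delta>" using \<delta> by simp
        then have e: "real (q i) = of_int \<lfloor>measure M (\<omega> i) / \<delta>\<rfloor>" by (simp add: q_def)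
        have "real (q i) \<le> measure M (\<omega> i) / \<delta>" "measure M (\<omega> i) / \<delta> \<le> real (q i) + 1"
          unfolding e by linarith+
        then show "real (q i) * \<delta> \<le> measure M (\<omega> i)" "measure M (\<omega> i) \<le> real (q i) * \<delta> + \<delta>"
          using \<delta> by (auto simp: field_simps)
      qed
      have "\<exists>S. (\<forall>l<q i. S l \<in> sets M \<and> S l \<subseteq> \<omega> i \<and> emeasure M (S l) = ennreal \<delta>) \<and> disjoint_family_on S {..<q i}" if "i < n" for i
        by (rule split_equal) (use \<omega>m[OF that] q[of i] \<delta> in \<open>auto intro: ennreal_leI\<close>)
      then obtain S where S: "\<And>i l. i < n \<Longrightarrow> l < q i \<Longrightarrow> S i l \<in> sets M \<and> S i l \<subseteq> \<omega> i \<and> emeasure M (S i l) = ennreal \<delta>"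
        "\<And>i. i < n \<Longrightarrow> disjoint_family_on (S i) {..<q i}" by metis
      define U where "U i = (\<Union>l<q i. S i l)" for i
      have fS: "finite_family (q i) (S i)" if "i < n" for i unfolding finite_family_def using S that by auto
      have Um: "U i \<in> sets M" "U i \<subseteq> \<omega> i" if "i < n" for i unfolding U_def using S(1)[OF that] by auto
      have emU: "emeasure M (U i) = ennreal (real (q i) * \<delta>)" if "i < n" for i
        unfolding U_def by (rule union_equal[OF fS[OF that]]) (use S(1)[OF that] \<delta> in auto)
      define I where "I = Sigma {..<n} (\<lambda>i. {..<q i})"
      have Ifin: "finite I" unfolding I_def by auto
      define v where "v t = (\<Sum>p\<in>I. b (fst p) * indicator (S (fst p) (snd p)) t)" for t
      have v_eq: "v t = (\<Sum>i<n. b i * indicator (U i) t)" for t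
      proof -
        have "v t = (\<Sum>i<n. \<Sum>l<q i. b i * indicator (S i l) t)"
          unfolding v_def I_def by (subst sum.Sigma) (auto simp: case_prod_beta)
        also have "\<dots> = (\<Sum>i<n. b i * indicator (U i) t)"
        proof (intro sum.cong refl)
          fix i assume "i \<in> {..<n}"
          then have i: "i < n" by simp
          show "(\<Sum>l<q i. b i * indicator (S i l) t) = b i * indicator (U i) t"
          proof (cases "\<exists>l<q i. t \<in> S i l")
            case True
            then obtain l where l: "l < q i" "t \<in> S i l" by blast
            then have "t \<in> U i" by (auto simp: U_def)
            then show ?thesis using step_at[OF fS[OF i] l, of "\<lambda>_. b i"] by (simp only: indicator_simps mult_1_right)
          next
            case False
            then show ?thesis using step_off[of "q i" t "S i" "\<lambda>_. b i"] by (auto simp: U_def)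
          qed
        qed
        finally show ?thesis .
      qed
      have vE: "v \<in> E"
        unfolding v_def by (rule step_in[OF Ifin]) (use S(1) in \<open>auto simp: I_def\<close>)
      have dis: "disjoint_family_on (\<lambda>p. S (fst p) (snd p)) I"
        unfolding disjoint_family_on_def
      proof (intro ballI impI)
        fix p p' assume pp: "p \<in> I" "p' \<in> I" "p \<noteq> p'"
        then have lt: "fst p < n" "snd p < q (fst p)" "fst p' < n" "snd p' < q (fst p')" by (auto simp: I_def)
        show "S (fst p) (snd p) \<inter> S (fst p') (snd p') = {}"
        proof (cases "fst p = fst p'")
          case True
          then have "snd p \<noteq> snd p'" using pp(3) by (auto simp: prod_eq_iff)
          then show ?thesis using S(2)[OF lt(1)] lt True by (simp add: disjoint_family_on_def)
        next
          case False
          then have "\<omega> (fst p) \<inter> \<omega> (fst p') = {}"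
            using fam lt unfolding finite_family_def disjoint_family_on_def by simp
          then show ?thesis using S(1)[OF lt(1,2)] S(1)[OF lt(3,4)] by blast
        qed
      qed
      have Nv: "(N v)\<^sup>2 = (\<Sum>i<n. (cmod (b i))\<^sup>2 * (\<kappa>\<^sup>2 * (real (q i) * \<delta>)))"
      proof -
        have "(N v)\<^sup>2 = (\<Sum>p\<in>I. (cmod (b (fst p)))\<^sup>2 * (N (indicator (S (fst p) (snd p))))\<^sup>2)"
          unfolding v_def
          by (rule square_additive_sum[OF _ Ifin _ dis, of \<delta>]) (use sq[of "Suc r"] S(1) in \<open>auto simp: I_def \<delta>_def\<close>)
        also have "\<dots> = (\<Sum>p\<in>I. (cmod (b (fst p)))\<^sup>2 * (\<kappa>\<^sup>2 * \<delta>))"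
          using small[of "Suc r"] S(1) by (intro sum.cong refl) (auto simp: I_def \<delta>_def)
        also have "\<dots> = (\<Sum>i<n. \<Sum>l<q i. (cmod (b i))\<^sup>2 * (\<kappa>\<^sup>2 * \<delta>))"
          unfolding I_def by (subst sum.Sigma) (auto simp: case_prod_beta)
        also have "\<dots> = (\<Sum>i<n. (cmod (b i))\<^sup>2 * (\<kappa>\<^sup>2 * (real (q i) * \<delta>)))"
          by (intro sum.cong refl) simp
        finally show ?thesis .
      qed
      have diff: "\<bar>(N v)\<^sup>2 - \<kappa>\<^sup>2 * (\<Sum>i<n. (cmod (b i))\<^sup>2 * measure M (\<omega> i))\<bar> \<le> \<kappa>\<^sup>2 * (\<Sum>i<n. (cmod (b i))\<^sup>2) * \<delta>"
      proof -
        have "(N v)\<^sup>2 - \<kappa>\<^sup>2 * (\<Sum>i<n. (cmod (b i))\<^sup>2 * measure M (\<omega> i))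
          = (\<Sum>i<n. \<kappa>\<^sup>2 * (cmod (b i))\<^sup>2 * (real (q i) * \<delta> - measure M (\<omega> i)))"
          unfolding Nv by (simp add: sum_distrib_left sum_subtractf[symmetric] algebra_simps)
        also have "\<bar>\<dots>\<bar> \<le> (\<Sum>i<n. \<bar>\<kappa>\<^sup>2 * (cmod (b i))\<^sup>2 * (real (q i) * \<delta> - measure M (\<omega> i))\<bar>)" by (rule sum_abs)
        also have "\<dots> \<le> (\<Sum>i<n. \<kappa>\<^sup>2 * (cmod (b i))\<^sup>2 * \<delta>)"
        proof (rule sum_mono)
          fix i
          have "\<bar>real (q i) * \<delta> - measure M (\<omega> i)\<bar> \<le> \<delta>" using q[of i] by linarith
          then show "\<bar>\<kappa>\<^sup>2 * (cmod (b i))\<^sup>2 * (real (q i) * \<delta> - measure M (\<omega> i))\<bar> \<le> \<kappa>\<^sup>2 * (cmod (b i))\<^sup>2 * \<delta>"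
            by (simp add: abs_mult mult_left_mono)
        qed
        also have "\<dots> = \<kappa>\<^sup>2 * (\<Sum>i<n. (cmod (b i))\<^sup>2) * \<delta>"
          by (simp only: sum_distrib_left sum_distrib_right)
        finally show ?thesis .
      qed
      have "\<bar>N w - N v\<bar> \<le> N (\<lambda>t. w t - v t)" by (rule abs_norm_diff_le[OF wE vE])
      also have "(\<lambda>t. w t - v t) = (\<lambda>t. \<Sum>i<n. b i * indicator (\<omega> i - U i) t)"
      proof
        fix t
        have "w t - v t = (\<Sum>i<n. b i * indicator (\<omega> i) t - b i * indicator (U i) t)"
          by (simp only: w_def v_eq sum_subtractf)
        also have "\<dots> = (\<Sum>i<n. b i * indicator (\<omega> i - U i) t)"
          using Um(2) by (intro sum.cong refl) (auto simp: indicator_def)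
        finally show "w t - v t = (\<Sum>i<n. b i * indicator (\<omega> i - U i) t)" .
      qed
      also have "N (\<lambda>t. \<Sum>i<n. b i * indicator (\<omega> i - U i) t) \<le> (\<Sum>i<n. N (\<lambda>t. b i * indicator (\<omega> i - U i) t))"
      proof (rule norm_sum_le)
        fix i assume "i \<in> {..<n}"
        then have i: "i < n" by simp
        have "emeasure M (\<omega> i - U i) \<le> emeasure M (\<omega> i)" using \<omega>m[OF i] by (intro emeasure_mono) auto
        also have "\<dots> < \<infinity>" using fam i by (simp add: finite_family_def)
        finally show "(\<lambda>t. b i * indicator (\<omega> i - U i) t) \<in> E"
          using \<omega>m[OF i] Um[OF i] by (intro scale indicator_in) auto
      qed simp
      also have "\<dots> \<le> (\<Sum>i<n. cmod (b i) * (\<beta> / sqrt (real (Suc r))))"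
      proof (rule sum_mono)
        fix i assume "i \<in> {..<n}"
        then have i: "i < n" by simp
        have rm: "\<omega> i - U i \<in> sets M" using \<omega>m[OF i] Um[OF i] by auto
        have "emeasure M (\<omega> i - U i) = emeasure M (\<omega> i) - emeasure M (U i)"
          using Um[OF i] \<omega>m[OF i] emU[OF i] by (intro emeasure_Diff) auto
        also have "\<dots> = ennreal (measure M (\<omega> i) - real (q i) * \<delta>)"
          unfolding emU[OF i] \<omega>m(2)[OF i] using q[of i] \<delta> by (intro ennreal_minus) auto
        also have "\<dots> \<le> ennreal \<delta>" using q[of i] by (intro ennreal_leI) linarith
        finally have le: "emeasure M (\<omega> i - U i) \<le> ennreal \<delta>" .
        then have rf: "emeasure M (\<omega> i - U i) < \<infinity>" by (simp add: order_le_less_trans[OF _ ennreal_less_top])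
        \<comment> \<open>The remainder has measure at most \<delta>, so its norm is at most that of
          a set of measure exactly \<delta>; such a set exists inside \<open>X\<close> because
          \<delta> is at most \<open>a\<close>.\<close>
        obtain Y where Y: "Y \<in> sets M" "emeasure M Y = ennreal \<delta>"
          using atomless[OF X(1), of \<delta>] X(2) \<delta> a by (auto simp: \<delta>_def field_simps intro!: ennreal_leI)
        have "N (indicator (\<omega> i - U i)) \<le> N (indicator Y)"
          by (rule norm_indicator_mono_measure[OF rm Y(1)]) (use Y le in auto)
        also have "N (indicator Y) = \<beta> / sqrt (real (Suc r))"
        proof -
          have "(N (indicator Y))\<^sup>2 = (\<beta> / sqrt (real (Suc r)))\<^sup>2"
            using small[of "Suc r" Y] Y \<kappa>2 by (simp add: \<delta>_def power_divide)
          moreover have "0 \<le> N (indicator Y)" using Y by (intro norm_nonneg indicator_in) auto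
          ultimately show ?thesis using \<beta> by (simp add: power2_eq_iff_nonneg)
        qed
        finally have "cmod (b i) * N (indicator (\<omega> i - U i)) \<le> cmod (b i) * (\<beta> / sqrt (real (Suc r)))"
          by (rule mult_left_mono) simp
        then show "N (\<lambda>t. b i * indicator (\<omega> i - U i) t) \<le> cmod (b i) * (\<beta> / sqrt (real (Suc r)))"
          using norm_scale[OF indicator_in[OF rm rf]] by simp
      qed
      also have "\<dots> = (\<Sum>i<n. cmod (b i)) * (\<beta> / sqrt (real (Suc r)))" by (simp only: sum_distrib_right)
      finally have "\<bar>N w - N v\<bar> \<le> (\<Sum>i<n. cmod (b i)) * (\<beta> / sqrt (real (Suc r)))" .
      then have "good r v" unfolding good_def using vE diff by (simp add: \<delta>_def)
      then show ?thesis by blast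
    qed
    define v where "v r = (SOME v. good r v)" for r
    have "good r (v r)" for r unfolding v_def using good by (rule someI_ex)
    then have v: "\<bar>N w - N (v r)\<bar> \<le> (\<Sum>i<n. cmod (b i)) * (\<beta> / sqrt (real (Suc r)))"
      "\<bar>(N (v r))\<^sup>2 - \<kappa>\<^sup>2 * (\<Sum>i<n. (cmod (b i))\<^sup>2 * measure M (\<omega> i))\<bar> \<le> \<kappa>\<^sup>2 * (\<Sum>i<n. (cmod (b i))\<^sup>2) * (a / real (Suc r))" for r
      unfolding good_def by blast+
    have z1: "(\<lambda>r. (\<Sum>i<n. cmod (b i)) * (\<beta> / sqrt (real (Suc r)))) \<longlonglongrightarrow> 0"
    proof -
      have "(\<lambda>r. sqrt (1 / real (Suc r))) \<longlonglongrightarrow> sqrt 0"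
        by (intro tendsto_real_sqrt LIMSEQ_Suc[OF lim_const_over_n])
      then have "(\<lambda>r. (\<Sum>i<n. cmod (b i)) * \<beta> * sqrt (1 / real (Suc r))) \<longlonglongrightarrow> (\<Sum>i<n. cmod (b i)) * \<beta> * sqrt 0"
        by (intro tendsto_mult tendsto_const)
      then show ?thesis by (simp add: real_sqrt_divide)
    qed
    have z2: "(\<lambda>r. \<kappa>\<^sup>2 * (\<Sum>i<n. (cmod (b i))\<^sup>2) * (a / real (Suc r))) \<longlonglongrightarrow> 0"
      using tendsto_mult[OF tendsto_const LIMSEQ_Suc[OF lim_const_over_n[of a]], of "\<kappa>\<^sup>2 * (\<Sum>i<n. (cmod (b i))\<^sup>2)"] by simp
    have "(\<lambda>r. N (v r)) \<longlonglongrightarrow> N w"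
    proof (rule LIM_zero_cancel, rule Lim_null_comparison[OF _ z1])
      show "\<forall>\<^sub>F r in sequentially. norm (N (v r) - N w) \<le> (\<Sum>i<n. cmod (b i)) * (\<beta> / sqrt (real (Suc r)))"
        using v(1) by (simp add: abs_minus_commute)
    qed
    then have "(\<lambda>r. (N (v r))\<^sup>2) \<longlonglongrightarrow> (N w)\<^sup>2" by (rule tendsto_power)
    moreover have "(\<lambda>r. (N (v r))\<^sup>2) \<longlonglongrightarrow> \<kappa>\<^sup>2 * (\<Sum>i<n. (cmod (b i))\<^sup>2 * measure M (\<omega> i))"
      by (rule LIM_zero_cancel, rule Lim_null_comparison[OF _ z2]) (use v(2) in simp)
    ultimately show ?thesis unfolding w_def using LIMSEQ_unique by blast
  qed
  have "f \<in> L2_space M \<and> N f = \<kappa> * L2_norm M f" if f: "f \<in> E" for f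
  proof -
    have r: "rho (space M) f \<in> E" by (rule rho_in[OF sets.top f])
    have sr: "sets M = sets (restrict_space M (space M))"
      by (auto simp: sets_restrict_space_iff dest: sets.sets_into_space[THEN subsetD])
    have "rho (space M) f \<in> L2_space M \<and> N (rho (space M) f) = \<kappa> * L2_norm M (rho (space M) f)"
      by (rule L2_norm_extension[OF sets.top sr \<kappa> _ step r]) (auto simp: rho_apply)
    moreover have "N (rho (space M) f) = N f" by (rule norm_cong[OF r f]) (auto simp: rho_apply)
    moreover have "L2_norm M (rho (space M) f) = L2_norm M f"
      unfolding L2_norm_def by (intro arg_cong[where f = sqrt] Bochner_Integration.integral_cong) (auto simp: rho_apply)
    moreover have "integrable M (\<lambda>t. (cmod (rho (space M) f t))\<^sup>2) = integrable M (\<lambda>t. (cmod (f t))\<^sup>2)"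
      by (intro Bochner_Integration.integrable_cong) (auto simp: rho_apply)
    ultimately show ?thesis using meas[OF f] by (simp add: L2_space_def)
  qed
  then show ?thesis unfolding proportional_to_L2_def using \<kappa> by blast
qed

text \<open>A coupled pair yields Pythagoras for pieces of measure \<open>a / (m r)\<close> for
  every \<open>r\<close>, provided that a piece of measure \<open>a / m\<close> fits into
  \<open>B\<close>. These are exactly the fractions of a set of measure \<open>a / m\<close>, as
  required for proportionality.\<close>

lemma local_if_not_proportional:
  assumes np: "\<not> proportional_to_L2 M E N" and T: "hermitian T C"
  shows "local_map T"
proof (rule local_map_if_no_coupling[OF T])
  fix A B c assume A: "A \<in> sets M" and B: "B \<in> sets M" and AB: "A \<inter> B = {}" and fin: "emeasure M A < \<infinity>"
    and Bpos: "emeasure M B > 0" "emeasure M B < \<infinity>" and c: "c \<noteq> (0::complex)"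
  have lin: "linear_map M E M E T" using T by (simp add: hermitian_def)
  show "\<not> (\<forall>t\<in>B. cmod (T (indicator A) t - c) \<le> cmod c / 2)"
  proof
    assume near: "\<forall>t\<in>B. cmod (T (indicator A) t - c) \<le> cmod c / 2"
    define a where "a = measure M A"
    have emA: "emeasure M A = ennreal a" unfolding a_def using fin by (intro emeasure_eq_ennreal_measure) auto
    define b where "b = measure M B"
    have emB: "emeasure M B = ennreal b" unfolding b_def using Bpos by (intro emeasure_eq_ennreal_measure) auto
    have b: "b > 0" using Bpos emB by simp
    \<comment> \<open>If \<open>A\<close> were null, \<open>T (indicator A)\<close> would vanish
      a.e., although it is within \<open>\<bar>c\<bar> / 2\<close> of \<open>c\<close> on
      \<open>B\<close>.\<close>
    have a: "a > 0"
    proof (rule ccontr)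
      assume "\<not> a > 0"
      then have "A \<in> null_sets M" using emA A by (auto simp: ennreal_neg)
      from AE_not_in[OF this] have z: "AE t in M. indicator A t = (0::complex) * indicator A t"
        by eventually_elim simp
      have iE: "indicator A \<in> E" using A fin by (rule indicator_in)
      have "AE t in M. T (indicator A) t = T (\<lambda>t. 0 * indicator A t) t"
        by (rule linear_map_cong[OF lin iE scale[OF iE] z])
      moreover have "AE t in M. T (\<lambda>t. 0 * indicator A t) t = 0 * T (indicator A) t" by (rule linear_map_scale[OF lin iE])
      ultimately have "AE t in M. t \<notin> B"
      proof eventually_elim
        case (elim t)
        then have "T (indicator A) t = 0" by simp
        then show ?case using near c by force
      qed
      then show False using AE_iff_null_sets[OF B] Bpos by auto
    qed
    obtain m :: nat where m: "a / b < real m" using reals_Archimedean2 by blast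
    have m0: "m > 0" using m a b by (metis divide_pos_pos of_nat_0_less_iff order_less_trans)
    have mb: "a / real m \<le> b" using m m0 b by (simp add: field_simps)
    have "proportional_to_L2 M E N"
    proof -
      define a0 where "a0 = a / real m"
      have a0: "a0 > 0" using a m0 by (simp add: a0_def)
      obtain X where X: "X \<in> sets M" "emeasure M X = ennreal a0"
        using atomless[OF B, of a0] a0 mb emB by (auto simp: a0_def intro: ennreal_leI)
      show ?thesis
      proof (rule proportional_if_square_additive[OF a0 X])
        fix r :: nat assume r: "r > 0"
        have "a / real (m * r) \<le> a / real m" using a m0 r by (intro divide_left_mono) auto
        then have le: "a / real (m * r) \<le> b" using mb by linarith
        have "square_additive (a / real (m * r))"
          by (rule square_additive_if_coupled[OF T A emA a B AB c]) (use near m0 r le emB in \<open>auto intro: ennreal_leI\<close>)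
        then show "square_additive (a0 / real r)" by (simp add: a0_def)
      qed
    qed
    then show False using np by simp
  qed
qed

text \<open>The parallelogram law of L_2 is transported back by the isometry. For disjoint
  \<open>f\<close> and \<open>g\<close> the moduli of \<open>f + g\<close> and \<open>f - g\<close>
  coincide, so the law becomes Pythagoras, which gives \<open>square_additive\<close> for every
  \<delta>.\<close>

lemma proportional_of_isometric:
  assumes iso: "isometric_isomorphism M E N M' E' N' Q" and p': "proportional_to_L2 M' E' N'"
    and pos: "emeasure M (space M) > 0"
  shows "proportional_to_L2 M E N"
proof -
  have lin: "linear_map M E M' E' Q" and isoN: "\<And>f. f \<in> E \<Longrightarrow> N' (Q f) = N f"
    using iso by (auto simp: isometric_isomorphism_def)
  obtain k where k: "k > 0" "\<And>f. f \<in> E' \<Longrightarrow> f \<in> L2_space M' \<and> N' f = k * L2_norm M' f"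
    using p' unfolding proportional_to_L2_def by blast
  have Nsq: "(N f)\<^sup>2 = k\<^sup>2 * (\<integral>t. (cmod (Q f t))\<^sup>2 \<partial>M')" and Qi: "integrable M' (\<lambda>t. (cmod (Q f t))\<^sup>2)"
    and Qm: "Q f \<in> borel_measurable M'" if "f \<in> E" for f
  proof -
    have QE: "Q f \<in> E'" by (rule linear_map_in[OF lin that])
    show "integrable M' (\<lambda>t. (cmod (Q f t))\<^sup>2)" "Q f \<in> borel_measurable M'" using k(2)[OF QE] by (auto simp: L2_space_def)
    have "N f = k * L2_norm M' (Q f)" using isoN[OF that] k(2)[OF QE] by simp
    then show "(N f)\<^sup>2 = k\<^sup>2 * (\<integral>t. (cmod (Q f t))\<^sup>2 \<partial>M')"
      by (simp add: L2_norm_def power_mult_distrib Bochner_Integration.integral_nonneg)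
  qed
  have par: "(N (\<lambda>t. f t + g t))\<^sup>2 = (N f)\<^sup>2 + (N g)\<^sup>2" if fg: "f \<in> E" "g \<in> E" and d: "\<And>t. f t = 0 \<or> g t = 0" for f g
  proof -
    have s: "(\<lambda>t. f t + g t) \<in> E" "(\<lambda>t. f t - g t) \<in> E" using fg add diff_in by auto
    have "N (\<lambda>t. f t - g t) = N (\<lambda>t. f t + g t)"
    proof (rule norm_cong_cmod[OF s(2,1)], rule AE_I2)
      fix t show "cmod (f t - g t) = cmod (f t + g t)" using d[of t] by auto
    qed
    then have "2 * (N (\<lambda>t. f t + g t))\<^sup>2 = (N (\<lambda>t. f t + g t))\<^sup>2 + (N (\<lambda>t. f t - g t))\<^sup>2" by simp
    also have "\<dots> = k\<^sup>2 * ((\<integral>t. (cmod (Q (\<lambda>t. f t + g t) t))\<^sup>2 \<partial>M') + (\<integral>t. (cmod (Q (\<lambda>t. f t - g t) t))\<^sup>2 \<partial>M'))"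
      unfolding Nsq[OF s(1)] Nsq[OF s(2)] by (simp only: distrib_left)
    also have "(\<integral>t. (cmod (Q (\<lambda>t. f t + g t) t))\<^sup>2 \<partial>M') + (\<integral>t. (cmod (Q (\<lambda>t. f t - g t) t))\<^sup>2 \<partial>M')
      = (\<integral>t. (cmod (Q (\<lambda>t. f t + g t) t))\<^sup>2 + (cmod (Q (\<lambda>t. f t - g t) t))\<^sup>2 \<partial>M')"
      by (rule Bochner_Integration.integral_add[OF Qi[OF s(1)] Qi[OF s(2)], symmetric])
    also have "\<dots> = (\<integral>t. 2 * (cmod (Q f t))\<^sup>2 + 2 * (cmod (Q g t))\<^sup>2 \<partial>M')"
    proof (rule integral_cong_AE)
      have [measurable]: "Q f \<in> borel_measurable M'" "Q g \<in> borel_measurable M'" "Q (\<lambda>t. f t + g t) \<in> borel_measurable M'"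
        "Q (\<lambda>t. f t - g t) \<in> borel_measurable M'" using Qm fg s by auto
      show "(\<lambda>t. (cmod (Q (\<lambda>t. f t + g t) t))\<^sup>2 + (cmod (Q (\<lambda>t. f t - g t) t))\<^sup>2) \<in> borel_measurable M'"
        "(\<lambda>t. 2 * (cmod (Q f t))\<^sup>2 + 2 * (cmod (Q g t))\<^sup>2) \<in> borel_measurable M'" by measurable
      show "AE t in M'. (cmod (Q (\<lambda>t. f t + g t) t))\<^sup>2 + (cmod (Q (\<lambda>t. f t - g t) t))\<^sup>2 = 2 * (cmod (Q f t))\<^sup>2 + 2 * (cmod (Q g t))\<^sup>2"
        using linear_map_add[OF lin fg] linear_map_diff[OF lin fg]
      proof eventually_elim
        case (elim t)
        show ?case unfolding elim
          by (simp only: cmod_power2) (simp add: power2_eq_square algebra_simps)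
      qed
    qed
    also have "\<dots> = 2 * (\<integral>t. (cmod (Q f t))\<^sup>2 \<partial>M') + 2 * (\<integral>t. (cmod (Q g t))\<^sup>2 \<partial>M')"
      using Qi[OF fg(1)] Qi[OF fg(2)] by simp
    also have "k\<^sup>2 * \<dots> = 2 * ((N f)\<^sup>2 + (N g)\<^sup>2)"
      unfolding Nsq[OF fg(1)] Nsq[OF fg(2)] by (simp add: algebra_simps)
    finally show ?thesis by simp
  qed
  have sq: "square_additive \<delta>" for \<delta>
    unfolding square_additive_def
  proof (intro allI impI, elim conjE)
    fix n C c assume fam: "finite_family n C"
    have "(N (\<lambda>t. \<Sum>i<l. c i * indicator (C i) t))\<^sup>2 = (\<Sum>i<l. (cmod (c i))\<^sup>2 * (N (indicator (C i)))\<^sup>2)" if "l \<le> n" for l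
      using that
    proof (induction l)
      case 0
      then show ?case using norm_zero by simp
    next
      case (Suc l)
      have l: "l < n" using Suc.prems by simp
      have faml: "finite_family l C" using fam l unfolding finite_family_def disjoint_family_on_def by auto
      have iE: "indicator (C l) \<in> E" using fam l indicator_in by (auto simp: finite_family_def)
      have dj: "(\<Sum>i<l. c i * indicator (C i) t) = 0 \<or> c l * indicator (C l) t = 0" for t
      proof (cases "t \<in> C l")
        case True
        have "t \<notin> C i" if "i < l" for i
        proof -
          have "C i \<inter> C l = {}" using fam that l unfolding finite_family_def disjoint_family_on_def by simp
          then show ?thesis using True by blast
        qed
        then show ?thesis by (intro disjI1 step_off)
      qed auto
      have "(N (\<lambda>t. \<Sum>i<Suc l. c i * indicator (C i) t))\<^sup>2 = (N (\<lambda>t. \<Sum>i<l. c i * indicator (C i) t))\<^sup>2 + (N (\<lambda>t. c l * indicator (C l) t))\<^sup>2"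
        unfolding sum.lessThan_Suc by (rule par[OF family_step_in[OF faml] scale[OF iE] dj])
      also have "(N (\<lambda>t. c l * indicator (C l) t))\<^sup>2 = (cmod (c l))\<^sup>2 * (N (indicator (C l)))\<^sup>2"
        using norm_scale[OF iE] by (simp add: power_mult_distrib)
      finally show ?case using Suc by simp
    qed
    then show "(N (\<lambda>t. \<Sum>i<n. c i * indicator (C i) t))\<^sup>2 = (\<Sum>i<n. (cmod (c i))\<^sup>2 * (N (indicator (C i)))\<^sup>2)" by blast
  qed
  obtain X where X: "X \<in> sets M" "emeasure M X > 0" "emeasure M X < \<infinity>"
    by (rule finite_positive_subset[OF sets.top pos])
  have em: "emeasure M X = ennreal (measure M X)" using X by (intro emeasure_eq_ennreal_measure) auto
  have "measure M X > 0" using X em by (cases "measure M X > 0") (auto simp: ennreal_neg)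
  then show ?thesis by (rule proportional_if_square_additive[OF _ X(1) em sq])
qed

end

section \<open>Set and point maps induced by an isometry\<close>

text \<open>The inverse is part of the data, so that \<open>swap\<close> yields every fact for the
  inverse isometry as well.\<close>

locale isometric_pair = E: ideal_function_space M E N + E': ideal_function_space M' E' N'
  for M :: "'a measure" and E N and M' :: "'b measure" and E' N' +
  fixes Q Qi
  assumes iso: "isometric_isomorphism M E N M' E' N' Q"
    and iso_inv: "isometric_isomorphism M' E' N' M E N Qi"
    and Q_Qi: "g \<in> E' \<Longrightarrow> AE t in M'. Q (Qi g) t = g t"
    and Qi_Q: "f \<in> E \<Longrightarrow> AE t in M. Qi (Q f) t = f t"
begin

lemma swap: "isometric_pair M' E' N' M E N Qi Q"
  using iso iso_inv Q_Qi Qi_Q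
  by (intro isometric_pair.intro isometric_pair_axioms.intro E.ideal_function_space_axioms E'.ideal_function_space_axioms) auto

lemma lin: "linear_map M E M' E' Q" and norm_Q: "f \<in> E \<Longrightarrow> N' (Q f) = N f"
  using iso by (auto simp: isometric_isomorphism_def)

lemma lin_inv: "linear_map M' E' M E Qi" and norm_Qi: "g \<in> E' \<Longrightarrow> N (Qi g) = N' g"
  using iso_inv by (auto simp: isometric_isomorphism_def)

lemma Q_in: "f \<in> E \<Longrightarrow> Q f \<in> E'" and Qi_in: "g \<in> E' \<Longrightarrow> Qi g \<in> E"
  using linear_map_in[OF lin] linear_map_in[OF lin_inv] by auto

lemma hermitian_conjugate:
  assumes A: "A \<in> sets M"
  shows "E'.hermitian (\<lambda>g. Q (rho A (Qi g))) (1 / 2)"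
  unfolding E'.hermitian_def
proof (intro conjI allI ballI)
  have rin: "rho A (Qi g) \<in> E" if "g \<in> E'" for g using E.rho_in[OF A Qi_in[OF that]] .
  show "linear_map M' E' M' E' (\<lambda>g. Q (rho A (Qi g)))"
    unfolding linear_map_def
  proof (intro conjI ballI allI impI)
    show "Q (rho A (Qi f)) \<in> E'" if "f \<in> E'" for f using Q_in[OF rin[OF that]] .
    show "AE t in M'. Q (rho A (Qi f)) t = Q (rho A (Qi g)) t" if "f \<in> E'" "g \<in> E'" "AE t in M'. f t = g t" for f g
    proof (rule linear_map_cong[OF lin rin[OF that(1)] rin[OF that(2)]])
      show "AE t in M. rho A (Qi f) t = rho A (Qi g) t"
        using linear_map_cong[OF lin_inv that] by eventually_elim (simp add: rho_apply)
    qed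
    show "AE t in M'. Q (rho A (Qi (\<lambda>s. f s + g s))) t = Q (rho A (Qi f)) t + Q (rho A (Qi g)) t" if "f \<in> E'" "g \<in> E'" for f g
    proof -
      have "AE t in M. rho A (Qi (\<lambda>s. f s + g s)) t = rho A (Qi f) t + rho A (Qi g) t"
        using linear_map_add[OF lin_inv that] by eventually_elim (simp add: rho_apply)
      then have "AE t in M'. Q (rho A (Qi (\<lambda>s. f s + g s))) t = Q (\<lambda>t. rho A (Qi f) t + rho A (Qi g) t) t"
        by (rule linear_map_cong[OF lin rin[OF E'.add[OF that]] E.add[OF rin[OF that(1)] rin[OF that(2)]]])
      then show ?thesis using linear_map_add[OF lin rin[OF that(1)] rin[OF that(2)]] by eventually_elim simp
    qed
    show "AE t in M'. Q (rho A (Qi (\<lambda>s. c * f s))) t = c * Q (rho A (Qi f)) t" if "f \<in> E'" for c f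
    proof -
      have "AE t in M. rho A (Qi (\<lambda>s. c * f s)) t = c * rho A (Qi f) t"
        using linear_map_scale[OF lin_inv that, of c] by eventually_elim (simp add: rho_apply)
      then have "AE t in M'. Q (rho A (Qi (\<lambda>s. c * f s))) t = Q (\<lambda>t. c * rho A (Qi f) t) t"
        by (rule linear_map_cong[OF lin rin[OF E'.scale[OF that]] E.scale[OF rin[OF that]]])
      then show ?thesis using linear_map_scale[OF lin rin[OF that], of c] by eventually_elim simp
    qed
  qed
  fix s :: real and g assume g: "g \<in> E'"
  let ?f = "Qi g"
  have fE: "?f \<in> E" by (rule Qi_in[OF g])
  let ?h = "\<lambda>t. ?f t + \<i> * complex_of_real s * rho A ?f t"
  have hE: "?h \<in> E" by (intro E.add fE E.scale rin g)
  have yE: "(\<lambda>t. g t + \<i> * complex_of_real s * Q (rho A ?f) t) \<in> E'"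
    by (intro E'.add g E'.scale Q_in rin)
  \<comment> \<open>The perturbed element is \<open>Q\<close> applied to
    \<open>(1 + i s \<chi>) (Qi g)\<close> with \<chi> the indicator of \<open>A\<close>, so both
    isometries drop out and a pointwise estimate remains.\<close>
  have "AE t in M'. g t + \<i> * complex_of_real s * Q (rho A ?f) t = Q ?h t"
    using Q_Qi[OF g] linear_map_add[OF lin fE E.scale[OF rin[OF g]], of "\<i> * complex_of_real s"]
      linear_map_scale[OF lin rin[OF g], of "\<i> * complex_of_real s"]
    by eventually_elim simp
  then have "N' (\<lambda>t. g t + \<i> * complex_of_real s * Q (rho A ?f) t) = N' (Q ?h)"
    by (rule E'.norm_cong[OF yE Q_in[OF hE]])
  also have "\<dots> = N ?h" by (rule norm_Q[OF hE])
  also have "\<dots> \<le> (1 + 1 / 2 * s\<^sup>2) * N ?f"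
  proof (rule E.bounded_dominated(2)[OF fE E.meas[OF hE]])
    show "0 \<le> 1 + 1 / 2 * s\<^sup>2" by simp
    have c: "cmod (1 + \<i> * complex_of_real s) \<le> 1 + 1 / 2 * s\<^sup>2"
    proof -
      have "(cmod (1 + \<i> * complex_of_real s))\<^sup>2 = 1 + s\<^sup>2" by (simp add: cmod_power2)
      also have "\<dots> \<le> 1 + s\<^sup>2 + (s\<^sup>2 / 2)\<^sup>2" by simp
      also have "\<dots> = (1 + 1 / 2 * s\<^sup>2)\<^sup>2" by (simp add: power2_sum)
      finally show ?thesis by (rule power2_le_imp_le) simp
    qed
    show "AE t in M. cmod (?h t) \<le> (1 + 1 / 2 * s\<^sup>2) * cmod (?f t)"
    proof (rule AE_I2)
      fix t
      show "cmod (?h t) \<le> (1 + 1 / 2 * s\<^sup>2) * cmod (?f t)"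
      proof (cases "t \<in> A")
        case True
        then have "cmod (?h t) = cmod (1 + \<i> * complex_of_real s) * cmod (?f t)"
          by (simp add: rho_apply norm_mult[symmetric] algebra_simps)
        then show ?thesis using c by (simp add: mult_right_mono)
      next
        case False
        have "1 * cmod (?f t) \<le> (1 + 1 / 2 * s\<^sup>2) * cmod (?f t)" by (intro mult_right_mono) auto
        then show ?thesis using False by (simp add: rho_apply)
      qed
    qed
  qed
  also have "N ?f = N' g" by (rule norm_Qi[OF g])
  finally show "N' (\<lambda>t. g t + \<i> * complex_of_real s * Q (rho A ?f) t) \<le> (1 + 1 / 2 * s\<^sup>2) * N' g" .
qed simp

text \<open>The conjugated cut-off \<open>R\<close> is local, so \<open>weighted_composition\<close>
  with the identity as point map makes it multiplication by a function \<open>e\<close>. Since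
  \<open>R\<close> is idempotent, testing on a positive \<open>w\<close> gives \<open>e = 0\<close>
  or \<open>e = 1\<close> a.e., and \<open>B\<close> is the set where \<open>e = 1\<close>.\<close>

lemma set_map_exists:
  assumes loc: "\<And>T C. E'.hermitian T C \<Longrightarrow> E'.local_map T" and A: "A \<in> sets M"
  shows "\<exists>B\<in>sets M'. \<forall>f\<in>E. AE t in M'. Q (rho A f) t = rho B (Q f) t"
proof -
  define R where "R g = Q (rho A (Qi g))" for g
  have H: "E'.hermitian R (1 / 2)" unfolding R_def by (rule hermitian_conjugate[OF A])
  have linR: "linear_map M' E' M' E' R" using H by (simp add: E'.hermitian_def)
  have locR: "E'.local_map R" by (rule loc[OF H])
  have RN: "N' (R g) \<le> 1 * N' g" if g: "g \<in> E'" for g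
  proof -
    have "N' (R g) = N (rho A (Qi g))" unfolding R_def by (rule norm_Q[OF E.rho_in[OF A Qi_in[OF g]]])
    also have "\<dots> \<le> N (Qi g)" by (rule E.norm_rho_le[OF A Qi_in[OF g]])
    finally show ?thesis using norm_Qi[OF g] by simp
  qed
  have comm: "AE t in M'. R (rho S f) t = indicator S t * R f t" if "S \<in> sets M'" "f \<in> E'" for S f
    using E'.local_map_commutes[OF linR locR that] by (simp add: rho_def)
  have "\<exists>e\<in>borel_measurable M'. \<forall>f\<in>E'. AE t in M'. R f t = e t * f t"
    by (rule weighted_composition[OF E'.ideal_function_space_axioms E'.ideal_function_space_axioms linR RN zero_le_one measurable_ident[unfolded id_def] comm])
  then obtain e where e: "e \<in> borel_measurable M'" and e_all: "\<forall>f\<in>E'. AE t in M'. R f t = e t * f t"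
    by (elim bexE) (rule that)
  have eR: "AE t in M'. R f t = e t * f t" if "f \<in> E'" for f using e_all that by (rule bspec)
  have RR: "AE t in M'. R (R g) t = R g t" if g: "g \<in> E'" for g
  proof -
    have r: "rho A (Qi g) \<in> E" by (rule E.rho_in[OF A Qi_in[OF g]])
    have "AE t in M. rho A (Qi (R g)) t = rho A (Qi g) t"
      unfolding R_def using Qi_Q[OF r] by eventually_elim (simp add: rho_apply)
    then show ?thesis unfolding R_def
      by (rule linear_map_cong[OF lin E.rho_in[OF A Qi_in[OF Q_in[OF r]]] r, folded R_def, unfolded R_def])
  qed
  obtain w where w: "w \<in> E'" "\<forall>t\<in>space M'. \<exists>r>0. w t = complex_of_real r" using E'.pos_element by blast
  have e01: "AE t in M'. e t = 0 \<or> e t = 1"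
    using RR[OF w(1)] eR[OF w(1)] eR[OF linear_map_in[OF linR w(1)]] AE_space
  proof eventually_elim
    case (elim t)
    then have "w t \<noteq> 0" using w(2) by fastforce
    moreover have "e t * (e t * w t) = e t * w t" using elim by simp
    ultimately show ?case by auto
  qed
  define B where "B = {t \<in> space M'. e t = 1}"
  have Bm: "B \<in> sets M'" unfolding B_def using e by measurable
  have "AE t in M'. Q (rho A f) t = rho B (Q f) t" if f: "f \<in> E" for f
  proof -
    have "AE t in M. rho A (Qi (Q f)) t = rho A f t" using Qi_Q[OF f] by eventually_elim (simp add: rho_apply)
    then have "AE t in M'. R (Q f) t = Q (rho A f) t"
      unfolding R_def by (rule linear_map_cong[OF lin E.rho_in[OF A Qi_in[OF Q_in[OF f]]] E.rho_in[OF A f]])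
    then show ?thesis using eR[OF Q_in[OF f]] e01 AE_space
      by eventually_elim (auto simp: rho_apply B_def)
  qed
  then show ?thesis using Bm by blast
qed

section \<open>Boolean properties of the set map\<close>

context
  fixes \<Phi>
  assumes \<Phi>m: "\<And>A. A \<in> sets M \<Longrightarrow> \<Phi> A \<in> sets M'"
    and \<Phi>: "\<And>A f. A \<in> sets M \<Longrightarrow> f \<in> E \<Longrightarrow> AE t in M'. Q (rho A f) t = rho (\<Phi> A) (Q f) t"
begin

text \<open>A function whose image vanishes nowhere: two sets are equal a.e. as soon as they cut
  this image in the same way, so relations between sets can be read off from
  \<open>Q\<close>.\<close>

lemma weight_exists:
  obtains f where "f \<in> E" "AE t in M'. Q f t \<noteq> 0"
proof -
  obtain w where w: "w \<in> E'" "\<forall>t\<in>space M'. \<exists>r>0. w t = complex_of_real r" using E'.pos_element by blast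
  have "AE t in M'. Q (Qi w) t \<noteq> 0"
    using Q_Qi[OF w(1)] AE_space by eventually_elim (use w(2) in fastforce)
  then show ?thesis using that Qi_in[OF w(1)] by blast
qed

lemma set_map_inter:
  assumes A: "A \<in> sets M" "B \<in> sets M"
  shows "AE t in M'. t \<in> \<Phi> (A \<inter> B) \<longleftrightarrow> t \<in> \<Phi> A \<and> t \<in> \<Phi> B"
proof -
  obtain f where f: "f \<in> E" "AE t in M'. Q f t \<noteq> 0" by (rule weight_exists)
  have AB: "A \<inter> B \<in> sets M" using A by auto
  show ?thesis
    using \<Phi>[OF AB f(1)] \<Phi>[OF A(1) E.rho_in[OF A(2) f(1)]] \<Phi>[OF A(2) f(1)] f(2)
    by eventually_elim (auto simp: rho_rho rho_apply split: if_splits)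
qed

lemma set_map_mono:
  assumes "A \<in> sets M" "B \<in> sets M" "A \<subseteq> B"
  shows "AE t in M'. t \<in> \<Phi> A \<longrightarrow> t \<in> \<Phi> B"
  using set_map_inter[OF assms(1,2)] assms(3) by (auto simp: Int_absorb2 elim: eventually_mono)

lemma set_map_null:
  assumes A: "A \<in> null_sets M"
  shows "AE t in M'. t \<notin> \<Phi> A"
proof -
  obtain f where f: "f \<in> E" "AE t in M'. Q f t \<noteq> 0" by (rule weight_exists)
  have Am: "A \<in> sets M" using A by auto
  have "AE t in M. rho A f t = 0 * f t" using AE_not_in[OF A] by eventually_elim (simp add: rho_apply)
  then have "AE t in M'. Q (rho A f) t = Q (\<lambda>t. 0 * f t) t"
    by (rule linear_map_cong[OF lin E.rho_in[OF Am f(1)] E.scale[OF f(1)]])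
  then show ?thesis using linear_map_scale[OF lin f(1), of 0] \<Phi>[OF Am f(1)] f(2)
    by eventually_elim (auto simp: rho_apply)
qed

lemma set_map_space: "AE t in M'. t \<in> \<Phi> (space M)"
proof -
  obtain f where f: "f \<in> E" "AE t in M'. Q f t \<noteq> 0" by (rule weight_exists)
  have "AE t in M. rho (space M) f t = f t" by (auto simp: rho_apply)
  then have "AE t in M'. Q (rho (space M) f) t = Q f t"
    by (rule linear_map_cong[OF lin E.rho_in[OF sets.top f(1)] f(1)])
  then show ?thesis using \<Phi>[OF sets.top f(1)] f(2)
    by eventually_elim (auto simp: rho_apply split: if_splits)
qed

lemma set_map_compl:
  assumes A: "A \<in> sets M"
  shows "AE t in M'. t \<in> \<Phi> (space M - A) \<longleftrightarrow> t \<notin> \<Phi> A"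
proof -
  obtain f where f: "f \<in> E" "AE t in M'. Q f t \<noteq> 0" by (rule weight_exists)
  have Ac: "space M - A \<in> sets M" using A by auto
  have r: "rho A f \<in> E" "rho (space M - A) f \<in> E" using E.rho_in A Ac f by auto
  have "AE t in M. rho A f t + rho (space M - A) f t = f t" by (auto simp: rho_apply)
  then have "AE t in M'. Q (\<lambda>t. rho A f t + rho (space M - A) f t) t = Q f t"
    by (rule linear_map_cong[OF lin E.add[OF r] f(1)])
  then show ?thesis using linear_map_add[OF lin r] \<Phi>[OF A f(1)] \<Phi>[OF Ac f(1)] f(2)
    by eventually_elim (auto simp: rho_apply split: if_splits)
qed

text \<open>Let \<open>f\<close> be the preimage of a function living exactly on the excess
  \<open>D\<close> of \<open>\<Phi> (\<Union>n. A n)\<close> over the union of the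
  \<open>\<Phi> (A n)\<close>. Each \<open>rho (A n) f\<close> has image 0, hence is 0 because
  \<open>Q\<close> is isometric; so \<open>f\<close> vanishes on the whole union, and its image
  vanishes on \<open>D\<close>. No continuity of the norm along increasing sets is used.\<close>

lemma set_map_UN:
  fixes A :: "nat \<Rightarrow> 'a set"
  assumes A: "\<And>n. A n \<in> sets M"
  shows "AE t in M'. t \<in> \<Phi> (\<Union>n. A n) \<longleftrightarrow> (\<exists>n. t \<in> \<Phi> (A n))"
proof -
  have U: "(\<Union>n. A n) \<in> sets M" using A by auto
  have "AE t in M'. \<forall>n. t \<in> \<Phi> (A n) \<longrightarrow> t \<in> \<Phi> (\<Union>n. A n)"
    by (subst AE_all_countable) (auto intro!: set_map_mono A U)
  moreover have "AE t in M'. t \<in> \<Phi> (\<Union>n. A n) \<longrightarrow> (\<exists>n. t \<in> \<Phi> (A n))"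
  proof -
    define D where "D = \<Phi> (\<Union>n. A n) - (\<Union>n. \<Phi> (A n))"
    have Dm: "D \<in> sets M'" unfolding D_def using \<Phi>m[OF U] \<Phi>m[OF A] by auto
    obtain w where w: "w \<in> E'" "\<forall>t\<in>space M'. \<exists>r>0. w t = complex_of_real r" using E'.pos_element by blast
    define g where "g = rho D w"
    have gE: "g \<in> E'" unfolding g_def by (rule E'.rho_in[OF Dm w(1)])
    define f where "f = Qi g"
    have fE: "f \<in> E" unfolding f_def by (rule Qi_in[OF gE])
    have Qf: "AE t in M'. Q f t = g t" unfolding f_def by (rule Q_Qi[OF gE])
    have zero: "AE t in M. rho (A n) f t = 0" for n
    proof -
      have rE: "rho (A n) f \<in> E" by (rule E.rho_in[OF A fE])
      have "AE t in M'. Q (rho (A n) f) t = 0"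
        using \<Phi>[OF A fE, of n] Qf by eventually_elim (auto simp: rho_apply g_def D_def)
      then have "N' (Q (rho (A n) f)) = 0" using E'.norm_eq_0[OF Q_in[OF rE]] by simp
      then have "N (rho (A n) f) = 0" using norm_Q[OF rE] by simp
      then show ?thesis using E.norm_eq_0[OF rE] by simp
    qed
    have "AE t in M. \<forall>n. rho (A n) f t = 0" using zero by (subst AE_all_countable) auto
    then have "AE t in M. rho (\<Union>n. A n) f t = 0 * f t"
    proof eventually_elim
      case (elim t)
      show ?case
      proof (cases "t \<in> (\<Union>n. A n)")
        case True
        then obtain n where "t \<in> A n" by (rule UN_E)
        then show ?thesis using elim[rule_format, of n] by (simp add: rho_apply)
      qed (simp add: rho_apply)
    qed
    then have "AE t in M'. Q (rho (\<Union>n. A n) f) t = Q (\<lambda>t. 0 * f t) t"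
      by (rule linear_map_cong[OF lin E.rho_in[OF U fE] E.scale[OF fE]])
    then have "AE t in M'. t \<notin> D"
      using linear_map_scale[OF lin fE, of 0] \<Phi>[OF U fE] Qf AE_space
    proof eventually_elim
      case (elim t)
      then have "rho (\<Phi> (\<Union>n. A n)) g t = 0" by (simp add: rho_apply split: if_splits)
      moreover have "w t \<noteq> 0" using elim w(2) by fastforce
      ultimately show ?case by (auto simp: g_def rho_apply D_def split: if_splits)
    qed
    then show ?thesis by eventually_elim (auto simp: D_def)
  qed
  ultimately show ?thesis by eventually_elim blast
qed

end


text \<open>The preimage \<open>B\<close> of \<open>A\<close> under \<phi> is
  \<open>\<Phi> A\<close> up to a null set, so cutting \<open>Q w\<close> to \<open>B\<close> gives
  \<open>Q (rho A w)\<close>. Applying \<open>Qi\<close> returns \<open>rho A w\<close>, and since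
  \<open>w\<close> vanishes nowhere, \<open>\<Psi> B\<close> is \<open>A\<close>.\<close>

lemma pointwise_inverse:
  assumes \<Phi>m: "\<And>A. A \<in> sets M \<Longrightarrow> \<Phi> A \<in> sets M'"
    and \<Phi>: "\<And>A f. A \<in> sets M \<Longrightarrow> f \<in> E \<Longrightarrow> AE t in M'. Q (rho A f) t = rho (\<Phi> A) (Q f) t"
    and \<Psi>: "\<And>B g. B \<in> sets M' \<Longrightarrow> g \<in> E' \<Longrightarrow> AE s in M. Qi (rho B g) s = rho (\<Psi> B) (Qi g) s"
    and \<phi>: "\<phi> \<in> measurable M' M" "\<And>A. A \<in> sets M \<Longrightarrow> AE t in M'. \<phi> t \<in> A \<longleftrightarrow> t \<in> \<Phi> A"
    and \<psi>: "\<psi> \<in> measurable M M'" "\<And>B. B \<in> sets M' \<Longrightarrow> AE s in M. \<psi> s \<in> B \<longleftrightarrow> s \<in> \<Psi> B"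
    and A: "A \<in> sets M"
  shows "AE s in M. \<phi> (\<psi> s) \<in> A \<longleftrightarrow> s \<in> A"
proof -
  obtain w where w: "w \<in> E" "\<forall>t\<in>space M. \<exists>r>0. w t = complex_of_real r" using E.pos_element by blast
  define B where "B = \<phi> -` A \<inter> space M'"
  have Bm: "B \<in> sets M'" unfolding B_def using \<phi>(1) A by (rule measurable_sets)
  have rE: "rho A w \<in> E" by (rule E.rho_in[OF A w(1)])
  have "AE t in M'. rho B (Q w) t = Q (rho A w) t"
    using \<phi>(2)[OF A] \<Phi>[OF A w(1)] AE_space by eventually_elim (auto simp: rho_apply B_def)
  then have "AE s in M. Qi (rho B (Q w)) s = Qi (Q (rho A w)) s"
    by (rule linear_map_cong[OF lin_inv E'.rho_in[OF Bm Q_in[OF w(1)]] Q_in[OF rE]])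
  then have "AE s in M. s \<in> \<Psi> B \<longleftrightarrow> s \<in> A"
    using \<Psi>[OF Bm Q_in[OF w(1)]] Qi_Q[OF w(1)] Qi_Q[OF rE] AE_space
  proof eventually_elim
    case (elim s)
    have "w s \<noteq> 0" using elim w(2) by fastforce
    moreover have "rho (\<Psi> B) (Qi (Q w)) s = rho (\<Psi> B) w s" by (simp add: rho_apply elim(3))
    ultimately show ?case using elim by (auto simp: rho_apply split: if_splits)
  qed
  then show ?thesis using \<psi>(2)[OF Bm] AE_space
    by eventually_elim (use measurable_space[OF \<psi>(1)] in \<open>auto simp: B_def\<close>)
qed

end

text \<open>A real function is determined by its sublevel sets: the value at \<open>t\<close> is the
  infimum of the rationals \<open>r\<close> for which \<open>t\<close> lies in the image of
  \<open>{..r}\<close>. Agreement with \<open>\<Phi>\<close> spreads from half-lines to Borel sets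
  because \<open>\<Phi>\<close> respects complements and countable unions a.e., and then to Lebesgue
  sets by completeness of \<open>M'\<close>.\<close>

lemma point_map_exists:
  fixes \<Omega> :: "real set"
  assumes pair: "isometric_pair (lebesgue_on \<Omega>) E N M' E' N' Q Qi"
    and M: "M = lebesgue_on \<Omega>" and \<Omega>: "\<Omega> \<in> sets borel" "0 \<in> \<Omega>"
    and cM': "complete_measure M'"
    and \<Phi>m: "\<And>A. A \<in> sets M \<Longrightarrow> \<Phi> A \<in> sets M'"
    and \<Phi>: "\<And>A f. A \<in> sets M \<Longrightarrow> f \<in> E \<Longrightarrow> AE t in M'. Q (rho A f) t = rho (\<Phi> A) (Q f) t"
  shows "\<exists>\<phi>. nonsingular M' M \<phi> \<and> (\<forall>A\<in>sets M. AE t in M'. \<phi> t \<in> A \<longleftrightarrow> t \<in> \<Phi> A)"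
proof -
  interpret isometric_pair M E N M' E' N' Q Qi using pair by (simp add: M)
  have inter: "AE t in M'. t \<in> \<Phi> (A \<inter> B) \<longleftrightarrow> t \<in> \<Phi> A \<and> t \<in> \<Phi> B" if "A \<in> sets M" "B \<in> sets M" for A B
    by (rule set_map_inter[where \<Phi> = \<Phi>, OF \<Phi>m \<Phi> that])
  have mono: "AE t in M'. t \<in> \<Phi> A \<longrightarrow> t \<in> \<Phi> B" if "A \<in> sets M" "B \<in> sets M" "A \<subseteq> B" for A B
    by (rule set_map_mono[where \<Phi> = \<Phi>, OF \<Phi>m \<Phi> that])
  have null: "AE t in M'. t \<notin> \<Phi> A" if "A \<in> null_sets M" for A
    by (rule set_map_null[where \<Phi> = \<Phi>, OF \<Phi>m \<Phi> that])
  have top: "AE t in M'. t \<in> \<Phi> (space M)"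
    by (rule set_map_space[where \<Phi> = \<Phi>, OF \<Phi>m \<Phi>])
  have compl: "AE t in M'. t \<in> \<Phi> (space M - A) \<longleftrightarrow> t \<notin> \<Phi> A" if "A \<in> sets M" for A
    by (rule set_map_compl[where \<Phi> = \<Phi>, OF \<Phi>m \<Phi> that])
  have UN: "AE t in M'. t \<in> \<Phi> (\<Union>n. A n) \<longleftrightarrow> (\<exists>n. t \<in> \<Phi> (A n))" if "\<And>n. A n \<in> sets M" for A :: "nat \<Rightarrow> real set"
    by (rule set_map_UN[where \<Phi> = \<Phi>, OF \<Phi>m \<Phi> that])
  have sp: "space M = \<Omega>" by (simp add: M)
  have \<Omega>l: "\<Omega> \<in> sets lebesgue" using \<Omega>(1) by (intro sets_completionI_sets) simp
  have setsM: "A \<in> sets M \<longleftrightarrow> A \<in> sets lebesgue \<and> A \<subseteq> \<Omega>" for A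
    unfolding M using \<Omega>l by (auto simp: sets_restrict_space_iff)
  have bor: "A \<inter> \<Omega> \<in> sets M" if "A \<in> sets borel" for A
  proof -
    have "A \<in> sets lebesgue" using that by (intro sets_completionI_sets) simp
    then show ?thesis unfolding setsM using \<Omega>l by auto
  qed
  have "{} \<in> null_sets M" by (rule null_setsI) simp_all
  then have e0: "AE t in M'. t \<notin> \<Phi> {}" by (rule null)
  define r where "r n = real_of_rat (from_nat n)" for n :: nat
  have r_dense: "\<exists>n. x < r n \<and> r n < y" if lt: "x < y" for x y
  proof -
    obtain q where "x < of_rat q" "of_rat q < y" using of_rat_dense[OF lt] by blast
    moreover obtain n where "q = from_nat n" using surj_from_nat by (metis surjD)
    ultimately show ?thesis unfolding r_def by blast
  qed
  define I where "I n = {..r n} \<inter> \<Omega>" for n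
  have Im: "I n \<in> sets M" for n unfolding I_def by (rule bor) simp
  define S where "S n = \<Phi> (I n)" for n
  have Sm[measurable]: "S n \<in> sets M'" for n unfolding S_def by (rule \<Phi>m[OF Im])
  \<comment> \<open>The points where the countably many sets \<open>S n\<close> form a genuine
    Dedekind cut: monotone, nonempty and bounded below. Each condition holds a.e., so discarding the
    other points is harmless.\<close>
  define G where "G = {t \<in> space M'. (\<forall>m n. r m \<le> r n \<longrightarrow> t \<in> S m \<longrightarrow> t \<in> S n) \<and> (\<exists>n. t \<in> S n) \<and> (\<exists>n. t \<notin> S n)}"
  have Gm[measurable]: "G \<in> sets M'" unfolding G_def by measurable
  have G1: "AE t in M'. \<forall>m n. r m \<le> r n \<longrightarrow> t \<in> S m \<longrightarrow> t \<in> S n"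
  proof (subst AE_all_countable, intro allI, subst AE_all_countable, intro allI)
    fix m n
    show "AE t in M'. r m \<le> r n \<longrightarrow> t \<in> S m \<longrightarrow> t \<in> S n"
    proof (cases "r m \<le> r n")
      case True
      then have "I m \<subseteq> I n" by (auto simp: I_def)
      from mono[OF Im Im this] show ?thesis unfolding S_def by eventually_elim simp
    qed simp
  qed
  have G2: "AE t in M'. \<exists>n. t \<in> S n"
  proof -
    have "(\<Union>n. I n) = space M"
    proof (intro equalityI subsetI)
      fix x assume x: "x \<in> space M"
      obtain n where "x < r n" using r_dense[of x "x + 1"] by auto
      then show "x \<in> (\<Union>n. I n)" using x by (auto simp: I_def sp intro!: exI[of _ n])
    qed (auto simp: I_def sp)
    then show ?thesis using UN[of I, OF Im] top unfolding S_def by auto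
  qed
  have G3: "AE t in M'. \<exists>n. t \<notin> S n"
  proof -
    have Jm: "space M - I n \<in> sets M" for n using Im by auto
    have "(\<Union>n. space M - I n) = space M"
    proof (intro equalityI subsetI)
      fix x assume x: "x \<in> space M"
      obtain n where "r n < x" using r_dense[of "x - 1" x] by auto
      then show "x \<in> (\<Union>n. space M - I n)" using x by (auto simp: I_def intro!: exI[of _ n])
    qed auto
    then have "AE t in M'. \<exists>n. t \<in> \<Phi> (space M - I n)" using UN[of "\<lambda>n. space M - I n", OF Jm] top by auto
    moreover have "AE t in M'. \<forall>n. t \<in> \<Phi> (space M - I n) \<longleftrightarrow> t \<notin> S n"
      unfolding S_def by (subst AE_all_countable) (use compl[OF Im] in blast)
    ultimately show ?thesis by eventually_elim blast
  qed
  have GAE: "AE t in M'. t \<in> G" using G1 G2 G3 AE_space by eventually_elim (simp add: G_def)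
  define \<phi>0 where "\<phi>0 t = (if t \<in> G then Inf {r n |n. t \<in> S n} else 0)" for t
  \<comment> \<open>The infimum need not be attained, so only strict inequalities have an exact
    description; open half-lines are therefore used as generators below.\<close>
  have less: "\<phi>0 t < a \<longleftrightarrow> (\<exists>n. r n < a \<and> t \<in> S n)" if t: "t \<in> G" for t a
  proof -
    have ne: "{r n |n. t \<in> S n} \<noteq> {}" using t by (auto simp: G_def)
    obtain n0 where n0: "t \<notin> S n0" using t by (auto simp: G_def)
    have "r n0 \<le> x" if xin: "x \<in> {r n |n. t \<in> S n}" for x
    proof (rule ccontr)
      assume "\<not> r n0 \<le> x"
      moreover obtain n where "x = r n" "t \<in> S n" using xin by blast
      ultimately have "t \<in> S n0" using t unfolding G_def by (auto dest!: less_imp_le simp: not_le)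
      then show False using n0 by simp
    qed
    then have "bdd_below {r n |n. t \<in> S n}" by (rule bdd_belowI)
    then show ?thesis using cInf_less_iff[OF ne] t by (auto simp: \<phi>0_def)
  qed
  have \<phi>0m: "\<phi>0 \<in> borel_measurable M'"
    unfolding borel_measurable_iff_less
  proof
    fix a
    have "{t \<in> space M'. \<phi>0 t < a} = {t \<in> space M'. (t \<in> G \<and> (\<exists>n. r n < a \<and> t \<in> S n)) \<or> (t \<notin> G \<and> 0 < a)}"
      using less by (auto simp: \<phi>0_def)
    also have "\<dots> \<in> sets M'" by measurable
    finally show "{t \<in> space M'. \<phi>0 t < a} \<in> sets M'" .
  qed
  have P: "AE t in M'. \<phi>0 t \<in> A \<longleftrightarrow> t \<in> \<Phi> (A \<inter> \<Omega>)" if "A \<in> sets borel" for A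
  proof -
    have borel: "sets borel = sigma_sets UNIV (range (lessThan :: real \<Rightarrow> real set))"
      by (subst borel_Iio) (rule sets_measure_of, simp)
    have "A \<in> sigma_sets UNIV (range lessThan)" using that borel by simp
    then show ?thesis
    proof (induction rule: sigma_sets.induct)
      case (Basic A)
      then obtain a where a: "A = {..<a}" by blast
      define B where "B n = (if r n < a then I n else {})" for n
      have Bm: "B n \<in> sets M" for n using Im by (simp add: B_def)
      have "A \<inter> \<Omega> = (\<Union>n. B n)"
      proof (intro equalityI subsetI)
        fix x assume x: "x \<in> A \<inter> \<Omega>"
        then obtain n where "x < r n" "r n < a" using r_dense[of x a] a by auto
        then show "x \<in> (\<Union>n. B n)" using x by (auto simp: B_def I_def intro!: exI[of _ n])
      qed (auto simp: B_def I_def a split: if_splits)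
      then have "AE t in M'. t \<in> \<Phi> (A \<inter> \<Omega>) \<longleftrightarrow> (\<exists>n. t \<in> \<Phi> (B n))" using UN[of B, OF Bm] by simp
      then show ?case using e0 GAE
      proof eventually_elim
        case (elim t)
        have "(\<exists>n. t \<in> \<Phi> (B n)) \<longleftrightarrow> (\<exists>n. r n < a \<and> t \<in> S n)"
          using elim(2) by (auto simp: B_def S_def split: if_splits)
        then show ?case using elim less[OF elim(3), of a] by (simp add: a)
      qed
    next
      case Empty
      show ?case using e0 by simp
    next
      case (Compl A)
      have "A \<in> sets borel" unfolding borel by (rule Compl.hyps)
      then have AM: "A \<inter> \<Omega> \<in> sets M" by (rule bor)
      have eq: "(UNIV - A) \<inter> \<Omega> = space M - (A \<inter> \<Omega>)" by (auto simp: sp)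
      from compl[OF AM] Compl.IH show ?case unfolding eq by eventually_elim simp
    next
      case (Union A)
      have "A i \<in> sets borel" for i unfolding borel by (rule Union.hyps)
      then have Am: "A i \<inter> \<Omega> \<in> sets M" for i by (rule bor)
      have all: "AE t in M'. \<forall>i. \<phi>0 t \<in> A i \<longleftrightarrow> t \<in> \<Phi> (A i \<inter> \<Omega>)"
        using Union.IH by (subst AE_all_countable) blast
      have eq: "(\<Union>i. A i) \<inter> \<Omega> = (\<Union>i. A i \<inter> \<Omega>)" by blast
      from all UN[of "\<lambda>i. A i \<inter> \<Omega>", OF Am] show ?case unfolding eq by eventually_elim blast
    qed
  qed
  \<comment> \<open>Almost all values lie in \<Omega> already; sending the others to the point 0 of
    \<Omega> makes \<phi> map everywhere into the space of \<open>M\<close>.\<close>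
  define \<phi> where "\<phi> t = (if \<phi>0 t \<in> \<Omega> then \<phi>0 t else 0)" for t
  have \<phi>\<Omega>: "\<phi> t \<in> \<Omega>" for t using \<Omega>(2) by (simp add: \<phi>_def)
  have \<phi>b[measurable]: "\<phi> \<in> borel_measurable M'"
    unfolding \<phi>_def using \<phi>0m \<Omega>(1) by measurable
  have \<phi>0\<Omega>: "AE t in M'. \<phi>0 t \<in> \<Omega>" using P[OF \<Omega>(1)] top by eventually_elim (simp add: sp)
  have \<phi>P: "AE t in M'. \<phi> t \<in> A \<longleftrightarrow> t \<in> \<Phi> (A \<inter> \<Omega>)" if "A \<in> sets borel" for A
    using \<phi>0\<Omega> P[OF that] by eventually_elim (simp add: \<phi>_def)
  have pre: "\<phi> -` A \<inter> space M' \<in> sets M' \<and> (AE t in M'. \<phi> t \<in> A \<longleftrightarrow> t \<in> \<Phi> A)" if A: "A \<in> sets M" for A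
  proof -
    have "A \<in> sets (completion lborel)" "A \<subseteq> \<Omega>" using A setsM by auto
    \<comment> \<open>A Borel map may have non-measurable preimages of Lebesgue sets. Here the
      preimage of the Borel null set \<open>Z\<close> is null, because \<open>\<Phi>\<close>
      preserves null sets, and completeness then covers every subset of it.\<close>
    then obtain X Y Z where XYZ: "A = X \<union> Y" "Y \<subseteq> Z" "Z \<in> null_sets lborel" "X \<in> sets lborel"
      by (auto elim: sets_completionE)
    have Xb: "X \<in> sets borel" "Z \<in> sets borel" using XYZ by (auto simp: null_sets_def)
    have ZM: "Z \<inter> \<Omega> \<in> null_sets M"
    proof -
      have "Z \<in> null_sets lebesgue" using XYZ(3) by (rule null_sets_completionI)
      then have "Z \<inter> \<Omega> \<in> null_sets lebesgue" using \<Omega>l by (rule null_set_Int2)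
      then show ?thesis unfolding M using \<Omega>l by (simp add: null_sets_restrict_space)
    qed
    have Zae: "AE t in M'. \<phi> t \<notin> Z" using \<phi>P[OF Xb(2)] null[OF ZM] by eventually_elim simp
    have Zs: "\<phi> -` Z \<inter> space M' \<in> sets M'" using \<phi>b Xb(2) by (rule measurable_sets)
    have "AE t in M'. t \<notin> \<phi> -` Z \<inter> space M'" using Zae by eventually_elim simp
    then have "\<phi> -` Z \<inter> space M' \<in> null_sets M'" using AE_iff_null_sets[OF Zs] by simp
    then have "\<phi> -` Y \<inter> space M' \<in> sets M'"
      by (rule complete_measure.complete[OF cM', rotated]) (use XYZ(2) in auto)
    moreover have "\<phi> -` X \<inter> space M' \<in> sets M'" using \<phi>b Xb(1) by (rule measurable_sets)
    ultimately have "(\<phi> -` X \<inter> space M') \<union> (\<phi> -` Y \<inter> space M') \<in> sets M'" by auto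
    also have "(\<phi> -` X \<inter> space M') \<union> (\<phi> -` Y \<inter> space M') = \<phi> -` A \<inter> space M'" using XYZ(1) by auto
    finally have s: "\<phi> -` A \<inter> space M' \<in> sets M'" .
    have XM: "X \<inter> \<Omega> \<in> sets M" by (rule bor[OF Xb(1)])
    have Zm: "Z \<inter> \<Omega> \<in> sets M" "space M - Z \<inter> \<Omega> \<in> sets M" using ZM by auto
    have D: "A \<inter> (space M - Z \<inter> \<Omega>) \<in> sets M" using A Zm by auto
    \<comment> \<open>These inclusions squeeze \<open>\<Phi> A\<close> between sets that agree with
      \<open>\<Phi> (X \<inter> \<Omega>)\<close> up to the null image of \<open>Z\<close>.\<close>
    have X_sub: "X \<inter> \<Omega> \<subseteq> A" "A \<inter> (space M - Z \<inter> \<Omega>) \<subseteq> X \<inter> \<Omega>" using XYZ by (auto simp: sp)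
    have "AE t in M'. \<phi> t \<in> A \<longleftrightarrow> t \<in> \<Phi> A"
      using \<phi>P[OF Xb(1)] Zae mono[OF XM A X_sub(1)] mono[OF D XM X_sub(2)] inter[OF A Zm(2)] compl[OF Zm(1)] null[OF ZM]
      by eventually_elim (use XYZ in blast)
    with s show ?thesis by blast
  qed
  have \<phi>m: "\<phi> \<in> measurable M' M"
    using pre \<phi>\<Omega> by (intro measurableI) (auto simp: sp)
  have "nonsingular M' M \<phi>"
    unfolding nonsingular_def
  proof (intro conjI ballI \<phi>m)
    fix A assume A: "A \<in> null_sets M"
    then have p: "\<phi> -` A \<inter> space M' \<in> sets M'" "AE t in M'. \<phi> t \<in> A \<longleftrightarrow> t \<in> \<Phi> A" using pre[of A] by auto
    have "AE t in M'. t \<notin> \<phi> -` A \<inter> space M'" using p(2) null[OF A] by eventually_elim simp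
    then show "\<phi> -` A \<inter> space M' \<in> null_sets M'" using AE_iff_null_sets[OF p(1)] by simp
  qed
  then show ?thesis using pre by blast
qed

lemma eq_ae_if_same_cuts:
  fixes \<phi> :: "'a \<Rightarrow> real" and \<psi> :: "'a \<Rightarrow> real"
  assumes "\<And>a. AE t in M. \<phi> t \<le> a \<longleftrightarrow> \<psi> t \<le> a"
  shows "AE t in M. \<phi> t = \<psi> t"
proof -
  have "AE t in M. \<forall>q::rat. \<phi> t \<le> of_rat q \<longleftrightarrow> \<psi> t \<le> of_rat q"
    using assms by (subst AE_all_countable) blast
  then show ?thesis
  proof eventually_elim
    case (elim t)
    show ?case
    proof (rule ccontr)
      assume "\<phi> t \<noteq> \<psi> t"
      then consider "\<phi> t < \<psi> t" | "\<psi> t < \<phi> t" by linarith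
      then show False
      proof cases
        case 1
        then obtain q where "\<phi> t < of_rat q" "of_rat q < \<psi> t" using of_rat_dense by blast
        then show False using elim[rule_format, of q] by auto
      next
        case 2
        then obtain q where "\<psi> t < of_rat q" "of_rat q < \<phi> t" using of_rat_dense by blast
        then show False using elim[rule_format, of q] by auto
      qed
    qed
  qed
qed

text \<open>Conjugating a cut-off by \<open>Q\<close> gives a Hermitian map on \<open>E'\<close>, so
  locality there produces \<open>\<Phi>\<close>; locality on \<open>E\<close> produces the set map
  of the inverse. The two point maps are mutually inverse because they restore every half-line, and
  countably many half-lines separate points.\<close>

lemma invertible_of_set_maps:
  fixes \<Omega> \<Omega>' :: "real set"
  assumes pair: "isometric_pair (lebesgue_on \<Omega>) E N (lebesgue_on \<Omega>') E' N' Q Qi"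
    and \<Omega>: "\<Omega> \<in> sets borel" "0 \<in> \<Omega>" and \<Omega>': "\<Omega>' \<in> sets borel" "0 \<in> \<Omega>'"
    and loc: "\<And>T C. ideal_function_space.hermitian (lebesgue_on \<Omega>) E N T C \<Longrightarrow> ideal_function_space.local_map (lebesgue_on \<Omega>) E T"
    and loc': "\<And>T C. ideal_function_space.hermitian (lebesgue_on \<Omega>') E' N' T C \<Longrightarrow> ideal_function_space.local_map (lebesgue_on \<Omega>') E' T"
  shows "\<exists>q \<phi>. q \<in> borel_measurable (lebesgue_on \<Omega>') \<and> invertible_transformation (lebesgue_on \<Omega>') (lebesgue_on \<Omega>) \<phi> \<and>
    (\<forall>f\<in>E. AE t in lebesgue_on \<Omega>'. Q f t = q t * f (\<phi> t))"
proof -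
  define M where "M = lebesgue_on \<Omega>"
  define M' where "M' = lebesgue_on \<Omega>'"
  interpret isometric_pair M E N M' E' N' Q Qi using pair by (simp add: M_def M'_def)
  interpret inv: isometric_pair M' E' N' M E N Qi Q by (rule swap)
  have complete: "complete_measure (lebesgue_on S)" if "S \<in> sets borel" for S :: "real set"
  proof
    have S: "S \<in> sets lebesgue" using that by (intro sets_completionI_sets) simp
    fix A B :: "real set" assume "B \<subseteq> A" "A \<in> null_sets (lebesgue_on S)"
    then have "A \<subseteq> S" "A \<in> null_sets lebesgue" "B \<subseteq> A" using S by (auto simp: null_sets_restrict_space)
    then have "B \<in> sets lebesgue" "B \<subseteq> S" using completion.complete by auto
    then show "B \<in> sets (lebesgue_on S)" using S by (auto simp: sets_restrict_space_iff)
  qed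
  have "\<forall>A\<in>sets M. \<exists>B. B \<in> sets M' \<and> (\<forall>f\<in>E. AE t in M'. Q (rho A f) t = rho B (Q f) t)"
  proof
    fix A assume "A \<in> sets M"
    from set_map_exists[OF loc'[folded M'_def] this]
    show "\<exists>B. B \<in> sets M' \<and> (\<forall>f\<in>E. AE t in M'. Q (rho A f) t = rho B (Q f) t)" by (simp only: Bex_def)
  qed
  then obtain \<Phi> where \<Phi>': "\<forall>A\<in>sets M. \<Phi> A \<in> sets M' \<and> (\<forall>f\<in>E. AE t in M'. Q (rho A f) t = rho (\<Phi> A) (Q f) t)"
    by (rule bchoice[THEN exE])
  have \<Phi>: "\<And>A. A \<in> sets M \<Longrightarrow> \<Phi> A \<in> sets M'" "\<And>A f. A \<in> sets M \<Longrightarrow> f \<in> E \<Longrightarrow> AE t in M'. Q (rho A f) t = rho (\<Phi> A) (Q f) t"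
    using \<Phi>' by auto
  have "\<forall>B\<in>sets M'. \<exists>A. A \<in> sets M \<and> (\<forall>g\<in>E'. AE t in M. Qi (rho B g) t = rho A (Qi g) t)"
  proof
    fix B assume "B \<in> sets M'"
    from inv.set_map_exists[OF loc[folded M_def] this]
    show "\<exists>A. A \<in> sets M \<and> (\<forall>g\<in>E'. AE t in M. Qi (rho B g) t = rho A (Qi g) t)" by (simp only: Bex_def)
  qed
  then obtain \<Psi> where \<Psi>': "\<forall>B\<in>sets M'. \<Psi> B \<in> sets M \<and> (\<forall>g\<in>E'. AE t in M. Qi (rho B g) t = rho (\<Psi> B) (Qi g) t)"
    by (rule bchoice[THEN exE])
  have \<Psi>: "\<And>B. B \<in> sets M' \<Longrightarrow> \<Psi> B \<in> sets M" "\<And>B g. B \<in> sets M' \<Longrightarrow> g \<in> E' \<Longrightarrow> AE t in M. Qi (rho B g) t = rho (\<Psi> B) (Qi g) t"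
    using \<Psi>' by auto
  have pair': "isometric_pair (lebesgue_on \<Omega>) E N M' E' N' Q Qi" and swap': "isometric_pair (lebesgue_on \<Omega>') E' N' M E N Qi Q"
    using pair swap by (simp_all add: M_def M'_def)
  have "\<exists>\<phi>. nonsingular M' M \<phi> \<and> (\<forall>A\<in>sets M. AE t in M'. \<phi> t \<in> A \<longleftrightarrow> t \<in> \<Phi> A)"
    by (rule point_map_exists[OF pair' M_def \<Omega> complete[OF \<Omega>'(1), folded M'_def] \<Phi>])
  then obtain \<phi> where \<phi>1: "nonsingular M' M \<phi>" and \<phi>_all: "\<forall>A\<in>sets M. AE t in M'. \<phi> t \<in> A \<longleftrightarrow> t \<in> \<Phi> A"
    by (elim exE conjE) (rule that)
  have \<phi>2: "AE t in M'. \<phi> t \<in> A \<longleftrightarrow> t \<in> \<Phi> A" if "A \<in> sets M" for A using \<phi>_all that by (rule bspec)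
  have "\<exists>\<psi>. nonsingular M M' \<psi> \<and> (\<forall>B\<in>sets M'. AE s in M. \<psi> s \<in> B \<longleftrightarrow> s \<in> \<Psi> B)"
    by (rule point_map_exists[OF swap' M'_def \<Omega>' complete[OF \<Omega>(1), folded M_def] \<Psi>])
  then obtain \<psi> where \<psi>1: "nonsingular M M' \<psi>" and \<psi>_all: "\<forall>B\<in>sets M'. AE s in M. \<psi> s \<in> B \<longleftrightarrow> s \<in> \<Psi> B"
    by (elim exE conjE) (rule that)
  have \<psi>2: "AE s in M. \<psi> s \<in> B \<longleftrightarrow> s \<in> \<Psi> B" if "B \<in> sets M'" for B using \<psi>_all that by (rule bspec)
  note \<phi> = \<phi>1 \<phi>2 and \<psi> = \<psi>1 \<psi>2
  have \<phi>m: "\<phi> \<in> measurable M' M" and \<psi>m: "\<psi> \<in> measurable M M'" using \<phi>(1) \<psi>(1) by (auto simp: nonsingular_def)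
  have cut: "{..a} \<inter> S \<in> sets (lebesgue_on S)" if "S \<in> sets borel" for a :: real and S
  proof -
    have "{..a} \<inter> S \<in> sets lebesgue" "S \<in> sets lebesgue" using that by (auto intro!: sets_completionI_sets)
    then show ?thesis by (auto simp: sets_restrict_space_iff)
  qed
  have inv1: "AE s in M. \<phi> (\<psi> s) = s"
  proof (rule eq_ae_if_same_cuts)
    fix a :: real
    have "AE s in M. \<phi> (\<psi> s) \<in> {..a} \<inter> \<Omega> \<longleftrightarrow> s \<in> {..a} \<inter> \<Omega>"
      by (rule pointwise_inverse[OF \<Phi> \<Psi>(2) \<phi>m \<phi>(2) \<psi>m \<psi>(2)]) (use cut[OF \<Omega>(1)] in \<open>auto simp: M_def\<close>)
    then show "AE s in M. \<phi> (\<psi> s) \<le> a \<longleftrightarrow> s \<le> a"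
      using AE_space
    proof eventually_elim
      case (elim s)
      have "\<phi> (\<psi> s) \<in> \<Omega>" using measurable_space[OF \<phi>m measurable_space[OF \<psi>m elim(2)]] by (simp add: M_def)
      moreover have "s \<in> \<Omega>" using elim by (simp add: M_def)
      ultimately show ?case using elim by auto
    qed
  qed
  have inv2: "AE t in M'. \<psi> (\<phi> t) = t"
  proof (rule eq_ae_if_same_cuts)
    fix a :: real
    have "AE s in M'. \<psi> (\<phi> s) \<in> {..a} \<inter> \<Omega>' \<longleftrightarrow> s \<in> {..a} \<inter> \<Omega>'"
      by (rule inv.pointwise_inverse[OF \<Psi> \<Phi>(2) \<psi>m \<psi>(2) \<phi>m \<phi>(2)]) (use cut[OF \<Omega>'(1)] in \<open>auto simp: M'_def\<close>)
    then show "AE s in M'. \<psi> (\<phi> s) \<le> a \<longleftrightarrow> s \<le> a"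
      using AE_space
    proof eventually_elim
      case (elim s)
      have "\<psi> (\<phi> s) \<in> \<Omega>'" using measurable_space[OF \<psi>m measurable_space[OF \<phi>m elim(2)]] by (simp add: M'_def)
      moreover have "s \<in> \<Omega>'" using elim by (simp add: M'_def)
      ultimately show ?case using elim by auto
    qed
  qed
  have comm: "AE t in M'. Q (rho A f) t = indicator A (\<phi> t) * Q f t" if "A \<in> sets M" "f \<in> E" for A f
    using \<Phi>(2)[OF that] \<phi>(2)[OF that(1)] by eventually_elim (auto simp: rho_apply indicator_def)
  have "\<exists>q\<in>borel_measurable M'. \<forall>f\<in>E. AE t in M'. Q f t = q t * f (\<phi> t)"
    by (rule weighted_composition[OF E.ideal_function_space_axioms E'.ideal_function_space_axioms lin _ zero_le_one \<phi>m comm])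
      (simp add: norm_Q)
  moreover have "invertible_transformation M' M \<phi>"
    unfolding invertible_transformation_def using \<phi>(1) \<psi>(1) inv1 inv2 by blast
  ultimately show ?thesis unfolding M_def M'_def by blast
qed

section \<open>Lebesgue measure and the theorem\<close>

text \<open>The inverse picks a preimage of each function. Such a choice respects classes and is
  linear modulo null sets because \<open>Q\<close> is injective on classes: every identity for
  \<open>Qi\<close> is checked after applying \<open>Q\<close>.\<close>

lemma isometric_pair_exists:
  assumes M: "ideal_function_space M E N" and M': "ideal_function_space M' E' N'"
    and iso: "isometric_isomorphism M E N M' E' N' Q"
  obtains Qi where "isometric_pair M E N M' E' N' Q Qi"
proof -
  interpret E: ideal_function_space M E N by fact
  interpret E': ideal_function_space M' E' N' by fact
  have lin: "linear_map M E M' E' Q" and isoN: "\<And>f. f \<in> E \<Longrightarrow> N' (Q f) = N f"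
    and onto: "\<And>g. g \<in> E' \<Longrightarrow> \<exists>f\<in>E. AE t in M'. Q f t = g t"
    using iso by (auto simp: isometric_isomorphism_def)
  have inj: "AE t in M. f t = h t" if fh: "f \<in> E" "h \<in> E" and eq: "AE t in M'. Q f t = Q h t" for f h
  proof -
    have d: "(\<lambda>t. f t - h t) \<in> E" by (rule E.diff_in[OF fh])
    have "AE t in M'. Q (\<lambda>t. f t - h t) t = 0"
      using E.linear_map_diff[OF lin fh] eq by eventually_elim simp
    then have "N (\<lambda>t. f t - h t) = 0"
      using E'.norm_eq_0[OF linear_map_in[OF lin d]] isoN[OF d] by simp
    then have "AE t in M. f t - h t = 0" using E.norm_eq_0[OF d] by simp
    then show ?thesis by eventually_elim simp
  qed
  define Qi where "Qi g = (SOME f. f \<in> E \<and> (AE t in M'. Q f t = g t))" for g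
  have Qi: "Qi g \<in> E \<and> (AE t in M'. Q (Qi g) t = g t)" if "g \<in> E'" for g
    unfolding Qi_def using onto[OF that] unfolding Bex_def by (rule someI_ex)
  have QiE: "Qi g \<in> E" if "g \<in> E'" for g using Qi[OF that] by (rule conjunct1)
  have QQi: "AE t in M'. Q (Qi g) t = g t" if "g \<in> E'" for g using Qi[OF that] by (rule conjunct2)
  have QiQ: "AE t in M. Qi (Q f) t = f t" if "f \<in> E" for f
    by (rule inj[OF QiE[OF linear_map_in[OF lin that]] that QQi[OF linear_map_in[OF lin that]]])
  have "isometric_isomorphism M' E' N' M E N Qi"
    unfolding isometric_isomorphism_def linear_map_def
  proof (intro conjI ballI allI impI)
    show "Qi g \<in> E" if "g \<in> E'" for g by (rule QiE[OF that])
    show "AE t in M. Qi f t = Qi g t" if "f \<in> E'" "g \<in> E'" "AE t in M'. f t = g t" for f g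
    proof (rule inj[OF QiE[OF that(1)] QiE[OF that(2)]])
      show "AE t in M'. Q (Qi f) t = Q (Qi g) t"
        using QQi[OF that(1)] QQi[OF that(2)] that(3) by eventually_elim simp
    qed
    show "AE t in M. Qi (\<lambda>s. f s + g s) t = Qi f t + Qi g t" if "f \<in> E'" "g \<in> E'" for f g
    proof (rule inj[OF QiE[OF E'.add[OF that]] E.add[OF QiE[OF that(1)] QiE[OF that(2)]]])
      show "AE t in M'. Q (Qi (\<lambda>s. f s + g s)) t = Q (\<lambda>t. Qi f t + Qi g t) t"
        using QQi[OF E'.add[OF that]] QQi[OF that(1)] QQi[OF that(2)] linear_map_add[OF lin QiE[OF that(1)] QiE[OF that(2)]]
        by eventually_elim simp
    qed
    show "AE t in M. Qi (\<lambda>s. c * f s) t = c * Qi f t" if "f \<in> E'" for c f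
    proof (rule inj[OF QiE[OF E'.scale[OF that]] E.scale[OF QiE[OF that]]])
      show "AE t in M'. Q (Qi (\<lambda>s. c * f s)) t = Q (\<lambda>t. c * Qi f t) t"
        using QQi[OF E'.scale[OF that, of c]] QQi[OF that] linear_map_scale[OF lin QiE[OF that], of c]
        by eventually_elim simp
    qed
    show "N (Qi g) = N' g" if "g \<in> E'" for g
      using isoN[OF QiE[OF that]] E'.norm_cong[OF linear_map_in[OF lin QiE[OF that]] that QQi[OF that]] by simp
    show "\<exists>g\<in>E'. AE t in M. Qi g t = f t" if "f \<in> E" for f
      using QiQ[OF that] linear_map_in[OF lin that] by blast
  qed
  then show ?thesis
    using iso QQi QiQ
    by (intro that isometric_pair.intro isometric_pair_axioms.intro M M') auto
qed

section \<open>Sigma-finiteness and atomlessness of Lebesgue measure\<close>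

lemma sigma_finite_lebesgue_on:
  fixes \<Omega> :: "real set"
  assumes "\<Omega> \<in> sets lebesgue"
  shows "sigma_finite_measure (lebesgue_on \<Omega>)"
proof (rule sigma_finite_measure_restrict_space[OF _ assms])
  show "sigma_finite_measure (lebesgue :: real measure)"
  proof
    have "\<exists>n::nat. x \<in> {- real n..real n}" for x :: real
    proof -
      obtain n :: nat where "\<bar>x\<bar> \<le> real n" using real_arch_simple by blast
      then show ?thesis by (intro exI[of _ n]) auto
    qed
    then have "\<Union> (range (\<lambda>n::nat. {- real n..real n})) = space lebesgue" by auto
    then show "\<exists>A. countable A \<and> A \<subseteq> sets lebesgue \<and> \<Union> A = space (lebesgue :: real measure) \<and> (\<forall>a\<in>A. emeasure lebesgue a \<noteq> \<infinity>)"
      by (intro exI[of _ "range (\<lambda>n::nat. {- real n..real n})"]) auto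
  qed
qed

text \<open>The measure of \<open>A \<inter> {-x..x}\<close> is a 2-Lipschitz function of
  \<open>x >= 0\<close>, since enlarging \<open>x\<close> adds at most two intervals. It starts at 0
  and tends to the measure of \<open>A\<close>, so the intermediate value theorem applies.\<close>

lemma lebesgue_atomless:
  fixes A :: "real set"
  assumes A: "A \<in> sets lebesgue" and r: "0 \<le> r" "ennreal r \<le> emeasure lebesgue A"
  shows "\<exists>B\<in>sets lebesgue. B \<subseteq> A \<and> emeasure lebesgue B = ennreal r"
\<comment> \<open>The full measure may be reached only in the limit of large \<open>x\<close>; in
  that case \<open>A\<close> itself is taken.\<close>
proof (cases "ennreal r = emeasure lebesgue A")
  case True
  then show ?thesis using A by auto
next
  case False
  then have less: "ennreal r < emeasure lebesgue A" using r(2) by simp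
  define X where "X x = A \<inter> {-x..x}" for x
  have Xm: "X x \<in> sets lebesgue" for x unfolding X_def using A by auto
  have Xf: "X x \<in> fmeasurable lebesgue" for x
    unfolding X_def by (rule fmeasurable_Int_fmeasurable[of "{-x..x}", unfolded Int_commute[of "{-x..x}"]]) (use A in auto)
  define F where "F x = measure lebesgue (X x)" for x
  have em: "emeasure lebesgue (X x) = ennreal (F x)" for x
    unfolding F_def using Xf by (rule emeasure_eq_measure2)
  have lip: "\<bar>F x - F y\<bar> \<le> 2 * \<bar>x - y\<bar>" if "0 \<le> x" "x \<le> y" for x y
  proof -
    have "F y \<le> measure lebesgue (X x \<union> ({-y..-x} \<union> {x..y}))"
      unfolding F_def
      by (rule measure_mono_fmeasurable) (use Xm Xf in \<open>auto simp: X_def intro!: fmeasurable.Un\<close>)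
    also have "\<dots> \<le> F x + measure lebesgue ({-y..-x} \<union> {x..y})"
      unfolding F_def by (rule measure_Un_le) (use Xm in auto)
    also have "measure lebesgue ({-y..-x} \<union> {x..y}) \<le> measure lebesgue {-y..-x} + measure lebesgue {x..y}"
      by (rule measure_Un_le) auto
    also have "\<dots> = 2 * (y - x)" using that by simp
    finally have "F y \<le> F x + 2 * (y - x)" by simp
    moreover have "F x \<le> F y"
      unfolding F_def by (rule measure_mono_fmeasurable) (use Xm Xf that in \<open>auto simp: X_def\<close>)
    ultimately show ?thesis using that by auto
  qed
  have cont: "continuous_on {0..n} F" for n :: real
  proof (rule lipschitz_on_continuous_on[of 2], rule lipschitz_onI)
    fix x y assume "x \<in> {0..n}" "y \<in> {0..n}"
    then show "dist (F x) (F y) \<le> 2 * dist x y"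
      using lip[of x y] lip[of y x] by (cases "x \<le> y") (auto simp: dist_real_def abs_minus_commute)
  qed simp
  have "(SUP n::nat. emeasure lebesgue (X (real n))) = emeasure lebesgue (\<Union>n::nat. X (real n))"
    by (rule SUP_emeasure_incseq) (use Xm in \<open>auto simp: incseq_def X_def\<close>)
  also have "(\<Union>n::nat. X (real n)) = A"
  proof (intro equalityI subsetI)
    fix x assume x: "x \<in> A"
    obtain n :: nat where "\<bar>x\<bar> \<le> real n" using real_arch_simple by blast
    then show "x \<in> (\<Union>n::nat. X (real n))" using x by (auto simp: X_def intro!: exI[of _ n])
  qed (auto simp: X_def)
  finally have "ennreal r < (SUP n::nat. emeasure lebesgue (X (real n)))" using less by simp
  then obtain n :: nat where "ennreal r < emeasure lebesgue (X (real n))" by (auto simp: less_SUP_iff)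
  then have rn: "r \<le> F (real n)" unfolding em using r(1) by (simp add: ennreal_less_iff)
  have "X 0 \<subseteq> {0}" by (auto simp: X_def)
  then have "emeasure lebesgue (X 0) \<le> emeasure lebesgue {0::real}" by (intro emeasure_mono) auto
  then have F0: "F 0 \<le> r" using r(1) by (simp add: em ennreal_eq_0_iff)
  obtain x where "0 \<le> x" "x \<le> real n" "F x = r"
    using IVT'[of F 0 r "real n"] F0 rn cont by auto
  then show ?thesis using Xm[of x] em[of x] by (auto simp: X_def)
qed

lemma lebesgue_on_atomless:
  fixes \<Omega> :: "real set"
  assumes \<Omega>: "\<Omega> \<in> sets lebesgue" and A: "A \<in> sets (lebesgue_on \<Omega>)" and r: "0 \<le> r" "ennreal r \<le> emeasure (lebesgue_on \<Omega>) A"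
  shows "\<exists>B\<in>sets (lebesgue_on \<Omega>). B \<subseteq> A \<and> emeasure (lebesgue_on \<Omega>) B = ennreal r"
proof -
  have A': "A \<in> sets lebesgue" "A \<subseteq> \<Omega>" using A \<Omega> by (auto simp: sets_restrict_space_iff)
  have em: "emeasure (lebesgue_on \<Omega>) S = emeasure lebesgue S" if "S \<subseteq> \<Omega>" for S
    using \<Omega> that by (intro emeasure_restrict_space) auto
  obtain B where "B \<in> sets lebesgue" "B \<subseteq> A" "emeasure lebesgue B = ennreal r"
    using lebesgue_atomless[OF A'(1) r(1)] r(2) em[OF A'(2)] by auto
  then show ?thesis using A' \<Omega> em[of B] by (intro bexI[of _ B]) (auto simp: sets_restrict_space_iff)
qed

theorem theorem1:
  fixes M1 M2 :: "real measure"
    and E1 E2 :: "(real \<Rightarrow> complex) set"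
    and N1 N2 :: "(real \<Rightarrow> complex) \<Rightarrow> real"
  assumes "M1 = lebesgue_on {0..1} \<or> M1 = lebesgue"
    and "M2 = lebesgue_on {0..1} \<or> M2 = lebesgue"
    and "ideal_banach_space M1 E1 N1"
    and "ideal_banach_space M2 E2 N2"
    and "contains_finite_indicators M1 E1"
    and "contains_finite_indicators M2 E2"
  shows "(projection_provided M1 E1 N1 \<and> projection_provided M2 E2 N2 \<and>
          free_from_L2_components M1 E1 N1 \<and> free_from_L2_components M2 E2 N2 \<longrightarrow>
          (\<forall>Q. isometric_isomorphism M1 E1 N1 M2 E2 N2 Q \<longrightarrow>
            (\<exists>q \<phi>. q \<in> borel_measurable M2 \<and> invertible_transformation M2 M1 \<phi> \<and>
              (\<forall>f\<in>E1. AE t in M2. Q f t = q t * f (\<phi> t)))))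
       \<and> (symmetric_space M1 E1 N1 \<and> symmetric_space M2 E2 N2 \<and>
          \<not> proportional_to_L2 M1 E1 N1 \<longrightarrow>
          (\<forall>Q. isometric_isomorphism M1 E1 N1 M2 E2 N2 Q \<longrightarrow>
            (\<exists>q \<phi>. q \<in> borel_measurable M2 \<and> invertible_transformation M2 M1 \<phi> \<and>
              (\<forall>f\<in>E1. AE t in M2. Q f t = q t * f (\<phi> t)))))"
proof -
  \<comment> \<open>The interval and the line are treated alike, as Lebesgue measure on a Borel set
    that contains the default value 0.\<close>
  have dom: "\<exists>\<Omega>. M = lebesgue_on \<Omega> \<and> \<Omega> \<in> sets borel \<and> 0 \<in> \<Omega> \<and> emeasure M (space M) > 0"
    if "M = lebesgue_on {0..1} \<or> M = lebesgue" for M :: "real measure"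
    using that
  proof
    assume "M = lebesgue_on {0..1}"
    then show ?thesis by (intro exI[of _ "{0..1}"]) (simp add: emeasure_restrict_space)
  next
    assume "M = lebesgue"
    then show ?thesis by (intro exI[of _ UNIV]) (simp add: lebesgue_on_UNIV_eq)
  qed
  obtain \<Omega>1 where \<Omega>1: "M1 = lebesgue_on \<Omega>1" "\<Omega>1 \<in> sets borel" "0 \<in> \<Omega>1" "emeasure M1 (space M1) > 0"
    using dom[OF assms(1)] by blast
  obtain \<Omega>2 where \<Omega>2: "M2 = lebesgue_on \<Omega>2" "\<Omega>2 \<in> sets borel" "0 \<in> \<Omega>2"
    using dom[OF assms(2)] by blast
  have \<Omega>l: "\<Omega>1 \<in> sets lebesgue" "\<Omega>2 \<in> sets lebesgue" using \<Omega>1(2) \<Omega>2(2) by (auto intro!: sets_completionI_sets)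
  have fs1: "ideal_function_space M1 E1 N1"
    using assms(3,5) sigma_finite_lebesgue_on[OF \<Omega>l(1)] \<Omega>1(1)
    by (intro ideal_function_space.intro ideal_function_space_axioms.intro) (auto simp: contains_finite_indicators_def)
  have fs2: "ideal_function_space M2 E2 N2"
    using assms(4,6) sigma_finite_lebesgue_on[OF \<Omega>l(2)] \<Omega>2(1)
    by (intro ideal_function_space.intro ideal_function_space_axioms.intro) (auto simp: contains_finite_indicators_def)
  have main: "\<exists>q \<phi>. q \<in> borel_measurable M2 \<and> invertible_transformation M2 M1 \<phi> \<and> (\<forall>f\<in>E1. AE t in M2. Q f t = q t * f (\<phi> t))"
    if iso: "isometric_isomorphism M1 E1 N1 M2 E2 N2 Q"
      and loc1: "\<And>T C. ideal_function_space.hermitian M1 E1 N1 T C \<Longrightarrow> ideal_function_space.local_map M1 E1 T"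
      and loc2: "\<And>T C. ideal_function_space.hermitian M2 E2 N2 T C \<Longrightarrow> ideal_function_space.local_map M2 E2 T" for Q
  proof -
    obtain Qi where "isometric_pair M1 E1 N1 M2 E2 N2 Q Qi" using isometric_pair_exists[OF fs1 fs2 iso] by blast
    then show ?thesis
      using invertible_of_set_maps[of \<Omega>1 E1 N1 \<Omega>2 E2 N2 Q Qi, OF _ \<Omega>1(2,3) \<Omega>2(2,3)] loc1 loc2
      unfolding \<Omega>1(1) \<Omega>2(1) by blast
  qed
  show ?thesis
  proof (intro conjI impI allI; elim conjE)
    fix Q
    assume a: "projection_provided M1 E1 N1" "projection_provided M2 E2 N2"
      "free_from_L2_components M1 E1 N1" "free_from_L2_components M2 E2 N2"
      and iso: "isometric_isomorphism M1 E1 N1 M2 E2 N2 Q"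
    show "\<exists>q \<phi>. q \<in> borel_measurable M2 \<and> invertible_transformation M2 M1 \<phi> \<and> (\<forall>f\<in>E1. AE t in M2. Q f t = q t * f (\<phi> t))"
      by (rule main[OF iso])
        (rule ideal_function_space.local_if_free[OF fs1 ideal_function_space.has_averaging_projection[OF fs1 a(1)] a(3)],
         assumption,
         rule ideal_function_space.local_if_free[OF fs2 ideal_function_space.has_averaging_projection[OF fs2 a(2)] a(4)],
         assumption)
  next
    fix Q
    assume s: "symmetric_space M1 E1 N1" "symmetric_space M2 E2 N2" and np: "\<not> proportional_to_L2 M1 E1 N1"
      and iso: "isometric_isomorphism M1 E1 N1 M2 E2 N2 Q"
    interpret S1: atomless_symmetric_space M1 E1 N1
      using lebesgue_on_atomless[OF \<Omega>l(1)]
      by (intro atomless_symmetric_space.intro fs1 s atomless_symmetric_space_axioms.intro) (auto simp: \<Omega>1(1))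
    interpret S2: atomless_symmetric_space M2 E2 N2
      using lebesgue_on_atomless[OF \<Omega>l(2)]
      by (intro atomless_symmetric_space.intro fs2 s atomless_symmetric_space_axioms.intro) (auto simp: \<Omega>2(1))
    \<comment> \<open>Proportionality of the second norm would pass back to the first one through
      the isometry; this gives locality on both spaces from the hypothesis on one.\<close>
    have np2: "\<not> proportional_to_L2 M2 E2 N2"
      using S1.proportional_of_isometric[OF iso _ \<Omega>1(4)] np by blast
    show "\<exists>q \<phi>. q \<in> borel_measurable M2 \<and> invertible_transformation M2 M1 \<phi> \<and> (\<forall>f\<in>E1. AE t in M2. Q f t = q t * f (\<phi> t))"
      by (rule main[OF iso]) (rule S1.local_if_not_proportional[OF np], assumption, rule S2.local_if_not_proportional[OF np2], assumption)
  qed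
qed

end
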